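(* If $(V,\times,I)$ is an infinitary lextensive category such that the functor $$J:\mathsf{Set}\to V,\qquad A\mapsto\sum_{a\in A}I_a$$ is fully faithful, then the pseudopullback of the projection of the object of objects $U_0:\mathsf{Cat}(V)\to V$ along $J$ is the category $V\text{-}\mathsf{Cat}$.
   Context: $\times$ is the cartesian product of $V$, $I$ is its terminal object, and $I_a=I$ for each $a\in A$, so $J(A)$ is the $A$-indexed copower of $I$. An infinitary lextensive category is a category with finite limits and small coproducts which are disjoint and stable under pullback. $\mathsf{Cat}(V)$ is the category of internal categories in $V$, and $U_0$ sends an internal category to its object of objects. $V\text{-}\mathsf{Cat}$ is the category of small categories enriched over the cartesian monoidal category $V$. The pseudopullback of $U_0$ along $J$ is, up to equivalence, the category of triples $(C,A,\theta)$ with $C$ in $\mathsf{Cat}(V)$, $A$ a set and $\theta:U_0(C)\cong J(A)$ an isomorphism in $V$. *)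

theory Defs
  imports Main "HOL-Library.FuncSet"
begin

record ('o, 'a) cat =
  Obj :: "'o set"
  Arr :: "'a set"
  Dom :: "'a \<Rightarrow> 'o"
  Cod :: "'a \<Rightarrow> 'o"
  Idt :: "'o \<Rightarrow> 'a"
  Cmp :: "'a \<Rightarrow> 'a \<Rightarrow> 'a" (infixl "\<cdot>\<index>" 70)

definition hom :: "('o, 'a, 'm) cat_scheme \<Rightarrow> 'o \<Rightarrow> 'o \<Rightarrow> 'a set" where
  "hom C a b = {f \<in> Arr C. Dom C f = a \<and> Cod C f = b}"

locale category =
  fixes C :: "('o, 'a, 'm) cat_scheme" (structure)
  assumes Dom_in: "f \<in> Arr C \<Longrightarrow> Dom C f \<in> Obj C"
    and Cod_in: "f \<in> Arr C \<Longrightarrow> Cod C f \<in> Obj C"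
    and Idt_in: "a \<in> Obj C \<Longrightarrow> Idt C a \<in> hom C a a"
    and Cmp_in: "\<lbrakk>f \<in> hom C a b; g \<in> hom C b c\<rbrakk> \<Longrightarrow> g \<cdot> f \<in> hom C a c"
    and Cmp_Idt: "f \<in> hom C a b \<Longrightarrow> f \<cdot> Idt C a = f"
    and Idt_Cmp: "f \<in> hom C a b \<Longrightarrow> Idt C b \<cdot> f = f"
    and Cmp_assoc: "\<lbrakk>f \<in> hom C a b; g \<in> hom C b c; h \<in> hom C c d\<rbrakk>
          \<Longrightarrow> h \<cdot> g \<cdot> f = h \<cdot> (g \<cdot> f)"

definition is_iso :: "('o, 'a, 'm) cat_scheme \<Rightarrow> 'a \<Rightarrow> bool" where
  "is_iso C f \<longleftrightarrow> f \<in> Arr C \<and> (\<exists>g \<in> hom C (Cod C f) (Dom C f).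
     g \<cdot>\<^bsub>C\<^esub> f = Idt C (Dom C f) \<and> f \<cdot>\<^bsub>C\<^esub> g = Idt C (Cod C f))"

definition is_mono :: "('o, 'a, 'm) cat_scheme \<Rightarrow> 'a \<Rightarrow> bool" where
  "is_mono C f \<longleftrightarrow> f \<in> Arr C \<and>
     (\<forall>x. \<forall>g \<in> hom C x (Dom C f). \<forall>h \<in> hom C x (Dom C f).
        f \<cdot>\<^bsub>C\<^esub> g = f \<cdot>\<^bsub>C\<^esub> h \<longrightarrow> g = h)"

record ('o, 'a, 'p, 'b) fctr =
  FO :: "'o \<Rightarrow> 'p"
  FA :: "'a \<Rightarrow> 'b"

locale is_functor =
  fixes C :: "('o, 'a, 'm) cat_scheme" and D :: "('p, 'b, 'n) cat_scheme"
    and F :: "('o, 'a, 'p, 'b) fctr"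
  assumes FO_in: "a \<in> Obj C \<Longrightarrow> FO F a \<in> Obj D"
    and FA_in: "f \<in> hom C a b \<Longrightarrow> FA F f \<in> hom D (FO F a) (FO F b)"
    and FA_Idt: "a \<in> Obj C \<Longrightarrow> FA F (Idt C a) = Idt D (FO F a)"
    and FA_Cmp: "\<lbrakk>f \<in> hom C a b; g \<in> hom C b c\<rbrakk>
          \<Longrightarrow> FA F (g \<cdot>\<^bsub>C\<^esub> f) = FA F g \<cdot>\<^bsub>D\<^esub> FA F f"

definition id_fctr :: "('o, 'a, 'o, 'a) fctr" where
  "id_fctr = \<lparr>FO = (\<lambda>a. a), FA = (\<lambda>f. f)\<rparr>"

definition comp_fctr ::
  "('p, 'b, 'q, 'c) fctr \<Rightarrow> ('o, 'a, 'p, 'b) fctr \<Rightarrow> ('o, 'a, 'q, 'c) fctr" where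
  "comp_fctr G F = \<lparr>FO = FO G \<circ> FO F, FA = FA G \<circ> FA F\<rparr>"

definition is_natural_iso ::
  "('o, 'a, 'm) cat_scheme \<Rightarrow> ('p, 'b, 'n) cat_scheme \<Rightarrow> ('o, 'a, 'p, 'b) fctr
    \<Rightarrow> ('o, 'a, 'p, 'b) fctr \<Rightarrow> ('o \<Rightarrow> 'b) \<Rightarrow> bool" where
  "is_natural_iso C D F G \<eta> \<longleftrightarrow>
     (\<forall>a \<in> Obj C. \<eta> a \<in> hom D (FO F a) (FO G a) \<and> is_iso D (\<eta> a)) \<and>
     (\<forall>a b. \<forall>f \<in> hom C a b. FA G f \<cdot>\<^bsub>D\<^esub> \<eta> a = \<eta> b \<cdot>\<^bsub>D\<^esub> FA F f)"

definition fully_faithful ::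
  "('o, 'a, 'm) cat_scheme \<Rightarrow> ('p, 'b, 'n) cat_scheme \<Rightarrow> ('o, 'a, 'p, 'b) fctr \<Rightarrow> bool" where
  "fully_faithful C D F \<longleftrightarrow>
     (\<forall>a \<in> Obj C. \<forall>b \<in> Obj C. bij_betw (FA F) (hom C a b) (hom D (FO F a) (FO F b)))"

definition equivalent_categories ::
  "('o, 'a, 'm) cat_scheme \<Rightarrow> ('p, 'b, 'n) cat_scheme \<Rightarrow> bool" where
  "equivalent_categories C D \<longleftrightarrow> category C \<and> category D \<and>
     (\<exists>F G \<eta> \<epsilon>. is_functor C D F \<and> is_functor D C G \<and>
        is_natural_iso C C id_fctr (comp_fctr G F) \<eta> \<and>
        is_natural_iso D D (comp_fctr F G) id_fctr \<epsilon>)"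

text \<open>The pseudopullback of two functors into \<open>C\<close>, in its standard model: objects are triples
  \<open>(a, b, \<theta>)\<close> with \<open>\<theta> : F a \<cong> G b\<close>; an arrow \<open>(x, y, u, v)\<close> records its source and target triples
  \<open>x\<close>, \<open>y\<close> together with its components \<open>u\<close> and \<open>v\<close>.\<close>

definition pseudopullback ::
  "('o, 'a, 'm) cat_scheme \<Rightarrow> ('p, 'b, 'n) cat_scheme \<Rightarrow> ('q, 'c, 'k) cat_scheme
    \<Rightarrow> ('o, 'a, 'q, 'c) fctr \<Rightarrow> ('p, 'b, 'q, 'c) fctr
    \<Rightarrow> ('o \<times> 'p \<times> 'c, ('o \<times> 'p \<times> 'c) \<times> ('o \<times> 'p \<times> 'c) \<times> 'a \<times> 'b) cat" where
  "pseudopullback A B C F G =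
    (let Ob = {(a, b, \<theta>). a \<in> Obj A \<and> b \<in> Obj B \<and> \<theta> \<in> hom C (FO F a) (FO G b) \<and> is_iso C \<theta>}
     in \<lparr>Obj = Ob,
         Arr = {((a, b, \<theta>), (a', b', \<theta>'), u, v) | a b \<theta> a' b' \<theta>' u v.
                  (a, b, \<theta>) \<in> Ob \<and> (a', b', \<theta>') \<in> Ob \<and> u \<in> hom A a a' \<and> v \<in> hom B b b' \<and>
                  FA G v \<cdot>\<^bsub>C\<^esub> \<theta> = \<theta>' \<cdot>\<^bsub>C\<^esub> FA F u},
         Dom = (\<lambda>(x, y, u, v). x),
         Cod = (\<lambda>(x, y, u, v). y),
         Idt = (\<lambda>(a, b, \<theta>). ((a, b, \<theta>), (a, b, \<theta>), Idt A a, Idt B b)),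
         Cmp = (\<lambda>(y, z, u', v') (x, y', u, v). (x, z, u' \<cdot>\<^bsub>A\<^esub> u, v' \<cdot>\<^bsub>B\<^esub> v))\<rparr>)"

definition is_terminal :: "('o, 'a, 'm) cat_scheme \<Rightarrow> 'o \<Rightarrow> bool" where
  "is_terminal C t \<longleftrightarrow> t \<in> Obj C \<and> (\<forall>x \<in> Obj C. \<exists>!f. f \<in> hom C x t)"

definition is_initial :: "('o, 'a, 'm) cat_scheme \<Rightarrow> 'o \<Rightarrow> bool" where
  "is_initial C t \<longleftrightarrow> t \<in> Obj C \<and> (\<forall>x \<in> Obj C. \<exists>!f. f \<in> hom C t x)"

definition is_cone ::
  "('d, 'e, 'k) cat_scheme \<Rightarrow> ('o, 'a, 'm) cat_scheme \<Rightarrow> ('d, 'e, 'o, 'a) fctr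
    \<Rightarrow> 'o \<Rightarrow> ('d \<Rightarrow> 'a) \<Rightarrow> bool" where
  "is_cone D C F x \<mu> \<longleftrightarrow> x \<in> Obj C \<and> (\<forall>d \<in> Obj D. \<mu> d \<in> hom C x (FO F d)) \<and>
     (\<forall>d e. \<forall>u \<in> hom D d e. FA F u \<cdot>\<^bsub>C\<^esub> \<mu> d = \<mu> e)"

definition is_limit ::
  "('d, 'e, 'k) cat_scheme \<Rightarrow> ('o, 'a, 'm) cat_scheme \<Rightarrow> ('d, 'e, 'o, 'a) fctr
    \<Rightarrow> 'o \<Rightarrow> ('d \<Rightarrow> 'a) \<Rightarrow> bool" where
  "is_limit D C F l \<pi> \<longleftrightarrow> is_cone D C F l \<pi> \<and>
     (\<forall>x \<mu>. is_cone D C F x \<mu> \<longrightarrow> (\<exists>!h. h \<in> hom C x l \<and> (\<forall>d \<in> Obj D. \<pi> d \<cdot>\<^bsub>C\<^esub> h = \<mu> d)))"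

text \<open>Every finite category is isomorphic to one whose objects and arrows are natural numbers.\<close>

definition has_finite_limits :: "('o, 'a, 'm) cat_scheme \<Rightarrow> bool" where
  "has_finite_limits C \<longleftrightarrow>
     (\<forall>(D :: (nat, nat) cat) F. category D \<and> finite (Obj D) \<and> finite (Arr D) \<and> is_functor D C F
        \<longrightarrow> (\<exists>l \<pi>. is_limit D C F l \<pi>))"

definition is_product :: "('o, 'a, 'm) cat_scheme \<Rightarrow> 'o \<Rightarrow> 'o \<Rightarrow> 'o \<Rightarrow> 'a \<Rightarrow> 'a \<Rightarrow> bool" where
  "is_product C x y p p1 p2 \<longleftrightarrow> p \<in> Obj C \<and> p1 \<in> hom C p x \<and> p2 \<in> hom C p y \<and>
     (\<forall>w. \<forall>u \<in> hom C w x. \<forall>v \<in> hom C w y.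
        \<exists>!h. h \<in> hom C w p \<and> p1 \<cdot>\<^bsub>C\<^esub> h = u \<and> p2 \<cdot>\<^bsub>C\<^esub> h = v)"

definition is_pullback ::
  "('o, 'a, 'm) cat_scheme \<Rightarrow> 'a \<Rightarrow> 'a \<Rightarrow> 'o \<Rightarrow> 'a \<Rightarrow> 'a \<Rightarrow> bool" where
  "is_pullback C f g p p1 p2 \<longleftrightarrow> f \<in> Arr C \<and> g \<in> Arr C \<and> Cod C f = Cod C g \<and> p \<in> Obj C \<and>
     p1 \<in> hom C p (Dom C f) \<and> p2 \<in> hom C p (Dom C g) \<and> f \<cdot>\<^bsub>C\<^esub> p1 = g \<cdot>\<^bsub>C\<^esub> p2 \<and>
     (\<forall>w. \<forall>u \<in> hom C w (Dom C f). \<forall>v \<in> hom C w (Dom C g). f \<cdot>\<^bsub>C\<^esub> u = g \<cdot>\<^bsub>C\<^esub> v \<longrightarrow>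
        (\<exists>!h. h \<in> hom C w p \<and> p1 \<cdot>\<^bsub>C\<^esub> h = u \<and> p2 \<cdot>\<^bsub>C\<^esub> h = v))"

definition is_coproduct ::
  "('o, 'a, 'm) cat_scheme \<Rightarrow> 'i set \<Rightarrow> ('i \<Rightarrow> 'o) \<Rightarrow> 'o \<Rightarrow> ('i \<Rightarrow> 'a) \<Rightarrow> bool" where
  "is_coproduct C A X s \<iota> \<longleftrightarrow> s \<in> Obj C \<and> (\<forall>a \<in> A. X a \<in> Obj C \<and> \<iota> a \<in> hom C (X a) s) \<and>
     (\<forall>y \<in> Obj C. \<forall>f. (\<forall>a \<in> A. f a \<in> hom C (X a) y) \<longrightarrow>
        (\<exists>!h. h \<in> hom C s y \<and> (\<forall>a \<in> A. h \<cdot>\<^bsub>C\<^esub> \<iota> a = f a)))"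

text \<open>Smallness is relative to a family \<open>\<U>\<close> of subsets of some type, subject only to the closure
  conditions below.  The small sets of a Grothendieck universe satisfy them (and, being closed under
  power sets, more); so does the family of all subsets of any infinite type.\<close>

locale small_sets =
  fixes \<U> :: "'i set set"
  assumes small_infinite: "\<exists>A \<in> \<U>. infinite A"
    and small_subset: "\<lbrakk>A \<in> \<U>; B \<subseteq> A\<rbrakk> \<Longrightarrow> B \<in> \<U>"
    and small_image: "A \<in> \<U> \<Longrightarrow> f ` A \<in> \<U>"
    and small_UN: "\<lbrakk>A \<in> \<U>; \<And>a. a \<in> A \<Longrightarrow> X a \<in> \<U>\<rbrakk> \<Longrightarrow> (\<Union>a \<in> A. X a) \<in> \<U>"

definition Set_cat :: "'i set set \<Rightarrow> ('i set, 'i set \<times> 'i set \<times> ('i \<Rightarrow> 'i)) cat" where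
  "Set_cat \<U> =
    \<lparr>Obj = \<U>,
     Arr = {(A, B, f). A \<in> \<U> \<and> B \<in> \<U> \<and> f \<in> A \<rightarrow>\<^sub>E B},
     Dom = (\<lambda>(A, B, f). A),
     Cod = (\<lambda>(A, B, f). B),
     Idt = (\<lambda>A. (A, A, \<lambda>a \<in> A. a)),
     Cmp = (\<lambda>(B, D, g) (A, B', f). (A, D, compose A g f))\<rparr>"

definition has_small_coproducts :: "'i set set \<Rightarrow> ('o, 'a, 'm) cat_scheme \<Rightarrow> bool" where
  "has_small_coproducts \<U> C \<longleftrightarrow>
     (\<forall>A \<in> \<U>. \<forall>X \<in> A \<rightarrow> Obj C. \<exists>s \<iota>. is_coproduct C A X s \<iota>)"

definition small_coproducts_disjoint :: "'i set set \<Rightarrow> ('o, 'a, 'm) cat_scheme \<Rightarrow> bool" where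
  "small_coproducts_disjoint \<U> C \<longleftrightarrow>
     (\<forall>A \<in> \<U>. \<forall>X s \<iota>. is_coproduct C A X s \<iota> \<longrightarrow>
        (\<forall>a \<in> A. is_mono C (\<iota> a)) \<and>
        (\<forall>a \<in> A. \<forall>b \<in> A. a \<noteq> b \<longrightarrow>
           (\<forall>p p1 p2. is_pullback C (\<iota> a) (\<iota> b) p p1 p2 \<longrightarrow> is_initial C p)))"

definition small_coproducts_stable :: "'i set set \<Rightarrow> ('o, 'a, 'm) cat_scheme \<Rightarrow> bool" where
  "small_coproducts_stable \<U> C \<longleftrightarrow>
     (\<forall>A \<in> \<U>. \<forall>X s \<iota>. is_coproduct C A X s \<iota> \<longrightarrow>
        (\<forall>y. \<forall>f \<in> hom C y s. \<forall>P p q.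
           (\<forall>a \<in> A. is_pullback C (\<iota> a) f (P a) (p a) (q a)) \<longrightarrow> is_coproduct C A P y q))"

definition infinitary_lextensive :: "'i set set \<Rightarrow> ('o, 'a, 'm) cat_scheme \<Rightarrow> bool" where
  "infinitary_lextensive \<U> C \<longleftrightarrow> category C \<and> has_finite_limits C \<and>
     has_small_coproducts \<U> C \<and> small_coproducts_disjoint \<U> C \<and> small_coproducts_stable \<U> C"

record ('o, 'a) ccat = "('o, 'a) cat" +
  Unit :: "'o"
  Prod :: "'o \<Rightarrow> 'o \<Rightarrow> 'o" (infixr "\<otimes>\<index>" 75)
  Pr1 :: "'o \<Rightarrow> 'o \<Rightarrow> 'a"
  Pr2 :: "'o \<Rightarrow> 'o \<Rightarrow> 'a"

definition is_cartesian :: "('o, 'a, 'm) ccat_scheme \<Rightarrow> bool" where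
  "is_cartesian V \<longleftrightarrow> is_terminal V (Unit V) \<and>
     (\<forall>x \<in> Obj V. \<forall>y \<in> Obj V. is_product V x y (x \<otimes>\<^bsub>V\<^esub> y) (Pr1 V x y) (Pr2 V x y))"

definition prod_pair :: "('o, 'a, 'm) ccat_scheme \<Rightarrow> 'a \<Rightarrow> 'a \<Rightarrow> 'a" where
  "prod_pair V u v = (THE h. h \<in> hom V (Dom V u) (Cod V u \<otimes>\<^bsub>V\<^esub> Cod V v) \<and>
     Pr1 V (Cod V u) (Cod V v) \<cdot>\<^bsub>V\<^esub> h = u \<and> Pr2 V (Cod V u) (Cod V v) \<cdot>\<^bsub>V\<^esub> h = v)"

definition prod_map :: "('o, 'a, 'm) ccat_scheme \<Rightarrow> 'a \<Rightarrow> 'a \<Rightarrow> 'a" where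
  "prod_map V u v = prod_pair V (u \<cdot>\<^bsub>V\<^esub> Pr1 V (Dom V u) (Dom V v)) (v \<cdot>\<^bsub>V\<^esub> Pr2 V (Dom V u) (Dom V v))"

text \<open>The associator \<open>(x \<otimes> y) \<otimes> z \<rightarrow> x \<otimes> (y \<otimes> z)\<close>.\<close>

definition prod_assoc :: "('o, 'a, 'm) ccat_scheme \<Rightarrow> 'o \<Rightarrow> 'o \<Rightarrow> 'o \<Rightarrow> 'a" where
  "prod_assoc V x y z =
     prod_pair V (Pr1 V x y \<cdot>\<^bsub>V\<^esub> Pr1 V (x \<otimes>\<^bsub>V\<^esub> y) z)
       (prod_pair V (Pr2 V x y \<cdot>\<^bsub>V\<^esub> Pr1 V (x \<otimes>\<^bsub>V\<^esub> y) z) (Pr2 V (x \<otimes>\<^bsub>V\<^esub> y) z))"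

definition copower_cocone :: "('o, 'a, 'm) ccat_scheme \<Rightarrow> 'i set \<Rightarrow> 'o \<times> ('i \<Rightarrow> 'a)" where
  "copower_cocone V A = (SOME (s, \<iota>). is_coproduct V A (\<lambda>_. Unit V) s \<iota>)"

definition copower :: "('o, 'a, 'm) ccat_scheme \<Rightarrow> 'i set \<Rightarrow> 'o" where
  "copower V A = fst (copower_cocone V A)"

definition copower_inj :: "('o, 'a, 'm) ccat_scheme \<Rightarrow> 'i set \<Rightarrow> 'i \<Rightarrow> 'a" where
  "copower_inj V A = snd (copower_cocone V A)"

definition J_fctr ::
  "('o, 'a, 'm) ccat_scheme \<Rightarrow> ('i set, 'i set \<times> 'i set \<times> ('i \<Rightarrow> 'i), 'o, 'a) fctr" where
  "J_fctr V =
    \<lparr>FO = copower V,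
     FA = (\<lambda>(A, B, f). THE h. h \<in> hom V (copower V A) (copower V B) \<and>
             (\<forall>a \<in> A. h \<cdot>\<^bsub>V\<^esub> copower_inj V A a = copower_inj V B (f a)))\<rparr>"

definition pullback_cone :: "('o, 'a, 'm) cat_scheme \<Rightarrow> 'a \<Rightarrow> 'a \<Rightarrow> 'o \<times> 'a \<times> 'a" where
  "pullback_cone C f g = (SOME (p, p1, p2). is_pullback C f g p p1 p2)"

definition pb_obj :: "('o, 'a, 'm) cat_scheme \<Rightarrow> 'a \<Rightarrow> 'a \<Rightarrow> 'o" where
  "pb_obj C f g = fst (pullback_cone C f g)"

definition pb_fst :: "('o, 'a, 'm) cat_scheme \<Rightarrow> 'a \<Rightarrow> 'a \<Rightarrow> 'a" where
  "pb_fst C f g = fst (snd (pullback_cone C f g))"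

definition pb_snd :: "('o, 'a, 'm) cat_scheme \<Rightarrow> 'a \<Rightarrow> 'a \<Rightarrow> 'a" where
  "pb_snd C f g = snd (snd (pullback_cone C f g))"

definition pb_pair :: "('o, 'a, 'm) cat_scheme \<Rightarrow> 'a \<Rightarrow> 'a \<Rightarrow> 'a \<Rightarrow> 'a \<Rightarrow> 'a" where
  "pb_pair C f g u v = (THE h. h \<in> hom C (Dom C u) (pb_obj C f g) \<and>
     pb_fst C f g \<cdot>\<^bsub>C\<^esub> h = u \<and> pb_snd C f g \<cdot>\<^bsub>C\<^esub> h = v)"

record ('o, 'a) icat =
  icat0 :: "'o"
  icat1 :: "'o"
  isrc :: "'a"
  itgt :: "'a"
  iidt :: "'a"
  icmp :: "'a"

text \<open>Composable pairs \<open>(g, f)\<close>, with \<open>g\<close> first and \<open>isrc g = itgt f\<close>, are the pullback of \<open>isrc\<close>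
  along \<open>itgt\<close>, and \<open>icmp\<close> sends \<open>(g, f)\<close> to the composite of \<open>f\<close> followed by \<open>g\<close>.  Composable
  triples \<open>((h, g), f)\<close> are the pullback of the source of the second component along \<open>itgt\<close>.\<close>

abbreviation pairs_obj :: "('o, 'a, 'm) cat_scheme \<Rightarrow> ('o, 'a) icat \<Rightarrow> 'o" where
  "pairs_obj V C \<equiv> pb_obj V (isrc C) (itgt C)"

abbreviation pairs_fst :: "('o, 'a, 'm) cat_scheme \<Rightarrow> ('o, 'a) icat \<Rightarrow> 'a" where
  "pairs_fst V C \<equiv> pb_fst V (isrc C) (itgt C)"

abbreviation pairs_snd :: "('o, 'a, 'm) cat_scheme \<Rightarrow> ('o, 'a) icat \<Rightarrow> 'a" where
  "pairs_snd V C \<equiv> pb_snd V (isrc C) (itgt C)"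

abbreviation pairs_pair :: "('o, 'a, 'm) cat_scheme \<Rightarrow> ('o, 'a) icat \<Rightarrow> 'a \<Rightarrow> 'a \<Rightarrow> 'a" where
  "pairs_pair V C \<equiv> pb_pair V (isrc C) (itgt C)"

abbreviation triples_fst :: "('o, 'a, 'm) cat_scheme \<Rightarrow> ('o, 'a) icat \<Rightarrow> 'a" where
  "triples_fst V C \<equiv> pb_fst V (isrc C \<cdot>\<^bsub>V\<^esub> pairs_snd V C) (itgt C)"

abbreviation triples_snd :: "('o, 'a, 'm) cat_scheme \<Rightarrow> ('o, 'a) icat \<Rightarrow> 'a" where
  "triples_snd V C \<equiv> pb_snd V (isrc C \<cdot>\<^bsub>V\<^esub> pairs_snd V C) (itgt C)"

locale internal_category =
  fixes V :: "('o, 'a, 'm) cat_scheme" (structure) and C :: "('o, 'a) icat"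
  assumes icat0_in: "icat0 C \<in> Obj V"
    and icat1_in: "icat1 C \<in> Obj V"
    and isrc_in: "isrc C \<in> hom V (icat1 C) (icat0 C)"
    and itgt_in: "itgt C \<in> hom V (icat1 C) (icat0 C)"
    and iidt_in: "iidt C \<in> hom V (icat0 C) (icat1 C)"
    and icmp_in: "icmp C \<in> hom V (pairs_obj V C) (icat1 C)"
    and isrc_iidt: "isrc C \<cdot> iidt C = Idt V (icat0 C)"
    and itgt_iidt: "itgt C \<cdot> iidt C = Idt V (icat0 C)"
    and isrc_icmp: "isrc C \<cdot> icmp C = isrc C \<cdot> pairs_snd V C"
    and itgt_icmp: "itgt C \<cdot> icmp C = itgt C \<cdot> pairs_fst V C"
    and icmp_unit_right:
      "icmp C \<cdot> pairs_pair V C (Idt V (icat1 C)) (iidt C \<cdot> isrc C) = Idt V (icat1 C)"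
    and icmp_unit_left:
      "icmp C \<cdot> pairs_pair V C (iidt C \<cdot> itgt C) (Idt V (icat1 C)) = Idt V (icat1 C)"
    and icmp_assoc:
      "icmp C \<cdot> pairs_pair V C (icmp C \<cdot> triples_fst V C) (triples_snd V C) =
       icmp C \<cdot> pairs_pair V C (pairs_fst V C \<cdot> triples_fst V C)
         (icmp C \<cdot> pairs_pair V C (pairs_snd V C \<cdot> triples_fst V C) (triples_snd V C))"

record ('o, 'a) ifun =
  ifdom :: "('o, 'a) icat"
  ifcod :: "('o, 'a) icat"
  ifun0 :: "'a"
  ifun1 :: "'a"

locale internal_functor =
  fixes V :: "('o, 'a, 'm) cat_scheme" (structure) and F :: "('o, 'a) ifun"
  assumes ifdom: "internal_category V (ifdom F)"
    and ifcod: "internal_category V (ifcod F)"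
    and ifun0_in: "ifun0 F \<in> hom V (icat0 (ifdom F)) (icat0 (ifcod F))"
    and ifun1_in: "ifun1 F \<in> hom V (icat1 (ifdom F)) (icat1 (ifcod F))"
    and ifun_isrc: "isrc (ifcod F) \<cdot> ifun1 F = ifun0 F \<cdot> isrc (ifdom F)"
    and ifun_itgt: "itgt (ifcod F) \<cdot> ifun1 F = ifun0 F \<cdot> itgt (ifdom F)"
    and ifun_iidt: "ifun1 F \<cdot> iidt (ifdom F) = iidt (ifcod F) \<cdot> ifun0 F"
    and ifun_icmp: "ifun1 F \<cdot> icmp (ifdom F) =
      icmp (ifcod F) \<cdot> pairs_pair V (ifcod F)
        (ifun1 F \<cdot> pairs_fst V (ifdom F)) (ifun1 F \<cdot> pairs_snd V (ifdom F))"

definition Cat_int :: "('o, 'a, 'm) cat_scheme \<Rightarrow> (('o, 'a) icat, ('o, 'a) ifun) cat" where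
  "Cat_int V =
    \<lparr>Obj = {C. internal_category V C},
     Arr = {F. internal_functor V F},
     Dom = ifdom,
     Cod = ifcod,
     Idt = (\<lambda>C. \<lparr>ifdom = C, ifcod = C, ifun0 = Idt V (icat0 C), ifun1 = Idt V (icat1 C)\<rparr>),
     Cmp = (\<lambda>G F. \<lparr>ifdom = ifdom F, ifcod = ifcod G,
                   ifun0 = ifun0 G \<cdot>\<^bsub>V\<^esub> ifun0 F, ifun1 = ifun1 G \<cdot>\<^bsub>V\<^esub> ifun1 F\<rparr>)\<rparr>"

definition U0_fctr :: "(('o, 'a) icat, ('o, 'a) ifun, 'o, 'a) fctr" where
  "U0_fctr = \<lparr>FO = icat0, FA = ifun0\<rparr>"

text \<open>The composition \<open>ecmp C a b c\<close> has type \<open>C(b, c) \<otimes> C(a, b) \<rightarrow> C(a, c)\<close>.  The structure is required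
  to be \<open>undefined\<close> off the object set, so that equality of these records is equality of enriched
  categories and functors.\<close>

record ('i, 'o, 'a) ecat =
  eob :: "'i set"
  ehom :: "'i \<Rightarrow> 'i \<Rightarrow> 'o"
  eidt :: "'i \<Rightarrow> 'a"
  ecmp :: "'i \<Rightarrow> 'i \<Rightarrow> 'i \<Rightarrow> 'a"

locale enriched_category =
  fixes \<U> :: "'i set set" and V :: "('o, 'a, 'm) ccat_scheme" (structure)
    and C :: "('i, 'o, 'a) ecat"
  assumes eob_small: "eob C \<in> \<U>"
    and ehom_in: "\<lbrakk>a \<in> eob C; b \<in> eob C\<rbrakk> \<Longrightarrow> ehom C a b \<in> Obj V"
    and eidt_in: "a \<in> eob C \<Longrightarrow> eidt C a \<in> hom V (Unit V) (ehom C a a)"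
    and ecmp_in: "\<lbrakk>a \<in> eob C; b \<in> eob C; c \<in> eob C\<rbrakk>
          \<Longrightarrow> ecmp C a b c \<in> hom V (ehom C b c \<otimes> ehom C a b) (ehom C a c)"
    and ecmp_assoc: "\<lbrakk>a \<in> eob C; b \<in> eob C; c \<in> eob C; d \<in> eob C\<rbrakk>
          \<Longrightarrow> ecmp C a b d \<cdot> prod_map V (ecmp C b c d) (Idt V (ehom C a b)) =
              ecmp C a c d \<cdot> prod_map V (Idt V (ehom C c d)) (ecmp C a b c)
                \<cdot> prod_assoc V (ehom C c d) (ehom C b c) (ehom C a b)"
    and ecmp_unit_right: "\<lbrakk>a \<in> eob C; b \<in> eob C\<rbrakk>
          \<Longrightarrow> ecmp C a a b \<cdot> prod_map V (Idt V (ehom C a b)) (eidt C a) =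
              Pr1 V (ehom C a b) (Unit V)"
    and ecmp_unit_left: "\<lbrakk>a \<in> eob C; b \<in> eob C\<rbrakk>
          \<Longrightarrow> ecmp C a b b \<cdot> prod_map V (eidt C b) (Idt V (ehom C a b)) =
              Pr2 V (Unit V) (ehom C a b)"
    and ehom_undef: "\<not> (a \<in> eob C \<and> b \<in> eob C) \<Longrightarrow> ehom C a b = undefined"
    and eidt_undef: "a \<notin> eob C \<Longrightarrow> eidt C a = undefined"
    and ecmp_undef: "\<not> (a \<in> eob C \<and> b \<in> eob C \<and> c \<in> eob C) \<Longrightarrow> ecmp C a b c = undefined"

record ('i, 'o, 'a) efun =
  efdom :: "('i, 'o, 'a) ecat"
  efcod :: "('i, 'o, 'a) ecat"
  efob :: "'i \<Rightarrow> 'i"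
  efhom :: "'i \<Rightarrow> 'i \<Rightarrow> 'a"

locale enriched_functor =
  fixes \<U> :: "'i set set" and V :: "('o, 'a, 'm) ccat_scheme" (structure)
    and F :: "('i, 'o, 'a) efun"
  assumes efdom: "enriched_category \<U> V (efdom F)"
    and efcod: "enriched_category \<U> V (efcod F)"
    and efob_in: "efob F \<in> eob (efdom F) \<rightarrow>\<^sub>E eob (efcod F)"
    and efhom_in: "\<lbrakk>a \<in> eob (efdom F); b \<in> eob (efdom F)\<rbrakk>
          \<Longrightarrow> efhom F a b \<in> hom V (ehom (efdom F) a b) (ehom (efcod F) (efob F a) (efob F b))"
    and efhom_eidt: "a \<in> eob (efdom F)
          \<Longrightarrow> efhom F a a \<cdot> eidt (efdom F) a = eidt (efcod F) (efob F a)"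
    and efhom_ecmp: "\<lbrakk>a \<in> eob (efdom F); b \<in> eob (efdom F); c \<in> eob (efdom F)\<rbrakk>
          \<Longrightarrow> efhom F a c \<cdot> ecmp (efdom F) a b c =
              ecmp (efcod F) (efob F a) (efob F b) (efob F c)
                \<cdot> prod_map V (efhom F b c) (efhom F a b)"
    and efhom_undef: "\<not> (a \<in> eob (efdom F) \<and> b \<in> eob (efdom F)) \<Longrightarrow> efhom F a b = undefined"

definition Cat_enr ::
  "'i set set \<Rightarrow> ('o, 'a, 'm) ccat_scheme \<Rightarrow> (('i, 'o, 'a) ecat, ('i, 'o, 'a) efun) cat" where
  "Cat_enr \<U> V =
    \<lparr>Obj = {C. enriched_category \<U> V C},
     Arr = {F. enriched_functor \<U> V F},
     Dom = efdom,
     Cod = efcod,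
     Idt = (\<lambda>C. \<lparr>efdom = C, efcod = C, efob = (\<lambda>a \<in> eob C. a),
                 efhom = (\<lambda>a b. if a \<in> eob C \<and> b \<in> eob C then Idt V (ehom C a b) else undefined)\<rparr>),
     Cmp = (\<lambda>G F. \<lparr>efdom = efdom F, efcod = efcod G, efob = compose (eob (efdom F)) (efob G) (efob F),
                   efhom = (\<lambda>a b. if a \<in> eob (efdom F) \<and> b \<in> eob (efdom F)
                     then efhom G (efob F a) (efob F b) \<cdot>\<^bsub>V\<^esub> efhom F a b else undefined)\<rparr>)\<rparr>"

end

theory Submission
  imports Defs
begin

text \<open>Write \<open>C\<^sub>0\<close>, \<open>C\<^sub>1\<close> for the objects of objects and of arrows of an internal category \<open>C\<close>, and \<open>e a : I \<rightarrow> C\<^sub>0\<close>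
  (\<open>a \<in> A\<close>) for the coproduct injections given by \<open>\<theta> : C\<^sub>0 \<cong> J A\<close>.  Call a generalised element \<open>x : W \<rightarrow> C\<^sub>1\<close> of type
  \<open>(a, b)\<close> if its source and target are the constants \<open>e a\<close> and \<open>e b\<close>.  Enriched hom objects \<open>E(a, b)\<close> represent \<open>C\<close>
  if maps \<open>j a b : E(a, b) \<rightarrow> C\<^sub>1\<close> are universal among the elements of type \<open>(a, b)\<close> and carry enriched to
  internal identities and composites.  Pulling back the \<open>e a\<close> shows that every \<open>(C, A, \<theta>)\<close> is represented;
  disjointness and stability show that the coproduct of all \<open>E(a, b)\<close> carries an internal category represented
  by \<open>E\<close>.  By stability every \<open>W \<rightarrow> C\<^sub>0\<close> splits \<open>W\<close> into pieces on which it is constant, so maps out of \<open>C\<^sub>1\<close>, and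
  equations between them, are determined by typed elements; this makes internal and enriched functors
  between represented pairs correspond bijectively.  The representations thus form a span of categories whose
  legs are surjective on objects and fully faithful.\<close>

section \<open>Equivalences from spans of fully faithful surjections\<close>

text \<open>Hom objects and objects of arrows are determined only up to isomorphism, so a functor in
  either direction involves choices. Keeping the maps \<open>j\<close> as data confines the choices
  to one abstract argument, in which functoriality and naturality come from unique lifting. The laws
  on both sides are stated through iterated pullbacks or products; by evaluation at arbitrary
  elements and at the universal ones (identities, projections) they become the same algebraic
  equations, with no associators or objects of triples left. The delicate point is that an element
  can have several types: if \<open>e a\<close> and \<open>e b\<close> with
  \<open>a \<noteq> b\<close> agree on \<open>W\<close>, then \<open>W\<close> is initial but is
  still a legitimate domain. No construction may therefore read off "the" type of an element. Gluing
  prescribes a value for every type separately and asks only for naturality in the element; for a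
  composable pair the target of the second element is replaced by the source of the first instead of
  being compared with it.\<close>

lemma in_hom_iff: "f \<in> hom C a b \<longleftrightarrow> f \<in> Arr C \<and> Dom C f = a \<and> Cod C f = b"
  by (simp add: hom_def)

context category
begin

lemma Cmp_arr [simp]:
  assumes "f \<in> Arr C" "g \<in> Arr C" "Dom C g = Cod C f"
  shows "g \<cdot> f \<in> Arr C" "Dom C (g \<cdot> f) = Dom C f" "Cod C (g \<cdot> f) = Cod C g"
  using Cmp_in[of f "Dom C f" "Cod C f" g "Cod C g"] assms by (auto simp: in_hom_iff)

lemma Cmp_assoc' [simp]:
  assumes "f \<in> Arr C" "g \<in> Arr C" "h \<in> Arr C" "Dom C g = Cod C f" "Dom C h = Cod C g"
  shows "h \<cdot> g \<cdot> f = h \<cdot> (g \<cdot> f)"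
  using Cmp_assoc[of f "Dom C f" "Cod C f" g "Cod C g" h "Cod C h"] assms by (auto simp: in_hom_iff)

lemma Idt_arr [simp]:
  assumes "a \<in> Obj C"
  shows "Idt C a \<in> Arr C" "Dom C (Idt C a) = a" "Cod C (Idt C a) = a"
  using Idt_in[OF assms] by (auto simp: in_hom_iff)

lemma Cmp_Idt' [simp]: "f \<in> Arr C \<Longrightarrow> Dom C f = a \<Longrightarrow> f \<cdot> Idt C a = f"
  using Cmp_Idt[of f a "Cod C f"] by (auto simp: in_hom_iff)

lemma Idt_Cmp' [simp]: "f \<in> Arr C \<Longrightarrow> Cod C f = a \<Longrightarrow> Idt C a \<cdot> f = f"
  using Idt_Cmp[of f "Dom C f" a] by (auto simp: in_hom_iff)

lemma Dom_Obj [simp]: "f \<in> Arr C \<Longrightarrow> Dom C f \<in> Obj C"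
  and Cod_Obj [simp]: "f \<in> Arr C \<Longrightarrow> Cod C f \<in> Obj C"
  by (auto intro: Dom_in Cod_in)

lemma Dom_Obj': "f \<in> Arr C \<Longrightarrow> Dom C f = a \<Longrightarrow> a \<in> Obj C"
  and Cod_Obj': "f \<in> Arr C \<Longrightarrow> Cod C f = a \<Longrightarrow> a \<in> Obj C"
  by auto

lemma Cmp_reassoc:
  assumes "g \<cdot> f = h" "f \<in> Arr C" "g \<in> Arr C" "k \<in> Arr C" "Dom C g = Cod C f" "Dom C f = Cod C k"
  shows "g \<cdot> (f \<cdot> k) = h \<cdot> k"
  using assms Cmp_assoc' by metis

end

text \<open>A span of categories whose apex is never built: its objects would be \<open>R\<close>,
  its arrows the pairs \<open>(u, F)\<close> related by \<open>T\<close>. The two lifting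
  assumptions make both legs fully faithful, so for fixed \<open>r\<close> and \<open>r'\<close> the
  relation \<open>T\<close> is a bijection between hom sets; compatibility with identities and
  composites makes it functorial.\<close>

locale category_span =
  X: category X + Y: category Y
  for X :: "('o, 'a, 'm) cat_scheme" and Y :: "('p, 'b, 'n) cat_scheme" +
  fixes R :: "'r set" and p :: "'r \<Rightarrow> 'o" and q :: "'r \<Rightarrow> 'p"
    and T :: "'r \<Rightarrow> 'r \<Rightarrow> 'a \<Rightarrow> 'b \<Rightarrow> bool"
  assumes p_in: "r \<in> R \<Longrightarrow> p r \<in> Obj X"
    and q_in: "r \<in> R \<Longrightarrow> q r \<in> Obj Y"
    and p_surj: "x \<in> Obj X \<Longrightarrow> \<exists>r \<in> R. p r = x"
    and q_surj: "y \<in> Obj Y \<Longrightarrow> \<exists>r \<in> R. q r = y"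
    and T_lift: "\<lbrakk>r \<in> R; r' \<in> R; u \<in> hom X (p r) (p r')\<rbrakk> \<Longrightarrow> \<exists>!F. F \<in> hom Y (q r) (q r') \<and> T r r' u F"
    and T_lift': "\<lbrakk>r \<in> R; r' \<in> R; F \<in> hom Y (q r) (q r')\<rbrakk> \<Longrightarrow> \<exists>!u. u \<in> hom X (p r) (p r') \<and> T r r' u F"
    and T_Idt: "r \<in> R \<Longrightarrow> T r r (Idt X (p r)) (Idt Y (q r))"
    and T_Cmp: "\<lbrakk>r \<in> R; r' \<in> R; r'' \<in> R; u \<in> hom X (p r) (p r'); u' \<in> hom X (p r') (p r'');
        F \<in> hom Y (q r) (q r'); F' \<in> hom Y (q r') (q r''); T r r' u F; T r' r'' u' F'\<rbrakk>
        \<Longrightarrow> T r r'' (u' \<cdot>\<^bsub>X\<^esub> u) (F' \<cdot>\<^bsub>Y\<^esub> F)"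
begin

definition sect :: "'o \<Rightarrow> 'r" where
  "sect x = (SOME r. r \<in> R \<and> p r = x)"

definition lift :: "'r \<Rightarrow> 'r \<Rightarrow> 'a \<Rightarrow> 'b" where
  "lift r r' u = (THE F. F \<in> hom Y (q r) (q r') \<and> T r r' u F)"

definition lift_fctr :: "('o, 'a, 'p, 'b) fctr" where
  "lift_fctr = \<lparr>FO = (\<lambda>x. q (sect x)), FA = (\<lambda>u. lift (sect (Dom X u)) (sect (Cod X u)) u)\<rparr>"

lemma sect:
  assumes "x \<in> Obj X"
  shows "sect x \<in> R" "p (sect x) = x"
proof -
  have "\<exists>r. r \<in> R \<and> p r = x"
    using p_surj[OF assms] by blast
  from someI_ex[OF this] show "sect x \<in> R" "p (sect x) = x"
    by (auto simp: sect_def)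
qed

lemma lift:
  assumes "r \<in> R" "r' \<in> R" "u \<in> hom X (p r) (p r')"
  shows "lift r r' u \<in> hom Y (q r) (q r')" "T r r' u (lift r r' u)"
  using theI'[OF T_lift[OF assms]] by (auto simp: lift_def)

lemma lift_eq:
  assumes "r \<in> R" "r' \<in> R" "u \<in> hom X (p r) (p r')" "F \<in> hom Y (q r) (q r')" "T r r' u F"
  shows "lift r r' u = F"
  using T_lift[OF assms(1-3)] lift[OF assms(1-3)] assms(4-5) by blast

lemma is_functor_lift_fctr: "is_functor X Y lift_fctr"
proof
  fix a assume a: "a \<in> Obj X"
  show "FO lift_fctr a \<in> Obj Y"
    using a by (simp add: lift_fctr_def q_in sect)
  show "FA lift_fctr (Idt X a) = Idt Y (FO lift_fctr a)"
    using a T_Idt[of "sect a"]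
    by (auto simp: lift_fctr_def sect q_in intro!: lift_eq Y.Idt_in X.Idt_in)
next
  fix f a b assume f: "f \<in> hom X a b"
  then have "a \<in> Obj X" "b \<in> Obj X"
    by (auto simp: in_hom_iff)
  then show "FA lift_fctr f \<in> hom Y (FO lift_fctr a) (FO lift_fctr b)"
    using f lift(1)[of "sect a" "sect b" f] by (auto simp: lift_fctr_def sect in_hom_iff)
next
  fix f a b g c assume f: "f \<in> hom X a b" and g: "g \<in> hom X b c"
  then have o: "a \<in> Obj X" "b \<in> Obj X" "c \<in> Obj X"
    by (auto simp: in_hom_iff)
  have D: "Dom X f = a" "Cod X f = b" "Dom X g = b" "Cod X g = c" "Dom X (g \<cdot>\<^bsub>X\<^esub> f) = a"
    "Cod X (g \<cdot>\<^bsub>X\<^esub> f) = c"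
    using f g by (auto simp: in_hom_iff)
  have lf: "lift (sect a) (sect b) f \<in> hom Y (q (sect a)) (q (sect b))"
    "T (sect a) (sect b) f (lift (sect a) (sect b) f)"
    using lift[of "sect a" "sect b" f] o f by (auto simp: sect)
  have lg: "lift (sect b) (sect c) g \<in> hom Y (q (sect b)) (q (sect c))"
    "T (sect b) (sect c) g (lift (sect b) (sect c) g)"
    using lift[of "sect b" "sect c" g] o g by (auto simp: sect)
  have "lift (sect a) (sect c) (g \<cdot>\<^bsub>X\<^esub> f) = lift (sect b) (sect c) g \<cdot>\<^bsub>Y\<^esub> lift (sect a) (sect b) f"
    using T_Cmp[of "sect a" "sect b" "sect c" f g] o f g lf lg
    by (intro lift_eq) (auto simp: sect intro: X.Cmp_in Y.Cmp_in)
  then show "FA lift_fctr (g \<cdot>\<^bsub>X\<^esub> f) = FA lift_fctr g \<cdot>\<^bsub>Y\<^esub> FA lift_fctr f"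
    by (simp add: lift_fctr_def D)
qed

text \<open>Measures the effect of the choice made in \<open>sect\<close>: two elements of
  \<open>R\<close> over the same object of \<open>X\<close> have canonically isomorphic images in
  \<open>Y\<close>, by lifting the identity.\<close>

definition comparison :: "'r \<Rightarrow> 'r \<Rightarrow> 'b" where
  "comparison r r' = lift r r' (Idt X (p r))"

lemma comparison:
  assumes "r \<in> R" "r' \<in> R" "p r = p r'"
  shows "comparison r r' \<in> hom Y (q r) (q r')" "T r r' (Idt X (p r)) (comparison r r')"
  using lift[OF assms(1,2), of "Idt X (p r)"] X.Idt_in[OF p_in[OF assms(1)]] assms(3)
  by (auto simp: comparison_def)

text \<open>Both composites are \<open>T\<close>-related to \<open>u\<close> itself, since composing
  \<open>u\<close> with an identity changes nothing; unique lifting identifies them.\<close>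

lemma comparison_natural:
  assumes r: "r1 \<in> R" "r1' \<in> R" "p r1 = p r1'" "r2 \<in> R" "r2' \<in> R" "p r2 = p r2'"
    and u: "u \<in> hom X (p r1) (p r2)"
    and F: "F \<in> hom Y (q r1) (q r2)" "T r1 r2 u F"
    and F': "F' \<in> hom Y (q r1') (q r2')" "T r1' r2' u F'"
  shows "F' \<cdot>\<^bsub>Y\<^esub> comparison r1 r1' = comparison r2 r2' \<cdot>\<^bsub>Y\<^esub> F"
proof -
  note c1 = comparison[OF r(1-3)] and c2 = comparison[OF r(4-6)]
  have I1: "Idt X (p r1) \<in> hom X (p r1) (p r1')" "Idt X (p r2) \<in> hom X (p r2) (p r2')"
    using r X.Idt_in p_in by metis+
  have "T r1 r2' (u \<cdot>\<^bsub>X\<^esub> Idt X (p r1)) (F' \<cdot>\<^bsub>Y\<^esub> comparison r1 r1')"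
    by (rule T_Cmp[OF r(1,2,5) I1(1) _ c1(1) F'(1) c1(2) F'(2)]) (use u r in simp)
  then have 1: "T r1 r2' u (F' \<cdot>\<^bsub>Y\<^esub> comparison r1 r1')"
    using X.Cmp_Idt[OF u] by simp
  have "T r1 r2' (Idt X (p r2) \<cdot>\<^bsub>X\<^esub> u) (comparison r2 r2' \<cdot>\<^bsub>Y\<^esub> F)"
    by (rule T_Cmp[OF r(1,4,5) u I1(2) F(1) c2(1) F(2) c2(2)])
  then have 2: "T r1 r2' u (comparison r2 r2' \<cdot>\<^bsub>Y\<^esub> F)"
    using X.Idt_Cmp[OF u] by simp
  have "u \<in> hom X (p r1) (p r2')"
    using u r by simp
  from T_lift[OF r(1,5) this] 1 2 show ?thesis
    using Y.Cmp_in[OF c1(1) F'(1)] Y.Cmp_in[OF F(1) c2(1)] by blast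
qed

lemma comparison_refl: "r \<in> R \<Longrightarrow> comparison r r = Idt Y (q r)"
  unfolding comparison_def by (rule lift_eq) (auto simp: p_in q_in T_Idt intro: X.Idt_in Y.Idt_in)

lemma comparison_inverse:
  assumes r: "r \<in> R" "r' \<in> R" "p r = p r'"
  shows "comparison r' r \<cdot>\<^bsub>Y\<^esub> comparison r r' = Idt Y (q r)"
proof -
  \<comment> \<open>This is a naturality square over an identity, with \<open>F'\<close> the
    comparison from \<open>r'\<close> back to \<open>r\<close> and \<open>F\<close> the identity of
    \<open>q r\<close>.\<close>
  have "comparison r' r \<cdot>\<^bsub>Y\<^esub> comparison r r' = comparison r r \<cdot>\<^bsub>Y\<^esub> Idt Y (q r)"
    by (rule comparison_natural[where u = "Idt X (p r)"])
      (use r comparison[of r' r] T_Idt[of r] in \<open>auto simp: p_in q_in intro: X.Idt_in Y.Idt_in\<close>)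
  then show ?thesis
    using r Y.Cmp_Idt[OF Y.Idt_in[OF q_in]] by (simp add: comparison_refl)
qed

lemma is_iso_comparison:
  assumes r: "r \<in> R" "r' \<in> R" "p r = p r'"
  shows "is_iso Y (comparison r r')"
  using comparison(1)[OF r] comparison(1)[OF r(2,1) r(3)[symmetric]]
    comparison_inverse[OF r] comparison_inverse[OF r(2,1) r(3)[symmetric]]
  unfolding is_iso_def by (auto simp: in_hom_iff intro!: bexI[of _ "comparison r' r"])

text \<open>The assumptions are symmetric in the two legs, so the functor from \<open>Y\<close> to
  \<open>X\<close> and its comparison maps are obtained by reading the same results in the opposite
  span.\<close>

lemma category_span_swap: "category_span Y X R q p (\<lambda>r r' F u. T r r' u F)"
  by unfold_locales (use p_in q_in p_surj q_surj T_lift T_lift' T_Idt T_Cmp in auto)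

end

lemma (in category_span) equivalent: "equivalent_categories X Y"
proof -
  interpret S: category_span Y X R q p "\<lambda>r r' F u. T r r' u F"
    by (rule category_span_swap)
  have lift_sect: "FA lift_fctr u \<in> hom Y (q (sect a)) (q (sect b)) \<and>
      T (sect a) (sect b) u (FA lift_fctr u)" if "u \<in> hom X a b" for u a b
  proof -
    have "a \<in> Obj X" "b \<in> Obj X" "Dom X u = a" "Cod X u = b"
      using that by (auto simp: in_hom_iff)
    then show ?thesis
      using that lift[of "sect a" "sect b" u] by (auto simp: lift_fctr_def sect)
  qed
  have lift_sect': "FA S.lift_fctr u \<in> hom X (p (S.sect a)) (p (S.sect b)) \<and>
      T (S.sect a) (S.sect b) (FA S.lift_fctr u) u" if "u \<in> hom Y a b" for u a b
  proof -
    have "a \<in> Obj Y" "b \<in> Obj Y" "Dom Y u = a" "Cod Y u = b"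
      using that by (auto simp: in_hom_iff)
    then show ?thesis
      using that S.lift[of "S.sect a" "S.sect b" u] by (auto simp: S.lift_fctr_def S.sect)
  qed
  \<comment> \<open>\<open>sect x\<close> and the element chosen over its \<open>q\<close>-value
    have the same image in \<open>Y\<close>, while their images in \<open>X\<close> are
    \<open>x\<close> and its image under both functors. Their comparison along the opposite span is
    the unit.\<close>
  let ?\<eta> = "\<lambda>x. S.comparison (sect x) (S.sect (q (sect x)))"
  have "is_natural_iso X X id_fctr (comp_fctr S.lift_fctr lift_fctr) ?\<eta>"
    unfolding is_natural_iso_def
  proof (intro conjI ballI allI)
    fix x assume x: "x \<in> Obj X"
    have r: "sect x \<in> R" "S.sect (q (sect x)) \<in> R" "q (sect x) = q (S.sect (q (sect x)))"
      using x by (auto simp: sect q_in S.sect)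
    show "?\<eta> x \<in> hom X (FO id_fctr x) (FO (comp_fctr S.lift_fctr lift_fctr) x)"
      using S.comparison(1)[OF r] x by (simp add: id_fctr_def comp_fctr_def lift_fctr_def S.lift_fctr_def sect)
    show "is_iso X (?\<eta> x)"
      by (rule S.is_iso_comparison[OF r])
  next
    fix a b u assume u: "u \<in> hom X a b"
    then have o: "a \<in> Obj X" "b \<in> Obj X"
      by (auto simp: in_hom_iff)
    have q: "q (sect a) \<in> Obj Y" "q (sect b) \<in> Obj Y"
      using o by (auto simp: sect q_in)
    have "FA S.lift_fctr (FA lift_fctr u) \<cdot>\<^bsub>X\<^esub> ?\<eta> a = ?\<eta> b \<cdot>\<^bsub>X\<^esub> u"
      by (rule S.comparison_natural[where u = "FA lift_fctr u"])
        (use o q u lift_sect[OF u] lift_sect'[of "FA lift_fctr u"] in \<open>auto simp: sect S.sect\<close>)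
    then show "FA (comp_fctr S.lift_fctr lift_fctr) u \<cdot>\<^bsub>X\<^esub> ?\<eta> a = ?\<eta> b \<cdot>\<^bsub>X\<^esub> FA id_fctr u"
      by (simp add: comp_fctr_def id_fctr_def)
  qed
  moreover
  \<comment> \<open>Dually, these two elements have the same \<open>p\<close>-value, and their
    \<open>q\<close>-values are the double image of \<open>y\<close> and \<open>y\<close>
    itself.\<close>
  let ?\<epsilon> = "\<lambda>y. comparison (sect (p (S.sect y))) (S.sect y)"
  have "is_natural_iso Y Y (comp_fctr lift_fctr S.lift_fctr) id_fctr ?\<epsilon>"
    unfolding is_natural_iso_def
  proof (intro conjI ballI allI)
    fix y assume y: "y \<in> Obj Y"
    have r: "sect (p (S.sect y)) \<in> R" "S.sect y \<in> R" "p (sect (p (S.sect y))) = p (S.sect y)"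
      using y by (auto simp: sect p_in S.sect)
    show "?\<epsilon> y \<in> hom Y (FO (comp_fctr lift_fctr S.lift_fctr) y) (FO id_fctr y)"
      using comparison(1)[OF r] y by (simp add: id_fctr_def comp_fctr_def lift_fctr_def S.lift_fctr_def S.sect)
    show "is_iso Y (?\<epsilon> y)"
      by (rule is_iso_comparison[OF r])
  next
    fix a b F assume F: "F \<in> hom Y a b"
    then have o: "a \<in> Obj Y" "b \<in> Obj Y"
      by (auto simp: in_hom_iff)
    have p: "p (S.sect a) \<in> Obj X" "p (S.sect b) \<in> Obj X"
      using o by (auto simp: S.sect p_in)
    have "F \<cdot>\<^bsub>Y\<^esub> ?\<epsilon> a = ?\<epsilon> b \<cdot>\<^bsub>Y\<^esub> FA lift_fctr (FA S.lift_fctr F)"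
      by (rule comparison_natural[where u = "FA S.lift_fctr F"])
        (use o p F lift_sect'[OF F] lift_sect[of "FA S.lift_fctr F"] in \<open>auto simp: sect S.sect\<close>)
    then show "FA id_fctr F \<cdot>\<^bsub>Y\<^esub> ?\<epsilon> a = ?\<epsilon> b \<cdot>\<^bsub>Y\<^esub> FA (comp_fctr lift_fctr S.lift_fctr) F"
      by (simp add: comp_fctr_def id_fctr_def)
  qed
  ultimately show ?thesis
    unfolding equivalent_categories_def
    using X.category_axioms Y.category_axioms is_functor_lift_fctr S.is_functor_lift_fctr by blast
qed

section \<open>The pseudopullback and the category of small sets\<close>

lemma category_pseudopullback:
  assumes A: "category A" and B: "category B" and C: "category C"
    and F: "is_functor A C F" and G: "is_functor B C G"
  shows "category (pseudopullback A B C F G)"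
proof -
  interpret A: category A by (rule A)
  interpret B: category B by (rule B)
  interpret C: category C by (rule C)
  interpret F: is_functor A C F by (rule F)
  interpret G: is_functor B C G by (rule G)
  have FG: "FA F u \<in> Arr C" "Dom C (FA F u) = FO F (Dom A u)" "Cod C (FA F u) = FO F (Cod A u)"
    if "u \<in> Arr A" for u
    using F.FA_in[of u "Dom A u" "Cod A u"] that by (auto simp: in_hom_iff)
  have GG: "FA G u \<in> Arr C" "Dom C (FA G u) = FO G (Dom B u)" "Cod C (FA G u) = FO G (Cod B u)"
    if "u \<in> Arr B" for u
    using G.FA_in[of u "Dom B u" "Cod B u"] that by (auto simp: in_hom_iff)
  \<comment> \<open>The squares of two composable arrows are pasted along \<open>\<theta>'\<close>;
    this is what makes composites arrows of the pseudopullback.\<close>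
  have paste: "FA G (v' \<cdot>\<^bsub>B\<^esub> v) \<cdot>\<^bsub>C\<^esub> \<theta> = \<theta>'' \<cdot>\<^bsub>C\<^esub> FA F (u' \<cdot>\<^bsub>A\<^esub> u)"
    if "\<theta> \<in> hom C (FO F a) (FO G b)" "\<theta>' \<in> hom C (FO F a') (FO G b')"
      "\<theta>'' \<in> hom C (FO F a'') (FO G b'')"
      "u \<in> hom A a a'" "v \<in> hom B b b'" "u' \<in> hom A a' a''" "v' \<in> hom B b' b''"
      "FA G v \<cdot>\<^bsub>C\<^esub> \<theta> = \<theta>' \<cdot>\<^bsub>C\<^esub> FA F u" "FA G v' \<cdot>\<^bsub>C\<^esub> \<theta>' = \<theta>'' \<cdot>\<^bsub>C\<^esub> FA F u'"
    for a b \<theta> a' b' \<theta>' a'' b'' \<theta>'' u v u' v'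
  proof -
    have "FA G (v' \<cdot>\<^bsub>B\<^esub> v) \<cdot>\<^bsub>C\<^esub> \<theta> = FA G v' \<cdot>\<^bsub>C\<^esub> (FA G v \<cdot>\<^bsub>C\<^esub> \<theta>)"
      using that by (subst G.FA_Cmp) (auto simp: in_hom_iff GG)
    also have "\<dots> = FA G v' \<cdot>\<^bsub>C\<^esub> \<theta>' \<cdot>\<^bsub>C\<^esub> FA F u"
      unfolding that(8) using that by (subst C.Cmp_assoc') (auto simp: in_hom_iff GG FG)
    also have "\<dots> = \<theta>'' \<cdot>\<^bsub>C\<^esub> FA F (u' \<cdot>\<^bsub>A\<^esub> u)"
      unfolding that(9) F.FA_Cmp[OF that(4,6)]
      using that by (subst C.Cmp_assoc') (auto simp: in_hom_iff FG)
    finally show ?thesis .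
  qed
  show ?thesis
  proof
    fix a assume "a \<in> Obj (pseudopullback A B C F G)"
    then show "Idt (pseudopullback A B C F G) a \<in> hom (pseudopullback A B C F G) a a"
      by (auto simp: pseudopullback_def hom_def F.FA_Idt G.FA_Idt)
  next
    fix f a b g c
    assume "f \<in> hom (pseudopullback A B C F G) a b" "g \<in> hom (pseudopullback A B C F G) b c"
    then show "Cmp (pseudopullback A B C F G) g f \<in> hom (pseudopullback A B C F G) a c"
      by (auto simp: pseudopullback_def in_hom_iff intro!: paste)
  qed (auto simp: pseudopullback_def in_hom_iff)
qed

lemma category_Set_cat: "category (Set_cat \<U>)"
proof
  fix f a b g c h d
  assume "f \<in> hom (Set_cat \<U>) a b" "g \<in> hom (Set_cat \<U>) b c" "h \<in> hom (Set_cat \<U>) c d"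
  then show "Cmp (Set_cat \<U>) (Cmp (Set_cat \<U>) h g) f = Cmp (Set_cat \<U>) h (Cmp (Set_cat \<U>) g f)"
    by (auto simp: Set_cat_def in_hom_iff compose_def PiE_def Pi_def intro!: ext)
qed (auto simp: Set_cat_def in_hom_iff compose_def PiE_def Pi_def extensional_def intro!: ext)

section \<open>Pullbacks and disjoint stable coproducts\<close>

text \<open>The numbers 0, 1, 2 serve both as objects and as their identities; 3 and 4 are the
  arrows from 0 and from 1 to 2. After 3 or 4 only the identity of 2 can follow, and every other
  arrow is an identity, which explains the formula for \<open>Cmp\<close>.\<close>

definition cospan_shape :: "(nat, nat) cat" where
  "cospan_shape = \<lparr>Obj = {0, 1, 2}, Arr = {0, 1, 2, 3, 4},
     Dom = (\<lambda>u. if u = 3 then 0 else if u = 4 then 1 else u),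
     Cod = (\<lambda>u. if u = 3 \<or> u = 4 then 2 else u),
     Idt = (\<lambda>a. a), Cmp = (\<lambda>g f. if f = 3 \<or> f = 4 then f else g)\<rparr>"

lemma category_cospan_shape: "category cospan_shape"
  by unfold_locales (auto simp: cospan_shape_def in_hom_iff split: if_splits)

locale finitely_complete = category +
  assumes finite_limits: "has_finite_limits C"
begin

lemma pullback_exists:
  assumes f: "f \<in> Arr C" and g: "g \<in> Arr C" and fg: "Cod C f = Cod C g"
  shows "\<exists>p p1 p2. is_pullback C f g p p1 p2"
proof -
  define F where "F = \<lparr>FO = (\<lambda>a::nat. if a = 0 then Dom C f else if a = 1 then Dom C g else Cod C f),
    FA = (\<lambda>u::nat. if u = 0 then Idt C (Dom C f) else if u = 1 then Idt C (Dom C g)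
      else if u = 2 then Idt C (Cod C f) else if u = 3 then f else g)\<rparr>"
  have "is_functor cospan_shape C F"
    by unfold_locales (use f g fg in \<open>auto simp: cospan_shape_def F_def in_hom_iff split: if_splits\<close>)
  then obtain l \<pi> where l: "is_limit cospan_shape C F l \<pi>"
    using finite_limits category_cospan_shape
    unfolding has_finite_limits_def by (fastforce simp: cospan_shape_def)
  \<comment> \<open>The five arrows of the shape give five equations; those for the three identities
    hold automatically.\<close>
  have cone: "is_cone cospan_shape C F x \<mu> \<longleftrightarrow> x \<in> Obj C \<and> \<mu> 0 \<in> hom C x (Dom C f) \<and>
      \<mu> 1 \<in> hom C x (Dom C g) \<and> \<mu> 2 \<in> hom C x (Cod C f) \<and> f \<cdot> \<mu> 0 = \<mu> 2 \<and> g \<cdot> \<mu> 1 = \<mu> 2" for x \<mu>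
  proof -
    have D: "(\<forall>d \<in> Obj cospan_shape. P d) \<longleftrightarrow> P 0 \<and> P 1 \<and> P 2" for P
      by (simp add: cospan_shape_def)
    have A: "(\<forall>d e. \<forall>u \<in> hom cospan_shape d e. P u d e) \<longleftrightarrow>
      P 0 0 0 \<and> P 1 1 1 \<and> P 2 2 2 \<and> P 3 0 2 \<and> P 4 1 2" for P
      by (auto simp: cospan_shape_def in_hom_iff)
    show ?thesis
      unfolding is_cone_def D A by (auto simp: F_def in_hom_iff)
  qed
  have "is_pullback C f g l (\<pi> 0) (\<pi> 1)"
    unfolding is_pullback_def
  proof (intro conjI allI ballI impI)
    have c: "is_cone cospan_shape C F l \<pi>"
      using l by (simp add: is_limit_def)
    then show "l \<in> Obj C" "\<pi> 0 \<in> hom C l (Dom C f)" "\<pi> 1 \<in> hom C l (Dom C g)" "f \<cdot> \<pi> 0 = g \<cdot> \<pi> 1"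
      unfolding cone by auto
    fix w u v assume uv: "u \<in> hom C w (Dom C f)" "v \<in> hom C w (Dom C g)" "f \<cdot> u = g \<cdot> v"
    let ?\<mu> = "\<lambda>d::nat. if d = 0 then u else if d = 1 then v else f \<cdot> u"
    have "is_cone cospan_shape C F w ?\<mu>"
      unfolding cone using uv f g fg by (auto simp: in_hom_iff)
    then have "\<exists>!h. h \<in> hom C w l \<and> (\<forall>d \<in> Obj cospan_shape. \<pi> d \<cdot> h = ?\<mu> d)"
      using l by (simp add: is_limit_def)
    moreover have "(\<forall>d \<in> Obj cospan_shape. \<pi> d \<cdot> h = ?\<mu> d) \<longleftrightarrow> \<pi> 0 \<cdot> h = u \<and> \<pi> 1 \<cdot> h = v"
      if "h \<in> hom C w l" for h
    proof -
      \<comment> \<open>The leg to the vertex 2 is forced by the leg to 0, so a mediating map needs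
        to be tested on the two projections only.\<close>
      have "\<pi> 2 \<cdot> h = f \<cdot> (\<pi> 0 \<cdot> h)"
        using that c f unfolding cone by (auto simp: in_hom_iff simp flip: Cmp_assoc')
      then show ?thesis
        by (auto simp: cospan_shape_def)
    qed
    ultimately show "\<exists>!h. h \<in> hom C w l \<and> \<pi> 0 \<cdot> h = u \<and> \<pi> 1 \<cdot> h = v"
      by (metis (no_types, lifting))
  qed (use f g fg in auto)
  then show ?thesis
    by blast
qed

lemma pb_is_pullback:
  assumes "f \<in> Arr C" "g \<in> Arr C" "Cod C f = Cod C g"
  shows "is_pullback C f g (pb_obj C f g) (pb_fst C f g) (pb_snd C f g)"
proof -
  have "\<exists>x. case x of (p, p1, p2) \<Rightarrow> is_pullback C f g p p1 p2"
    using pullback_exists[OF assms] by auto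
  from someI_ex[OF this] show ?thesis
    by (auto simp: pullback_cone_def pb_obj_def pb_fst_def pb_snd_def split: prod.splits)
qed

lemma pb_arr [simp]:
  assumes "f \<in> Arr C" "g \<in> Arr C" "Cod C f = Cod C g"
  shows "pb_obj C f g \<in> Obj C"
    "pb_fst C f g \<in> Arr C" "Dom C (pb_fst C f g) = pb_obj C f g" "Cod C (pb_fst C f g) = Dom C f"
    "pb_snd C f g \<in> Arr C" "Dom C (pb_snd C f g) = pb_obj C f g" "Cod C (pb_snd C f g) = Dom C g"
  using pb_is_pullback[OF assms] by (auto simp: is_pullback_def in_hom_iff)

lemma pb_commutes:
  assumes "f \<in> Arr C" "g \<in> Arr C" "Cod C f = Cod C g"
  shows "f \<cdot> pb_fst C f g = g \<cdot> pb_snd C f g"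
  using pb_is_pullback[OF assms] by (auto simp: is_pullback_def in_hom_iff)

lemma pb_ext:
  assumes "f \<in> Arr C" "g \<in> Arr C" "Cod C f = Cod C g"
    and "h \<in> Arr C" "h' \<in> Arr C" "Dom C h = Dom C h'" "Cod C h = pb_obj C f g" "Cod C h' = pb_obj C f g"
    and "pb_fst C f g \<cdot> h = pb_fst C f g \<cdot> h'" "pb_snd C f g \<cdot> h = pb_snd C f g \<cdot> h'"
  shows "h = h'"
proof -
  have "\<exists>!k. k \<in> hom C (Dom C h) (pb_obj C f g) \<and> pb_fst C f g \<cdot> k = pb_fst C f g \<cdot> h \<and>
      pb_snd C f g \<cdot> k = pb_snd C f g \<cdot> h"
  proof -
    have "f \<cdot> (pb_fst C f g \<cdot> h) = g \<cdot> (pb_snd C f g \<cdot> h)"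
      using assms pb_commutes[OF assms(1-3)] by (simp flip: Cmp_assoc')
    then show ?thesis
      using pb_is_pullback[OF assms(1-3)] assms unfolding is_pullback_def by (simp add: in_hom_iff)
  qed
  then show ?thesis
    using assms unfolding in_hom_iff by metis
qed

lemma pb_pair_unfold:
  assumes "f \<in> Arr C" "g \<in> Arr C" "Cod C f = Cod C g"
    and "u \<in> Arr C" "v \<in> Arr C" "Dom C u = Dom C v" "Cod C u = Dom C f" "Cod C v = Dom C g"
    and "f \<cdot> u = g \<cdot> v"
  shows "pb_pair C f g u v \<in> hom C (Dom C u) (pb_obj C f g) \<and>
    pb_fst C f g \<cdot> pb_pair C f g u v = u \<and> pb_snd C f g \<cdot> pb_pair C f g u v = v"
  unfolding pb_pair_def
  by (rule theI') (use pb_is_pullback[OF assms(1-3)] assms in \<open>simp add: is_pullback_def in_hom_iff\<close>)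

lemma pb_pair_arr [simp]:
  assumes "f \<in> Arr C" "g \<in> Arr C" "Cod C f = Cod C g"
    and "u \<in> Arr C" "v \<in> Arr C" "Dom C v = Dom C u" "Cod C u = Dom C f" "Cod C v = Dom C g"
    and "f \<cdot> u = g \<cdot> v"
  shows "pb_pair C f g u v \<in> Arr C" "Dom C (pb_pair C f g u v) = Dom C u"
    "Cod C (pb_pair C f g u v) = pb_obj C f g"
    "pb_fst C f g \<cdot> pb_pair C f g u v = u" "pb_snd C f g \<cdot> pb_pair C f g u v = v"
  using pb_pair_unfold[of f g u v] assms by (auto simp: in_hom_iff)

lemma pb_pair_comp:
  assumes "f \<in> Arr C" "g \<in> Arr C" "Cod C f = Cod C g"
    and "u \<in> Arr C" "v \<in> Arr C" "Dom C v = Dom C u" "Cod C u = Dom C f" "Cod C v = Dom C g"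
    and "f \<cdot> u = g \<cdot> v" and "k \<in> Arr C" "Cod C k = Dom C u"
  shows "pb_pair C f g u v \<cdot> k = pb_pair C f g (u \<cdot> k) (v \<cdot> k)"
proof -
  have e: "f \<cdot> (u \<cdot> k) = g \<cdot> (v \<cdot> k)"
    using assms by (simp flip: Cmp_assoc')
  show ?thesis
    by (rule pb_ext[of f g]) (use assms e in \<open>simp_all flip: Cmp_assoc'\<close>)
qed

lemma pb_pair_projections:
  assumes "f \<in> Arr C" "g \<in> Arr C" "Cod C f = Cod C g" "k \<in> Arr C" "Cod C k = pb_obj C f g"
  shows "pb_pair C f g (pb_fst C f g \<cdot> k) (pb_snd C f g \<cdot> k) = k"
proof -
  have e: "f \<cdot> (pb_fst C f g \<cdot> k) = g \<cdot> (pb_snd C f g \<cdot> k)"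
    using assms pb_commutes[OF assms(1-3)] by (simp flip: Cmp_assoc')
  show ?thesis
    by (rule pb_ext[of f g]) (use assms e in simp_all)
qed

end

section \<open>Copairing and joint epimorphy of coproduct injections\<close>

lemma is_coproductD:
  assumes "is_coproduct C A X s \<iota>"
  shows "s \<in> Obj C" "a \<in> A \<Longrightarrow> X a \<in> Obj C" "a \<in> A \<Longrightarrow> \<iota> a \<in> Arr C" "a \<in> A \<Longrightarrow> Dom C (\<iota> a) = X a"
    "a \<in> A \<Longrightarrow> Cod C (\<iota> a) = s"
  using assms by (auto simp: is_coproduct_def in_hom_iff)

lemma coproduct_copair:
  assumes "is_coproduct C A X s \<iota>" "y \<in> Obj C" "\<And>a. a \<in> A \<Longrightarrow> f a \<in> hom C (X a) y"
  shows "\<exists>h \<in> hom C s y. \<forall>a \<in> A. h \<cdot>\<^bsub>C\<^esub> \<iota> a = f a"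
proof -
  have "\<forall>k. (\<forall>a \<in> A. k a \<in> hom C (X a) y) \<longrightarrow> (\<exists>!h. h \<in> hom C s y \<and> (\<forall>a \<in> A. h \<cdot>\<^bsub>C\<^esub> \<iota> a = k a))"
    using assms(1,2) by (simp add: is_coproduct_def)
  then show ?thesis
    using assms(3) by (blast dest: ex1_implies_ex)
qed

lemma (in category) coproduct_ext:
  assumes "is_coproduct C A X s \<iota>" "f \<in> hom C s y" "g \<in> hom C s y"
    and "\<And>a. a \<in> A \<Longrightarrow> f \<cdot> \<iota> a = g \<cdot> \<iota> a"
  shows "f = g"
proof -
  have y: "y \<in> Obj C"
    using assms(2) by (auto simp: in_hom_iff)
  have "\<forall>a \<in> A. f \<cdot> \<iota> a \<in> hom C (X a) y"
    using assms(1,2) by (auto simp: is_coproduct_def in_hom_iff)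
  moreover have "\<forall>k. (\<forall>a \<in> A. k a \<in> hom C (X a) y) \<longrightarrow> (\<exists>!h. h \<in> hom C s y \<and> (\<forall>a \<in> A. h \<cdot> \<iota> a = k a))"
    using assms(1) y by (simp add: is_coproduct_def)
  ultimately have "\<exists>!h. h \<in> hom C s y \<and> (\<forall>a \<in> A. h \<cdot> \<iota> a = f \<cdot> \<iota> a)"
    by simp
  then obtain h where "\<And>k. k \<in> hom C s y \<Longrightarrow> (\<forall>a \<in> A. k \<cdot> \<iota> a = f \<cdot> \<iota> a) \<Longrightarrow> k = h"
    by (elim ex1E) blast
  from this[of f] this[of g] show ?thesis
    using assms(2-4) by simp
qed

section \<open>The base category: terminal object and binary products\<close>

locale lextensive_cartesian =
  fixes \<U> :: "'i set set" and V :: "('o, 'a, 'm) ccat_scheme" (structure)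
  assumes small: "small_sets \<U>"
    and cartesian: "is_cartesian V"
    and lextensive: "infinitary_lextensive \<U> V"
begin

sublocale finitely_complete V
  using lextensive by (simp add: infinitary_lextensive_def finitely_complete_def finitely_complete_axioms_def)

definition bang :: "'o \<Rightarrow> 'a" where
  "bang x = (THE f. f \<in> hom V x (Unit V))"

lemma Unit_terminal: "is_terminal V (Unit V)"
  using cartesian by (simp add: is_cartesian_def)

lemma Unit_Obj [simp]: "Unit V \<in> Obj V"
  using Unit_terminal by (simp add: is_terminal_def)

lemma bang_arr [simp]:
  assumes "x \<in> Obj V"
  shows "bang x \<in> Arr V" "Dom V (bang x) = x" "Cod V (bang x) = Unit V"
proof -
  have "\<exists>!f. f \<in> hom V x (Unit V)"
    using Unit_terminal assms by (simp add: is_terminal_def)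
  from theI'[OF this] show "bang x \<in> Arr V" "Dom V (bang x) = x" "Cod V (bang x) = Unit V"
    by (auto simp: bang_def in_hom_iff)
qed

lemma bang_unique:
  assumes "f \<in> Arr V" "Cod V f = Unit V"
  shows "f = bang (Dom V f)"
proof -
  have "\<exists>!g. g \<in> hom V (Dom V f) (Unit V)"
    using Unit_terminal assms by (simp add: is_terminal_def)
  then show ?thesis
    using assms bang_arr[of "Dom V f"] by (metis in_hom_iff Dom_Obj)
qed

lemma bang_comp [simp]: "k \<in> Arr V \<Longrightarrow> Cod V k = y \<Longrightarrow> bang y \<cdot> k = bang (Dom V k)"
  using bang_unique[of "bang y \<cdot> k"] by fastforce

lemma bang_Unit [simp]: "bang (Unit V) = Idt V (Unit V)"
  using bang_unique[of "Idt V (Unit V)"] by simp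

lemma prod_is_product:
  "\<lbrakk>x \<in> Obj V; y \<in> Obj V\<rbrakk> \<Longrightarrow> is_product V x y (x \<otimes> y) (Pr1 V x y) (Pr2 V x y)"
  using cartesian by (simp add: is_cartesian_def)

lemma prod_arr [simp]:
  assumes "x \<in> Obj V" "y \<in> Obj V"
  shows "x \<otimes> y \<in> Obj V"
    "Pr1 V x y \<in> Arr V" "Dom V (Pr1 V x y) = x \<otimes> y" "Cod V (Pr1 V x y) = x"
    "Pr2 V x y \<in> Arr V" "Dom V (Pr2 V x y) = x \<otimes> y" "Cod V (Pr2 V x y) = y"
  using prod_is_product[OF assms] by (auto simp: is_product_def in_hom_iff)

lemma prod_ext:
  assumes "x \<in> Obj V" "y \<in> Obj V"
    and "h \<in> Arr V" "h' \<in> Arr V" "Dom V h = Dom V h'" "Cod V h = x \<otimes> y" "Cod V h' = x \<otimes> y"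
    and "Pr1 V x y \<cdot> h = Pr1 V x y \<cdot> h'" "Pr2 V x y \<cdot> h = Pr2 V x y \<cdot> h'"
  shows "h = h'"
proof -
  have "Pr1 V x y \<cdot> h \<in> hom V (Dom V h) x" "Pr2 V x y \<cdot> h \<in> hom V (Dom V h) y"
    using assms by (auto simp: in_hom_iff)
  then have "\<exists>!k. k \<in> hom V (Dom V h) (x \<otimes> y) \<and> Pr1 V x y \<cdot> k = Pr1 V x y \<cdot> h \<and>
      Pr2 V x y \<cdot> k = Pr2 V x y \<cdot> h"
    using prod_is_product[OF assms(1,2)] unfolding is_product_def by blast
  then show ?thesis
    using assms unfolding in_hom_iff by metis
qed

lemma prod_pair_arr [simp]:
  assumes "u \<in> Arr V" "v \<in> Arr V" "Dom V v = Dom V u"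
  shows "prod_pair V u v \<in> Arr V" "Dom V (prod_pair V u v) = Dom V u"
    "Cod V (prod_pair V u v) = Cod V u \<otimes> Cod V v"
proof -
  have "\<exists>!h. h \<in> hom V (Dom V u) (Cod V u \<otimes> Cod V v) \<and>
     Pr1 V (Cod V u) (Cod V v) \<cdot> h = u \<and> Pr2 V (Cod V u) (Cod V v) \<cdot> h = v"
    using prod_is_product[of "Cod V u" "Cod V v"] assms by (simp add: is_product_def in_hom_iff)
  from theI'[OF this] show "prod_pair V u v \<in> Arr V" "Dom V (prod_pair V u v) = Dom V u"
    "Cod V (prod_pair V u v) = Cod V u \<otimes> Cod V v"
    by (auto simp: prod_pair_def in_hom_iff)
qed

lemma prod_pair_proj [simp]:
  assumes "u \<in> Arr V" "v \<in> Arr V" "Dom V v = Dom V u" "Cod V u = x" "Cod V v = y"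
  shows "Pr1 V x y \<cdot> prod_pair V u v = u" "Pr2 V x y \<cdot> prod_pair V u v = v"
proof -
  have "\<exists>!h. h \<in> hom V (Dom V u) (Cod V u \<otimes> Cod V v) \<and>
     Pr1 V (Cod V u) (Cod V v) \<cdot> h = u \<and> Pr2 V (Cod V u) (Cod V v) \<cdot> h = v"
    using prod_is_product[of "Cod V u" "Cod V v"] assms(1-3) by (simp add: is_product_def in_hom_iff)
  from theI'[OF this] show "Pr1 V x y \<cdot> prod_pair V u v = u" "Pr2 V x y \<cdot> prod_pair V u v = v"
    using assms by (auto simp: prod_pair_def in_hom_iff)
qed

lemma prod_pair_comp [simp]:
  assumes "u \<in> Arr V" "v \<in> Arr V" "Dom V v = Dom V u" "k \<in> Arr V" "Cod V k = Dom V u"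
  shows "prod_pair V u v \<cdot> k = prod_pair V (u \<cdot> k) (v \<cdot> k)"
  by (rule prod_ext[of "Cod V u" "Cod V v"]) (use assms in \<open>simp_all flip: Cmp_assoc'\<close>)

lemma prod_pair_projections:
  assumes "x \<in> Obj V" "y \<in> Obj V" "k \<in> Arr V" "Cod V k = x \<otimes> y"
  shows "prod_pair V (Pr1 V x y \<cdot> k) (Pr2 V x y \<cdot> k) = k"
  by (rule prod_ext[of x y]) (use assms in simp_all)

lemma prod_pair_Pr [simp]:
  assumes "x \<in> Obj V" "y \<in> Obj V"
  shows "prod_pair V (Pr1 V x y) (Pr2 V x y) = Idt V (x \<otimes> y)"
  using prod_pair_projections[of x y "Idt V (x \<otimes> y)"] assms by simp

lemma prod_map_pair:
  assumes "u \<in> Arr V" "v \<in> Arr V" "f \<in> Arr V" "g \<in> Arr V" "Dom V f = Dom V g"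
    "Cod V f = Dom V u" "Cod V g = Dom V v"
  shows "prod_map V u v \<cdot> prod_pair V f g = prod_pair V (u \<cdot> f) (v \<cdot> g)"
  using assms by (simp add: prod_map_def)

lemma prod_map_arr [simp]:
  assumes "u \<in> Arr V" "v \<in> Arr V"
  shows "prod_map V u v \<in> Arr V" "Dom V (prod_map V u v) = Dom V u \<otimes> Dom V v"
    "Cod V (prod_map V u v) = Cod V u \<otimes> Cod V v"
  using assms by (simp_all add: prod_map_def)

section \<open>Strictness, stability and disjointness\<close>

lemma small_empty: "{} \<in> \<U>"
  using small unfolding small_sets_def by (meson empty_subsetI)

text \<open>By stability, the empty coproduct pulls back to an empty coproduct.\<close>

lemma strict_initial:
  assumes "is_initial V z" "f \<in> hom V y z"
  shows "is_initial V y"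
proof -
  have "is_coproduct V {} X z \<iota>" for X :: "'i \<Rightarrow> 'o" and \<iota>
    using assms(1) by (auto simp: is_coproduct_def is_initial_def)
  then have "is_coproduct V {} X y \<iota>" for X :: "'i \<Rightarrow> 'o" and \<iota>
    using lextensive assms(2) small_empty
    unfolding infinitary_lextensive_def small_coproducts_stable_def by blast
  then show ?thesis
    by (auto simp: is_coproduct_def is_initial_def)
qed

lemma coproduct_pullback:
  assumes "A \<in> \<U>" "is_coproduct V A X s \<iota>" "f \<in> hom V y s"
  shows "is_coproduct V A (\<lambda>a. pb_obj V (\<iota> a) f) y (\<lambda>a. pb_snd V (\<iota> a) f)"
proof -
  have "is_pullback V (\<iota> a) f (pb_obj V (\<iota> a) f) (pb_fst V (\<iota> a) f) (pb_snd V (\<iota> a) f)" if "a \<in> A" for a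
    using assms that pb_is_pullback by (simp add: in_hom_iff is_coproduct_def)
  then show ?thesis
    by (rule lextensive[unfolded infinitary_lextensive_def small_coproducts_stable_def, THEN conjunct2,
        THEN conjunct2, THEN conjunct2, THEN conjunct2, rule_format, OF assms])
qed

text \<open>A copower of \<open>I\<close> with its injections, kept apart from the chosen
  \<open>copower V A\<close> because the object of objects of an internal category is only
  isomorphic to that one.\<close>

definition discrete :: "'i set \<Rightarrow> 'o \<Rightarrow> ('i \<Rightarrow> 'a) \<Rightarrow> bool" where
  "discrete A D e \<longleftrightarrow> A \<in> \<U> \<and> is_coproduct V A (\<lambda>_. Unit V) D e"

lemma discrete_arr:
  assumes "discrete A D e" "a \<in> A"
  shows "e a \<in> Arr V" "Dom V (e a) = Unit V" "Cod V (e a) = D"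
  using assms by (auto simp: discrete_def is_coproduct_def in_hom_iff)

text \<open>The other projection of the pullback of \<open>e a\<close> along \<open>x\<close> goes
  to \<open>I\<close> and is thus forced. What remains of the universal property says that
  \<open>pb_snd V (e a) x\<close> is the largest piece of \<open>y\<close> on which \<open>x\<close>
  is constant with value \<open>e a\<close>.\<close>

lemma fiber:
  assumes D: "discrete A D e" "a \<in> A" and x: "x \<in> hom V y D"
  shows "pb_snd V (e a) x \<in> hom V (pb_obj V (e a) x) y"
    "x \<cdot> pb_snd V (e a) x = e a \<cdot> bang (pb_obj V (e a) x)"
    "\<lbrakk>k \<in> Arr V; Cod V k = y; x \<cdot> k = e a \<cdot> bang (Dom V k)\<rbrakk>
      \<Longrightarrow> \<exists>!h. h \<in> hom V (Dom V k) (pb_obj V (e a) x) \<and> pb_snd V (e a) x \<cdot> h = k"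
proof -
  note [simp] = discrete_arr[OF D]
  have [simp]: "x \<in> Arr V" "Dom V x = y" "Cod V x = D"
    using x by (auto simp: in_hom_iff)
  show "pb_snd V (e a) x \<in> hom V (pb_obj V (e a) x) y"
    by (simp add: in_hom_iff)
  have b: "pb_fst V (e a) x = bang (pb_obj V (e a) x)"
    using bang_unique[of "pb_fst V (e a) x"] by simp
  show "x \<cdot> pb_snd V (e a) x = e a \<cdot> bang (pb_obj V (e a) x)"
    using pb_commutes[of "e a" x] b by simp
  assume k: "k \<in> Arr V" "Cod V k = y" "x \<cdot> k = e a \<cdot> bang (Dom V k)"
  show "\<exists>!h. h \<in> hom V (Dom V k) (pb_obj V (e a) x) \<and> pb_snd V (e a) x \<cdot> h = k"
  proof (rule ex1I)
    show "pb_pair V (e a) x (bang (Dom V k)) k \<in> hom V (Dom V k) (pb_obj V (e a) x) \<and>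
        pb_snd V (e a) x \<cdot> pb_pair V (e a) x (bang (Dom V k)) k = k"
      using k by (simp add: in_hom_iff)
  next
    fix h assume h: "h \<in> hom V (Dom V k) (pb_obj V (e a) x) \<and> pb_snd V (e a) x \<cdot> h = k"
    show "h = pb_pair V (e a) x (bang (Dom V k)) k"
      by (rule pb_ext[of "e a" x]) (use h k in \<open>auto simp: in_hom_iff b\<close>)
  qed
qed

text \<open>The fibres of \<open>x\<close> are the summands of \<open>W\<close>, so values over
  different points can be prescribed independently, and an arbitrary constant piece factors through
  a fibre. Naturality of \<open>\<phi>\<close> in the piece is the only condition; where a piece is
  constant at two points, both prescriptions agree because both equal
  \<open>f \<cdot> k\<close>.\<close>

lemma discrete_glue:
  assumes D: "discrete A D e" and x: "x \<in> hom V W D" and Y: "Y \<in> Obj V"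
    and \<phi>: "\<And>a k. \<lbrakk>a \<in> A; k \<in> Arr V; Cod V k = W; x \<cdot> k = e a \<cdot> bang (Dom V k)\<rbrakk>
      \<Longrightarrow> \<phi> a k \<in> hom V (Dom V k) Y"
    and \<phi>_nat: "\<And>a k l. \<lbrakk>a \<in> A; k \<in> Arr V; Cod V k = W; x \<cdot> k = e a \<cdot> bang (Dom V k); l \<in> Arr V; Cod V l = Dom V k\<rbrakk>
      \<Longrightarrow> \<phi> a (k \<cdot> l) = \<phi> a k \<cdot> l"
  shows "\<exists>f \<in> hom V W Y. \<forall>a \<in> A. \<forall>k \<in> Arr V. Cod V k = W \<and> x \<cdot> k = e a \<cdot> bang (Dom V k) \<longrightarrow> f \<cdot> k = \<phi> a k"
proof -
  let ?P = "\<lambda>a. pb_obj V (e a) x" and ?q = "\<lambda>a. pb_snd V (e a) x"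
  have q: "?q a \<in> Arr V" "Dom V (?q a) = ?P a" "Cod V (?q a) = W"
      "x \<cdot> ?q a = e a \<cdot> bang (Dom V (?q a))" if "a \<in> A" for a
    using fiber(1,2)[OF D that x] by (auto simp: in_hom_iff)
  have "is_coproduct V A ?P W ?q"
    using D x coproduct_pullback by (auto simp: discrete_def)
  from coproduct_copair[OF this Y, of "\<lambda>a. \<phi> a (?q a)"] obtain f
    where f: "f \<in> hom V W Y" "\<And>a. a \<in> A \<Longrightarrow> f \<cdot> ?q a = \<phi> a (?q a)"
    using \<phi> q by metis
  have "f \<cdot> k = \<phi> a k" if a: "a \<in> A" "k \<in> Arr V" "Cod V k = W" "x \<cdot> k = e a \<cdot> bang (Dom V k)" for a k
  proof -
    obtain h where h: "h \<in> hom V (Dom V k) (?P a)" "?q a \<cdot> h = k"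
      using fiber(3)[OF D a(1) x a(2-4)] by blast
    have "f \<cdot> k = (f \<cdot> ?q a) \<cdot> h"
      using f(1) q[OF a(1)] h by (auto simp: in_hom_iff)
    also have "\<dots> = \<phi> a (?q a \<cdot> h)"
      using f(2)[OF a(1)] \<phi>_nat[OF a(1) q(1)[OF a(1)] q(3)[OF a(1)] q(4)[OF a(1)], of h] q(2)[OF a(1)] h
      by (auto simp: in_hom_iff)
    finally show ?thesis
      using h by simp
  qed
  then show ?thesis
    using f(1) by blast
qed

text \<open>The inclusions of the fibres of \<open>x\<close> are themselves constant pieces, and
  they are jointly epic as injections of a coproduct.\<close>

lemma discrete_ext:
  assumes D: "discrete A D e" and x: "x \<in> hom V W D" and f: "f \<in> hom V W Y" and g: "g \<in> hom V W Y"
    and eq: "\<And>a k. \<lbrakk>a \<in> A; k \<in> Arr V; Cod V k = W; x \<cdot> k = e a \<cdot> bang (Dom V k)\<rbrakk> \<Longrightarrow> f \<cdot> k = g \<cdot> k"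
  shows "f = g"
proof -
  have c: "is_coproduct V A (\<lambda>a. pb_obj V (e a) x) W (\<lambda>a. pb_snd V (e a) x)"
    using D x coproduct_pullback by (auto simp: discrete_def)
  show ?thesis
    by (rule coproduct_ext[OF c f g]) (use fiber(1,2)[OF D _ x] eq in \<open>auto simp: in_hom_iff\<close>)
qed

text \<open>Such a \<open>W\<close> maps into the intersection of two distinct summands, which is
  initial by disjointness; strictness passes this on to \<open>W\<close>.\<close>

lemma discrete_disjoint:
  assumes D: "discrete A D e" and ab: "a \<in> A" "b \<in> A" "a \<noteq> b"
    and W: "W \<in> Obj V" "e a \<cdot> bang W = e b \<cdot> bang W"
  shows "is_initial V W"
proof -
  note [simp] = discrete_arr[OF D ab(1)] discrete_arr[OF D ab(2)]
  have "is_initial V (pb_obj V (e a) (e b))"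
    using lextensive D ab pb_is_pullback[of "e a" "e b"]
    unfolding infinitary_lextensive_def small_coproducts_disjoint_def discrete_def by force
  moreover have "pb_pair V (e a) (e b) (bang W) (bang W) \<in> hom V W (pb_obj V (e a) (e b))"
    using W by (simp add: in_hom_iff)
  ultimately show ?thesis
    by (rule strict_initial)
qed

text \<open>Pulling the coproduct \<open>y\<close> back along \<open>k\<close>, the summands of \<open>W\<close> other than the \<open>a\<close>-th lie over two distinct
  points and are initial, so \<open>k\<close> factors through \<open>\<iota> a\<close>.\<close>

lemma coproduct_over_discrete:
  assumes D: "discrete A D e" and Y: "is_coproduct V A Y y \<iota>" and x: "x \<in> hom V y D"
    and xi: "\<And>a. a \<in> A \<Longrightarrow> x \<cdot> \<iota> a = e a \<cdot> bang (Y a)"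
    and a: "a \<in> A" and k: "k \<in> hom V W y" "x \<cdot> k = e a \<cdot> bang W"
  shows "\<exists>!h. h \<in> hom V W (Y a) \<and> \<iota> a \<cdot> h = k"
proof -
  have A: "A \<in> \<U>"
    using D by (simp add: discrete_def)
  have ia: "\<iota> b \<in> Arr V" "Dom V (\<iota> b) = Y b" "Cod V (\<iota> b) = y" if "b \<in> A" for b
    using is_coproductD[OF Y] that by auto
  have [simp]: "k \<in> Arr V" "Dom V k = W" "Cod V k = y" "x \<in> Arr V" "Dom V x = y" "Cod V x = D"
    using k x by (auto simp: in_hom_iff)
  have W: "W \<in> Obj V"
    using Dom_Obj[of k] by simp
  let ?P = "\<lambda>b. pb_obj V (\<iota> b) k" and ?q = "\<lambda>b. pb_snd V (\<iota> b) k"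
  have cop: "is_coproduct V A ?P W ?q"
    by (rule coproduct_pullback[OF A Y k(1)])
  have q: "?q b \<in> Arr V" "Dom V (?q b) = ?P b" "Cod V (?q b) = W" "?P b \<in> Obj V" if "b \<in> A" for b
    using ia[OF that] by auto
  \<comment> \<open>Over the \<open>b\<close>-th summand the map to \<open>D\<close> takes the value
    \<open>e b\<close> through \<open>\<iota> b\<close> and the value \<open>e a\<close> through
    \<open>k\<close>.\<close>
  have init: "is_initial V (?P b)" if b: "b \<in> A" "b \<noteq> a" for b
  proof -
    have "e b \<cdot> bang (?P b) = x \<cdot> \<iota> b \<cdot> pb_fst V (\<iota> b) k"
      using ia[OF b(1)] xi[OF b(1)] discrete_arr[OF D b(1)] Cod_Obj'[of "pb_fst V (\<iota> b) k" "Y b"] by simp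
    also have "\<dots> = x \<cdot> k \<cdot> ?q b"
      using ia[OF b(1)] pb_commutes[of "\<iota> b" k] by simp
    also have "\<dots> = e a \<cdot> bang (?P b)"
      using k(2) q[OF b(1)] discrete_arr[OF D a] W by simp
    finally show ?thesis
      using discrete_disjoint[OF D b(1) a] b q by simp
  qed
  \<comment> \<open>A candidate inverse \<open>s\<close> of \<open>?q a\<close> is prescribed on the
    summands of \<open>W\<close>: the identity on the \<open>a\<close>-th, and the unique map out of
    an initial object on all others.\<close>
  have "\<exists>s \<in> hom V W (?P a). \<forall>b \<in> A. s \<cdot> ?q b = (if b = a then Idt V (?P a) else (THE f. f \<in> hom V (?P b) (?P a)))"
  proof (rule coproduct_copair[OF cop])
    show "?P a \<in> Obj V"
      using q a by simp
    fix b assume b: "b \<in> A"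
    show "(if b = a then Idt V (?P a) else (THE f. f \<in> hom V (?P b) (?P a))) \<in> hom V (?P b) (?P a)"
      using init[OF b] theI'[of "\<lambda>f. f \<in> hom V (?P b) (?P a)"] q[OF a] Idt_in[of "?P a"]
      by (auto simp: is_initial_def)
  qed
  then obtain s where s: "s \<in> Arr V" "Dom V s = W" "Cod V s = ?P a" "s \<cdot> ?q a = Idt V (?P a)"
    using a by (auto simp: in_hom_iff)
  have qs: "?q a \<cdot> s = Idt V W"
  proof (rule coproduct_ext[OF cop])
    fix b assume b: "b \<in> A"
    show "?q a \<cdot> s \<cdot> ?q b = Idt V W \<cdot> ?q b"
    proof (cases "b = a")
      case True
      then show ?thesis
        using s q[OF a] by simp
    next
      case False
      have "?q a \<cdot> s \<cdot> ?q b \<in> hom V (?P b) W" "Idt V W \<cdot> ?q b \<in> hom V (?P b) W"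
        using s q[OF a] q[OF b] W by (auto simp: in_hom_iff)
      then show ?thesis
        using init[OF b False] W unfolding is_initial_def by blast
    qed
  qed (use s q[OF a] W in \<open>auto simp: in_hom_iff\<close>)
  have mono: "is_mono V (\<iota> a)"
    using lextensive A Y a unfolding infinitary_lextensive_def small_coproducts_disjoint_def by blast
  show ?thesis
  proof (rule ex_ex1I)
    \<comment> \<open>Since \<open>?q a\<close> is invertible, the first projection of the pullback,
      carried along \<open>s\<close>, is the wanted factorisation; it is unique because
      \<open>\<iota> a\<close> is monic.\<close>
    have "\<iota> a \<cdot> (pb_fst V (\<iota> a) k \<cdot> s) = \<iota> a \<cdot> pb_fst V (\<iota> a) k \<cdot> s"
      using ia[OF a] s by simp
    also have "\<dots> = k \<cdot> ?q a \<cdot> s"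
      using ia[OF a] s pb_commutes[of "\<iota> a" k] by simp
    also have "\<dots> = k"
      using qs s ia[OF a] by simp
    finally have "\<iota> a \<cdot> (pb_fst V (\<iota> a) k \<cdot> s) = k" .
    moreover have "pb_fst V (\<iota> a) k \<cdot> s \<in> hom V W (Y a)"
      using ia[OF a] s by (auto simp: in_hom_iff)
    ultimately show "\<exists>h. h \<in> hom V W (Y a) \<and> \<iota> a \<cdot> h = k"
      by blast
  next
    fix h h' assume "h \<in> hom V W (Y a) \<and> \<iota> a \<cdot> h = k" "h' \<in> hom V W (Y a) \<and> \<iota> a \<cdot> h' = k"
    then show "h = h'"
      using mono ia[OF a] unfolding is_mono_def by metis
  qed
qed

end

section \<open>Internal categories through generalised elements\<close>

definition icomposable :: "('o, 'a, 'm) cat_scheme \<Rightarrow> ('o, 'a) icat \<Rightarrow> 'a \<Rightarrow> 'a \<Rightarrow> bool" where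
  "icomposable V C g f \<longleftrightarrow> g \<in> Arr V \<and> f \<in> Arr V \<and> Cod V g = icat1 C \<and> Cod V f = icat1 C \<and>
     Dom V g = Dom V f \<and> isrc C \<cdot>\<^bsub>V\<^esub> g = itgt C \<cdot>\<^bsub>V\<^esub> f"

text \<open>Composition as an operation on elements with a common domain; by
  \<open>icomp_nat\<close> it is natural in that domain, and its value at the two projections of the
  object of pairs is \<open>icmp\<close> again.\<close>

definition icomp :: "('o, 'a, 'm) cat_scheme \<Rightarrow> ('o, 'a) icat \<Rightarrow> 'a \<Rightarrow> 'a \<Rightarrow> 'a" where
  "icomp V C g f = icmp C \<cdot>\<^bsub>V\<^esub> pairs_pair V C g f"

locale internal_category_in = finitely_complete V + internal_category V C
  for V :: "('o, 'a, 'm) cat_scheme" (structure) and C :: "('o, 'a) icat"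
begin

lemma arr [simp]:
  "icat0 C \<in> Obj V" "icat1 C \<in> Obj V"
  "isrc C \<in> Arr V" "Dom V (isrc C) = icat1 C" "Cod V (isrc C) = icat0 C"
  "itgt C \<in> Arr V" "Dom V (itgt C) = icat1 C" "Cod V (itgt C) = icat0 C"
  "iidt C \<in> Arr V" "Dom V (iidt C) = icat0 C" "Cod V (iidt C) = icat1 C"
  "icmp C \<in> Arr V" "Dom V (icmp C) = pairs_obj V C" "Cod V (icmp C) = icat1 C"
  using icat0_in icat1_in isrc_in itgt_in iidt_in icmp_in by (auto simp: in_hom_iff)

lemma icomp_arr [simp]:
  assumes "icomposable V C g f"
  shows "icomp V C g f \<in> Arr V" "Dom V (icomp V C g f) = Dom V f" "Cod V (icomp V C g f) = icat1 C"
  using assms by (simp_all add: icomposable_def icomp_def)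

lemma isrc_icomp [simp]: "icomposable V C g f \<Longrightarrow> isrc C \<cdot> icomp V C g f = isrc C \<cdot> f"
  and itgt_icomp [simp]: "icomposable V C g f \<Longrightarrow> itgt C \<cdot> icomp V C g f = itgt C \<cdot> g"
  by (simp_all add: icomposable_def icomp_def Cmp_reassoc[OF isrc_icmp] Cmp_reassoc[OF itgt_icmp])

lemma icomp_nat:
  assumes "icomposable V C g f" "k \<in> Arr V" "Cod V k = Dom V f"
  shows "icomp V C g f \<cdot> k = icomp V C (g \<cdot> k) (f \<cdot> k)"
  using assms by (simp add: icomposable_def icomp_def pb_pair_comp)

lemma isrc_iidt_comp: "x \<in> Arr V \<Longrightarrow> Cod V x = icat0 C \<Longrightarrow> isrc C \<cdot> (iidt C \<cdot> x) = x"
  and itgt_iidt_comp: "x \<in> Arr V \<Longrightarrow> Cod V x = icat0 C \<Longrightarrow> itgt C \<cdot> (iidt C \<cdot> x) = x"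
  by (simp_all add: Cmp_reassoc[OF isrc_iidt] Cmp_reassoc[OF itgt_iidt])

text \<open>The axiom of the internal category is the case where \<open>x\<close> is the identity of
  \<open>icat1 C\<close>; naturality transports it along any \<open>x\<close>.\<close>

lemma icomp_iidt_right:
  assumes "x \<in> Arr V" "Cod V x = icat1 C"
  shows "icomp V C x (iidt C \<cdot> (isrc C \<cdot> x)) = x"
proof -
  have "icomposable V C (Idt V (icat1 C)) (iidt C \<cdot> isrc C)"
    by (simp add: icomposable_def itgt_iidt_comp)
  from icomp_nat[OF this, of x] show ?thesis
    using assms icmp_unit_right by (simp add: icomp_def)
qed

lemma icomp_iidt_left:
  assumes "x \<in> Arr V" "Cod V x = icat1 C"
  shows "icomp V C (iidt C \<cdot> (itgt C \<cdot> x)) x = x"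
proof -
  have "icomposable V C (iidt C \<cdot> itgt C) (Idt V (icat1 C))"
    by (simp add: icomposable_def isrc_iidt_comp)
  from icomp_nat[OF this, of x] show ?thesis
    using assms icmp_unit_left by (simp add: icomp_def)
qed

text \<open>The axiom is associativity for the universal triple, given by the projections of the
  object of triples. The elements \<open>h\<close>, \<open>g\<close>, \<open>f\<close> induce a map
  \<open>?t\<close> into that object, and precomposition with it gives the general case.\<close>

lemma icomp_assoc:
  assumes hg: "icomposable V C h g" and gf: "icomposable V C g f"
  shows "icomp V C (icomp V C h g) f = icomp V C h (icomp V C g f)"
proof -
  let ?S = "isrc C \<cdot> pairs_snd V C"
  let ?x = "pairs_pair V C h g" and ?p = "triples_fst V C" and ?q = "triples_snd V C"
  let ?t = "pb_pair V ?S (itgt C) ?x f"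
  have x [simp]: "?x \<in> Arr V" "Dom V ?x = Dom V f" "Cod V ?x = pairs_obj V C"
      "pairs_fst V C \<cdot> ?x = h" "pairs_snd V C \<cdot> ?x = g"
    using hg gf by (auto simp: icomposable_def)
  have f [simp]: "f \<in> Arr V" "Cod V f = icat1 C" and sg: "isrc C \<cdot> g = itgt C \<cdot> f"
    using gf by (auto simp: icomposable_def)
  have t [simp]: "?t \<in> Arr V" "Dom V ?t = Dom V f" "Cod V ?t = pb_obj V ?S (itgt C)"
      "?p \<cdot> ?t = ?x" "?q \<cdot> ?t = f"
    by (simp_all add: sg)
  have pq: "isrc C \<cdot> (pairs_snd V C \<cdot> ?p) = itgt C \<cdot> ?q"
    using pb_commutes[of ?S "itgt C"] by simp
  have c1: "icomposable V C (pairs_fst V C \<cdot> ?p) (pairs_snd V C \<cdot> ?p)"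
    using pb_commutes[of "isrc C" "itgt C"] by (simp add: icomposable_def flip: Cmp_assoc')
  have c2: "icomposable V C (pairs_snd V C \<cdot> ?p) ?q"
    using pq by (simp add: icomposable_def)
  have a: "icmp C \<cdot> ?p = icomp V C (pairs_fst V C \<cdot> ?p) (pairs_snd V C \<cdot> ?p)"
    by (simp add: icomp_def pb_pair_projections)
  have c3: "icomposable V C (icomp V C (pairs_fst V C \<cdot> ?p) (pairs_snd V C \<cdot> ?p)) ?q"
    and c4: "icomposable V C (pairs_fst V C \<cdot> ?p) (icomp V C (pairs_snd V C \<cdot> ?p) ?q)"
    using c1 c2 unfolding icomposable_def
    by (simp_all add: isrc_icomp[OF c1] itgt_icomp[OF c2] icomp_arr[OF c1] icomp_arr[OF c2])
  have "icomp V C (icomp V C (pairs_fst V C \<cdot> ?p) (pairs_snd V C \<cdot> ?p)) ?q =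
      icomp V C (pairs_fst V C \<cdot> ?p) (icomp V C (pairs_snd V C \<cdot> ?p) ?q)"
    using icmp_assoc unfolding a by (simp add: icomp_def)
  then have "icomp V C (icomp V C (pairs_fst V C \<cdot> ?p) (pairs_snd V C \<cdot> ?p)) ?q \<cdot> ?t =
      icomp V C (pairs_fst V C \<cdot> ?p) (icomp V C (pairs_snd V C \<cdot> ?p) ?q) \<cdot> ?t"
    by simp
  then show ?thesis
    by (simp add: icomp_nat c1 c2 c3 c4)
qed

end

section \<open>Recovering internal categories and functors from laws on elements\<close>

context finitely_complete
begin

text \<open>Each axiom is a law on elements evaluated at universal elements: the identity of
  \<open>icat1 K\<close> for the units, the projections of the object of pairs for source and
  target, those of the object of triples for associativity.\<close>

lemma internal_categoryI:
  assumes src: "isrc K \<in> hom C (icat1 K) (icat0 K)" and tgt: "itgt K \<in> hom C (icat1 K) (icat0 K)"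
    and idt: "iidt K \<in> hom C (icat0 K) (icat1 K)" and cmp: "icmp K \<in> hom C (pairs_obj C K) (icat1 K)"
    and idt_src: "isrc K \<cdot> iidt K = Idt C (icat0 K)" and idt_tgt: "itgt K \<cdot> iidt K = Idt C (icat0 K)"
    and cmp_src: "\<And>g f. icomposable C K g f \<Longrightarrow> isrc K \<cdot> icomp C K g f = isrc K \<cdot> f"
    and cmp_tgt: "\<And>g f. icomposable C K g f \<Longrightarrow> itgt K \<cdot> icomp C K g f = itgt K \<cdot> g"
    and unit_right: "\<And>x. \<lbrakk>x \<in> Arr C; Cod C x = icat1 K\<rbrakk> \<Longrightarrow> icomp C K x (iidt K \<cdot> (isrc K \<cdot> x)) = x"
    and unit_left: "\<And>x. \<lbrakk>x \<in> Arr C; Cod C x = icat1 K\<rbrakk> \<Longrightarrow> icomp C K (iidt K \<cdot> (itgt K \<cdot> x)) x = x"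
    and assoc: "\<And>h g f. \<lbrakk>icomposable C K h g; icomposable C K g f\<rbrakk>
      \<Longrightarrow> icomp C K (icomp C K h g) f = icomp C K h (icomp C K g f)"
  shows "internal_category C K"
proof -
  note [simp] = src[unfolded in_hom_iff] tgt[unfolded in_hom_iff] idt[unfolded in_hom_iff]
    cmp[unfolded in_hom_iff]
  have [simp]: "icat0 K \<in> Obj C" "icat1 K \<in> Obj C"
    using Dom_Obj'[of "iidt K" "icat0 K"] Cod_Obj'[of "iidt K" "icat1 K"] by simp_all
  have c: "icomposable C K (pairs_fst C K) (pairs_snd C K)"
    by (simp add: icomposable_def pb_commutes)
  have p: "pairs_pair C K (pairs_fst C K) (pairs_snd C K) = Idt C (pairs_obj C K)"
    using pb_pair_projections[of "isrc K" "itgt K" "Idt C (pairs_obj C K)"] by simp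
  have q: "pairs_pair C K (pairs_fst C K \<cdot> k) (pairs_snd C K \<cdot> k) = k" if "k \<in> Arr C" "Cod C k = pairs_obj C K" for k
    using pb_pair_projections[of "isrc K" "itgt K" k] that by simp
  let ?S = "isrc K \<cdot> pairs_snd C K"
  have c1: "icomposable C K (pairs_fst C K \<cdot> triples_fst C K) (pairs_snd C K \<cdot> triples_fst C K)"
    using pb_commutes[of "isrc K" "itgt K"] by (simp add: icomposable_def flip: Cmp_assoc')
  have c2: "icomposable C K (pairs_snd C K \<cdot> triples_fst C K) (triples_snd C K)"
    using pb_commutes[of ?S "itgt K"] by (simp add: icomposable_def)
  show ?thesis
  proof
    show "isrc K \<cdot> icmp K = isrc K \<cdot> pairs_snd C K" "itgt K \<cdot> icmp K = itgt K \<cdot> pairs_fst C K"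
      using cmp_src[OF c] cmp_tgt[OF c] by (simp_all add: icomp_def p)
    show "icmp K \<cdot> pairs_pair C K (Idt C (icat1 K)) (iidt K \<cdot> isrc K) = Idt C (icat1 K)"
      "icmp K \<cdot> pairs_pair C K (iidt K \<cdot> itgt K) (Idt C (icat1 K)) = Idt C (icat1 K)"
      using unit_right[of "Idt C (icat1 K)"] unit_left[of "Idt C (icat1 K)"] by (simp_all add: icomp_def)
    show "icmp K \<cdot> pairs_pair C K (icmp K \<cdot> triples_fst C K) (triples_snd C K) =
       icmp K \<cdot> pairs_pair C K (pairs_fst C K \<cdot> triples_fst C K)
         (icmp K \<cdot> pairs_pair C K (pairs_snd C K \<cdot> triples_fst C K) (triples_snd C K))"
      using assoc[OF c1 c2] by (simp add: icomp_def q)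
  qed (use src tgt idt cmp idt_src idt_tgt in simp_all)
qed

lemma internal_functorD:
  assumes "internal_functor C F"
  shows "ifun0 F \<in> Arr C" "Dom C (ifun0 F) = icat0 (ifdom F)" "Cod C (ifun0 F) = icat0 (ifcod F)"
    "ifun1 F \<in> Arr C" "Dom C (ifun1 F) = icat1 (ifdom F)" "Cod C (ifun1 F) = icat1 (ifcod F)"
  using assms by (auto simp: internal_functor_def in_hom_iff)

lemma internal_functor_icomposable:
  assumes F: "internal_functor C F" and gf: "icomposable C (ifdom F) g f"
  shows "icomposable C (ifcod F) (ifun1 F \<cdot> g) (ifun1 F \<cdot> f)"
proof -
  interpret F: internal_functor C F by (rule F)
  interpret K: internal_category_in C "ifdom F"
    using F.ifdom by (simp add: internal_category_in_def finitely_complete_axioms)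
  interpret L: internal_category_in C "ifcod F"
    using F.ifcod by (simp add: internal_category_in_def finitely_complete_axioms)
  show ?thesis
    using gf internal_functorD[OF F]
    by (auto simp: icomposable_def Cmp_reassoc[OF F.ifun_isrc] Cmp_reassoc[OF F.ifun_itgt])
qed

text \<open>The functor axiom is the case of the universal composable pair; \<open>g\<close> and
  \<open>f\<close> induce a map into the object of pairs, and naturality of \<open>icomp\<close>
  does the rest.\<close>

lemma internal_functor_icomp:
  assumes F: "internal_functor C F" and gf: "icomposable C (ifdom F) g f"
  shows "ifun1 F \<cdot> icomp C (ifdom F) g f = icomp C (ifcod F) (ifun1 F \<cdot> g) (ifun1 F \<cdot> f)"
proof -
  interpret F: internal_functor C F by (rule F)
  interpret K: internal_category_in C "ifdom F"
    using F.ifdom by (simp add: internal_category_in_def finitely_complete_axioms)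
  interpret L: internal_category_in C "ifcod F"
    using F.ifcod by (simp add: internal_category_in_def finitely_complete_axioms)
  note [simp] = internal_functorD[OF F]
  let ?K = "ifdom F"
  let ?x = "pairs_pair C ?K g f"
  have x [simp]: "?x \<in> Arr C" "Dom C ?x = Dom C f" "Cod C ?x = pairs_obj C ?K"
      "pairs_fst C ?K \<cdot> ?x = g" "pairs_snd C ?K \<cdot> ?x = f"
    using gf by (auto simp: icomposable_def)
  have c: "icomposable C ?K (pairs_fst C ?K) (pairs_snd C ?K)"
    by (simp add: icomposable_def pb_commutes)
  have "ifun1 F \<cdot> icomp C ?K g f = (ifun1 F \<cdot> icmp ?K) \<cdot> ?x"
    by (simp add: icomp_def)
  also have "\<dots> = icomp C (ifcod F) (ifun1 F \<cdot> pairs_fst C ?K) (ifun1 F \<cdot> pairs_snd C ?K) \<cdot> ?x"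
    by (simp only: F.ifun_icmp icomp_def)
  also have "\<dots> = icomp C (ifcod F) (ifun1 F \<cdot> g) (ifun1 F \<cdot> f)"
    by (simp add: L.icomp_nat[OF internal_functor_icomposable[OF F c]])
  finally show ?thesis .
qed

lemma internal_functorI:
  assumes K: "internal_category C (ifdom F)" and L: "internal_category C (ifcod F)"
    and F0: "ifun0 F \<in> hom C (icat0 (ifdom F)) (icat0 (ifcod F))"
    and F1: "ifun1 F \<in> hom C (icat1 (ifdom F)) (icat1 (ifcod F))"
    and src: "isrc (ifcod F) \<cdot> ifun1 F = ifun0 F \<cdot> isrc (ifdom F)"
    and tgt: "itgt (ifcod F) \<cdot> ifun1 F = ifun0 F \<cdot> itgt (ifdom F)"
    and idt: "ifun1 F \<cdot> iidt (ifdom F) = iidt (ifcod F) \<cdot> ifun0 F"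
    and cmp: "\<And>g f. icomposable C (ifdom F) g f \<Longrightarrow>
      ifun1 F \<cdot> icomp C (ifdom F) g f = icomp C (ifcod F) (ifun1 F \<cdot> g) (ifun1 F \<cdot> f)"
  shows "internal_functor C F"
proof -
  interpret K: internal_category_in C "ifdom F"
    using K by (simp add: internal_category_in_def finitely_complete_axioms)
  let ?K = "ifdom F"
  have c: "icomposable C ?K (pairs_fst C ?K) (pairs_snd C ?K)"
    by (simp add: icomposable_def pb_commutes)
  have p: "pairs_pair C ?K (pairs_fst C ?K) (pairs_snd C ?K) = Idt C (pairs_obj C ?K)"
    using pb_pair_projections[of "isrc ?K" "itgt ?K" "Idt C (pairs_obj C ?K)"] by simp
  have "ifun1 F \<cdot> icmp ?K = icmp (ifcod F) \<cdot> pairs_pair C (ifcod F)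
      (ifun1 F \<cdot> pairs_fst C ?K) (ifun1 F \<cdot> pairs_snd C ?K)"
    using cmp[OF c] by (simp add: icomp_def p)
  then show ?thesis
    by (intro internal_functor.intro) (use assms in simp_all)
qed

lemma category_Cat_int: "category (Cat_int C)"
proof
  fix K assume "K \<in> Obj (Cat_int C)"
  then have K: "internal_category C K"
    by (simp add: Cat_int_def)
  interpret K: internal_category_in C K
    using K by (simp add: internal_category_in_def finitely_complete_axioms)
  have "internal_functor C \<lparr>ifdom = K, ifcod = K, ifun0 = Idt C (icat0 K), ifun1 = Idt C (icat1 K)\<rparr>"
  proof (rule internal_functorI)
    fix g f assume "icomposable C (ifdom \<lparr>ifdom = K, ifcod = K, ifun0 = Idt C (icat0 K), ifun1 = Idt C (icat1 K)\<rparr>) g f"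
    then have c: "icomposable C K g f"
      by simp
    then have "g \<in> Arr C" "f \<in> Arr C" "Cod C g = icat1 K" "Cod C f = icat1 K"
      by (simp_all add: icomposable_def)
    then show "ifun1 \<lparr>ifdom = K, ifcod = K, ifun0 = Idt C (icat0 K), ifun1 = Idt C (icat1 K)\<rparr> \<cdot>
      icomp C (ifdom \<lparr>ifdom = K, ifcod = K, ifun0 = Idt C (icat0 K), ifun1 = Idt C (icat1 K)\<rparr>) g f =
      icomp C (ifcod \<lparr>ifdom = K, ifcod = K, ifun0 = Idt C (icat0 K), ifun1 = Idt C (icat1 K)\<rparr>)
       (ifun1 \<lparr>ifdom = K, ifcod = K, ifun0 = Idt C (icat0 K), ifun1 = Idt C (icat1 K)\<rparr> \<cdot> g)
       (ifun1 \<lparr>ifdom = K, ifcod = K, ifun0 = Idt C (icat0 K), ifun1 = Idt C (icat1 K)\<rparr> \<cdot> f)"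
      using K.icomp_arr[OF c] by simp
  qed (use K in \<open>simp_all add: in_hom_iff\<close>)
  then show "Idt (Cat_int C) K \<in> hom (Cat_int C) K K"
    by (simp add: Cat_int_def in_hom_iff)
next
  fix F K L G M assume "F \<in> hom (Cat_int C) K L" "G \<in> hom (Cat_int C) L M"
  then have F: "internal_functor C F" "ifdom F = K" "ifcod F = L"
    and G: "internal_functor C G" "ifdom G = L" "ifcod G = M"
    by (auto simp: Cat_int_def in_hom_iff)
  interpret F: internal_functor C F by (rule F(1))
  interpret G: internal_functor C G by (rule G(1))
  interpret K: internal_category_in C K
    using F.ifdom F(2) by (simp add: internal_category_in_def finitely_complete_axioms)
  interpret L: internal_category_in C L
    using F.ifcod F(3) by (simp add: internal_category_in_def finitely_complete_axioms)
  interpret M: internal_category_in C M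
    using G.ifcod G(3) by (simp add: internal_category_in_def finitely_complete_axioms)
  note [simp] = internal_functorD[OF F(1)] internal_functorD[OF G(1)] F(2,3) G(2,3)
  have F': "isrc L \<cdot> ifun1 F = ifun0 F \<cdot> isrc K" "itgt L \<cdot> ifun1 F = ifun0 F \<cdot> itgt K"
      "ifun1 F \<cdot> iidt K = iidt L \<cdot> ifun0 F"
    using F.ifun_isrc F.ifun_itgt F.ifun_iidt by simp_all
  have G': "isrc M \<cdot> ifun1 G = ifun0 G \<cdot> isrc L" "itgt M \<cdot> ifun1 G = ifun0 G \<cdot> itgt L"
      "ifun1 G \<cdot> iidt L = iidt M \<cdot> ifun0 G"
    using G.ifun_isrc G.ifun_itgt G.ifun_iidt by simp_all
  let ?GF = "\<lparr>ifdom = K, ifcod = M, ifun0 = ifun0 G \<cdot> ifun0 F, ifun1 = ifun1 G \<cdot> ifun1 F\<rparr>"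
  have "internal_functor C ?GF"
  proof (rule internal_functorI)
    fix g f assume "icomposable C (ifdom ?GF) g f"
    then have c: "icomposable C K g f"
      by simp
    then have gf: "g \<in> Arr C" "f \<in> Arr C" "Cod C g = icat1 K" "Cod C f = icat1 K"
      by (simp_all add: icomposable_def)
    have d: "icomposable C L (ifun1 F \<cdot> g) (ifun1 F \<cdot> f)"
      using internal_functor_icomposable[OF F(1)] c by simp
    have "ifun1 G \<cdot> (ifun1 F \<cdot> icomp C K g f) = icomp C M (ifun1 G \<cdot> (ifun1 F \<cdot> g)) (ifun1 G \<cdot> (ifun1 F \<cdot> f))"
      using internal_functor_icomp[OF F(1), of g f] internal_functor_icomp[OF G(1), of "ifun1 F \<cdot> g" "ifun1 F \<cdot> f"] c d
      by simp
    then show "ifun1 ?GF \<cdot> icomp C (ifdom ?GF) g f = icomp C (ifcod ?GF) (ifun1 ?GF \<cdot> g) (ifun1 ?GF \<cdot> f)"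
      using gf K.icomp_arr[OF c] by simp
  qed (use K.internal_category_axioms M.internal_category_axioms in
      \<open>simp_all add: in_hom_iff F' G' Cmp_reassoc[OF G'(1)] Cmp_reassoc[OF G'(2)] Cmp_reassoc[OF G'(3)]\<close>)
  then show "Cmp (Cat_int C) G F \<in> hom (Cat_int C) K M"
    by (simp add: Cat_int_def in_hom_iff)
next
  fix F K L assume "F \<in> hom (Cat_int C) K L"
  then have F: "internal_functor C F" "ifdom F = K" "ifcod F = L"
    by (auto simp: Cat_int_def in_hom_iff)
  note [simp] = internal_functorD[OF F(1)] F(2,3)
  show "Cmp (Cat_int C) F (Idt (Cat_int C) K) = F" "Cmp (Cat_int C) (Idt (Cat_int C) L) F = F"
    by (simp_all add: Cat_int_def)
next
  fix F K L G M H N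
  assume "F \<in> hom (Cat_int C) K L" "G \<in> hom (Cat_int C) L M" "H \<in> hom (Cat_int C) M N"
  then have "internal_functor C F" "ifdom F = K" "ifcod F = L"
    "internal_functor C G" "ifdom G = L" "ifcod G = M"
    "internal_functor C H" "ifdom H = M" "ifcod H = N"
    by (auto simp: Cat_int_def in_hom_iff)
  then show "Cmp (Cat_int C) (Cmp (Cat_int C) H G) F = Cmp (Cat_int C) H (Cmp (Cat_int C) G F)"
    by (simp add: Cat_int_def internal_functorD)
qed (auto simp: Cat_int_def internal_functor_def)

lemma is_functor_U0_fctr: "is_functor (Cat_int C) C U0_fctr"
  by unfold_locales
    (auto simp: Cat_int_def U0_fctr_def in_hom_iff internal_functorD internal_category_def)

end

section \<open>Enriched categories through generalised elements\<close>

context lextensive_cartesian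
begin

definition ecomp :: "('i, 'o, 'a) ecat \<Rightarrow> 'i \<Rightarrow> 'i \<Rightarrow> 'i \<Rightarrow> 'a \<Rightarrow> 'a \<Rightarrow> 'a" where
  "ecomp E a b c g f = ecmp E a b c \<cdot> prod_pair V g f"

lemma enriched_arr:
  assumes "enriched_category \<U> V E" "a \<in> eob E"
  shows "b \<in> eob E \<Longrightarrow> ehom E a b \<in> Obj V" "eidt E a \<in> Arr V" "Dom V (eidt E a) = Unit V" "Cod V (eidt E a) = ehom E a a"
    "b \<in> eob E \<Longrightarrow> c \<in> eob E \<Longrightarrow> ecmp E a b c \<in> Arr V"
    "b \<in> eob E \<Longrightarrow> c \<in> eob E \<Longrightarrow> Dom V (ecmp E a b c) = ehom E b c \<otimes> ehom E a b"
    "b \<in> eob E \<Longrightarrow> c \<in> eob E \<Longrightarrow> Cod V (ecmp E a b c) = ehom E a c"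
  using assms by (auto simp: enriched_category_def in_hom_iff)

lemma ecomp_arr:
  assumes "enriched_category \<U> V E" "a \<in> eob E" "b \<in> eob E" "c \<in> eob E"
    and "g \<in> Arr V" "f \<in> Arr V" "Dom V g = Dom V f" "Cod V g = ehom E b c" "Cod V f = ehom E a b"
  shows "ecomp E a b c g f \<in> Arr V" "Dom V (ecomp E a b c g f) = Dom V f" "Cod V (ecomp E a b c g f) = ehom E a c"
  using assms by (simp_all add: ecomp_def enriched_arr)

lemma ecomp_nat:
  assumes "enriched_category \<U> V E" "a \<in> eob E" "b \<in> eob E" "c \<in> eob E"
    and "g \<in> Arr V" "f \<in> Arr V" "Dom V g = Dom V f" "Cod V g = ehom E b c" "Cod V f = ehom E a b"
    and "k \<in> Arr V" "Cod V k = Dom V f"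
  shows "ecomp E a b c g f \<cdot> k = ecomp E a b c (g \<cdot> k) (f \<cdot> k)"
  using assms by (simp add: ecomp_def enriched_arr)

text \<open>The pentagon-free form of the axiom: evaluated at the nested pair of \<open>h\<close>,
  \<open>g\<close> and \<open>f\<close>, the associator merely rebrackets and both sides become
  iterated \<open>ecomp\<close>.\<close>

lemma ecomp_assoc:
  assumes E: "enriched_category \<U> V E" and o: "a \<in> eob E" "b \<in> eob E" "c \<in> eob E" "d \<in> eob E"
    and h: "h \<in> Arr V" "Cod V h = ehom E c d"
    and g: "g \<in> Arr V" "Dom V g = Dom V h" "Cod V g = ehom E b c"
    and f: "f \<in> Arr V" "Dom V f = Dom V h" "Cod V f = ehom E a b"
  shows "ecomp E a b d (ecomp E b c d h g) f = ecomp E a c d h (ecomp E a b c g f)"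
proof -
  note [simp] = enriched_arr[OF E] o h g f
  let ?t = "prod_pair V (prod_pair V h g) f"
  have "ecomp E a b d (ecomp E b c d h g) f =
      (ecmp E a b d \<cdot> prod_map V (ecmp E b c d) (Idt V (ehom E a b))) \<cdot> ?t"
    by (simp add: ecomp_def prod_map_pair)
  also have "\<dots> = (ecmp E a c d \<cdot> prod_map V (Idt V (ehom E c d)) (ecmp E a b c)
                \<cdot> prod_assoc V (ehom E c d) (ehom E b c) (ehom E a b)) \<cdot> ?t"
    by (simp only: enriched_category.ecmp_assoc[OF E o])
  also have "\<dots> = ecomp E a c d h (ecomp E a b c g f)"
    by (simp add: ecomp_def prod_map_pair prod_assoc_def)
  finally show ?thesis .
qed

lemma ecomp_eidt_right:
  assumes E: "enriched_category \<U> V E" and o: "a \<in> eob E" "b \<in> eob E"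
    and f: "f \<in> Arr V" "Cod V f = ehom E a b"
  shows "ecomp E a a b f (eidt E a \<cdot> bang (Dom V f)) = f"
proof -
  note [simp] = enriched_arr[OF E] o f
  have "ecomp E a a b f (eidt E a \<cdot> bang (Dom V f)) =
      (ecmp E a a b \<cdot> prod_map V (Idt V (ehom E a b)) (eidt E a)) \<cdot> prod_pair V f (bang (Dom V f))"
    by (simp add: ecomp_def prod_map_pair)
  also have "\<dots> = f"
    by (simp add: enriched_category.ecmp_unit_right[OF E o])
  finally show ?thesis .
qed

lemma ecomp_eidt_left:
  assumes E: "enriched_category \<U> V E" and o: "a \<in> eob E" "b \<in> eob E"
    and f: "f \<in> Arr V" "Cod V f = ehom E a b"
  shows "ecomp E a b b (eidt E b \<cdot> bang (Dom V f)) f = f"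
proof -
  note [simp] = enriched_arr[OF E] o f
  have "ecomp E a b b (eidt E b \<cdot> bang (Dom V f)) f =
      (ecmp E a b b \<cdot> prod_map V (eidt E b) (Idt V (ehom E a b))) \<cdot> prod_pair V (bang (Dom V f)) f"
    by (simp add: ecomp_def prod_map_pair)
  also have "\<dots> = f"
    by (simp add: enriched_category.ecmp_unit_left[OF E o])
  finally show ?thesis .
qed

text \<open>The diagrams are recovered by evaluating the laws at the projections of the threefold
  product and, for the units, at the projection from the product with \<open>I\<close>.\<close>

lemma enriched_categoryI:
  assumes small: "eob E \<in> \<U>"
    and hom: "\<And>a b. \<lbrakk>a \<in> eob E; b \<in> eob E\<rbrakk> \<Longrightarrow> ehom E a b \<in> Obj V"
    and idt: "\<And>a. a \<in> eob E \<Longrightarrow> eidt E a \<in> hom V (Unit V) (ehom E a a)"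
    and cmp: "\<And>a b c. \<lbrakk>a \<in> eob E; b \<in> eob E; c \<in> eob E\<rbrakk>
          \<Longrightarrow> ecmp E a b c \<in> hom V (ehom E b c \<otimes> ehom E a b) (ehom E a c)"
    and assoc: "\<And>a b c d h g f. \<lbrakk>a \<in> eob E; b \<in> eob E; c \<in> eob E; d \<in> eob E;
        h \<in> Arr V; Cod V h = ehom E c d; g \<in> Arr V; Dom V g = Dom V h; Cod V g = ehom E b c;
        f \<in> Arr V; Dom V f = Dom V h; Cod V f = ehom E a b\<rbrakk>
      \<Longrightarrow> ecomp E a b d (ecomp E b c d h g) f = ecomp E a c d h (ecomp E a b c g f)"
    and unit_right: "\<And>a b f. \<lbrakk>a \<in> eob E; b \<in> eob E; f \<in> Arr V; Cod V f = ehom E a b\<rbrakk>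
      \<Longrightarrow> ecomp E a a b f (eidt E a \<cdot> bang (Dom V f)) = f"
    and unit_left: "\<And>a b f. \<lbrakk>a \<in> eob E; b \<in> eob E; f \<in> Arr V; Cod V f = ehom E a b\<rbrakk>
      \<Longrightarrow> ecomp E a b b (eidt E b \<cdot> bang (Dom V f)) f = f"
    and undef: "\<And>a b. \<not> (a \<in> eob E \<and> b \<in> eob E) \<Longrightarrow> ehom E a b = undefined"
      "\<And>a. a \<notin> eob E \<Longrightarrow> eidt E a = undefined"
      "\<And>a b c. \<not> (a \<in> eob E \<and> b \<in> eob E \<and> c \<in> eob E) \<Longrightarrow> ecmp E a b c = undefined"
  shows "enriched_category \<U> V E"
proof -
  have [simp]: "ecmp E a b c \<in> Arr V" "Dom V (ecmp E a b c) = ehom E b c \<otimes> ehom E a b"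
    "Cod V (ecmp E a b c) = ehom E a c" if "a \<in> eob E" "b \<in> eob E" "c \<in> eob E" for a b c
    using cmp that by (auto simp: in_hom_iff)
  have [simp]: "eidt E a \<in> Arr V" "Dom V (eidt E a) = Unit V" "Cod V (eidt E a) = ehom E a a" if "a \<in> eob E" for a
    using idt that by (auto simp: in_hom_iff)
  note [simp] = hom
  show ?thesis
  proof
    fix a b c d assume o [simp]: "a \<in> eob E" "b \<in> eob E" "c \<in> eob E" "d \<in> eob E"
    let ?X = "ehom E c d" and ?Y = "ehom E b c" and ?Z = "ehom E a b"
    let ?h = "Pr1 V ?X ?Y \<cdot> Pr1 V (?X \<otimes> ?Y) ?Z" and ?g = "Pr2 V ?X ?Y \<cdot> Pr1 V (?X \<otimes> ?Y) ?Z"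
      and ?f = "Pr2 V (?X \<otimes> ?Y) ?Z"
    have hg: "prod_pair V ?h ?g = Pr1 V (?X \<otimes> ?Y) ?Z"
      by (rule prod_pair_projections) simp_all
    have "ecomp E a b d (ecomp E b c d ?h ?g) ?f = ecomp E a c d ?h (ecomp E a b c ?g ?f)"
      by (rule assoc) simp_all
    then show "ecmp E a b d \<cdot> prod_map V (ecmp E b c d) (Idt V (ehom E a b)) =
              ecmp E a c d \<cdot> prod_map V (Idt V (ehom E c d)) (ecmp E a b c)
                \<cdot> prod_assoc V (ehom E c d) (ehom E b c) (ehom E a b)"
      unfolding prod_assoc_def
      by (simp add: ecomp_def prod_map_pair hg) (simp add: prod_map_def)
  next
    fix a b assume o [simp]: "a \<in> eob E" "b \<in> eob E"
    \<comment> \<open>Maps into the terminal object are unique, so the projection onto the factor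
      \<open>I\<close> can replace \<open>bang\<close>.\<close>
    have b: "bang (ehom E a b \<otimes> Unit V) = Pr2 V (ehom E a b) (Unit V)"
        "bang (Unit V \<otimes> ehom E a b) = Pr1 V (Unit V) (ehom E a b)"
      using bang_unique[of "Pr2 V (ehom E a b) (Unit V)"] bang_unique[of "Pr1 V (Unit V) (ehom E a b)"]
      by simp_all
    show "ecmp E a a b \<cdot> prod_map V (Idt V (ehom E a b)) (eidt E a) = Pr1 V (ehom E a b) (Unit V)"
      using unit_right[OF o, of "Pr1 V (ehom E a b) (Unit V)"] by (simp add: ecomp_def prod_map_def b)
    show "ecmp E a b b \<cdot> prod_map V (eidt E b) (Idt V (ehom E a b)) = Pr2 V (Unit V) (ehom E a b)"
      using unit_left[OF o, of "Pr2 V (Unit V) (ehom E a b)"] by (simp add: ecomp_def prod_map_def b)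
  qed (use small hom idt cmp undef in simp_all)
qed

lemma enriched_functor_ecomp:
  assumes F: "enriched_functor \<U> V F"
    and o: "a \<in> eob (efdom F)" "b \<in> eob (efdom F)" "c \<in> eob (efdom F)"
    and g: "g \<in> Arr V" "Cod V g = ehom (efdom F) b c"
    and f: "f \<in> Arr V" "Dom V f = Dom V g" "Cod V f = ehom (efdom F) a b"
  shows "efhom F a c \<cdot> ecomp (efdom F) a b c g f =
    ecomp (efcod F) (efob F a) (efob F b) (efob F c) (efhom F b c \<cdot> g) (efhom F a b \<cdot> f)"
proof -
  interpret F: enriched_functor \<U> V F by (rule F)
  have [simp]: "efob F a \<in> eob (efcod F)" if "a \<in> eob (efdom F)" for a
    using F.efob_in that by blast
  have [simp]: "efhom F a b \<in> Arr V" "Dom V (efhom F a b) = ehom (efdom F) a b"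
    "Cod V (efhom F a b) = ehom (efcod F) (efob F a) (efob F b)"
    if "a \<in> eob (efdom F)" "b \<in> eob (efdom F)" for a b
    using F.efhom_in that by (auto simp: in_hom_iff)
  note [simp] = enriched_arr[OF F.efdom] enriched_arr[OF F.efcod] o g f
  have "efhom F a c \<cdot> ecomp (efdom F) a b c g f = (efhom F a c \<cdot> ecmp (efdom F) a b c) \<cdot> prod_pair V g f"
    by (simp add: ecomp_def)
  also have "\<dots> = ecomp (efcod F) (efob F a) (efob F b) (efob F c) (efhom F b c \<cdot> g) (efhom F a b \<cdot> f)"
    unfolding F.efhom_ecmp[OF o] by (simp add: ecomp_def prod_map_pair)
  finally show ?thesis .
qed

lemma enriched_functorI:
  assumes dom: "enriched_category \<U> V (efdom F)" and cod: "enriched_category \<U> V (efcod F)"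
    and ob: "efob F \<in> eob (efdom F) \<rightarrow>\<^sub>E eob (efcod F)"
    and hom: "\<And>a b. \<lbrakk>a \<in> eob (efdom F); b \<in> eob (efdom F)\<rbrakk>
          \<Longrightarrow> efhom F a b \<in> hom V (ehom (efdom F) a b) (ehom (efcod F) (efob F a) (efob F b))"
    and idt: "\<And>a. a \<in> eob (efdom F)
          \<Longrightarrow> efhom F a a \<cdot> eidt (efdom F) a = eidt (efcod F) (efob F a)"
    and cmp: "\<And>a b c g f. \<lbrakk>a \<in> eob (efdom F); b \<in> eob (efdom F); c \<in> eob (efdom F);
        g \<in> Arr V; Cod V g = ehom (efdom F) b c; f \<in> Arr V; Dom V f = Dom V g; Cod V f = ehom (efdom F) a b\<rbrakk>
      \<Longrightarrow> efhom F a c \<cdot> ecomp (efdom F) a b c g f =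
        ecomp (efcod F) (efob F a) (efob F b) (efob F c) (efhom F b c \<cdot> g) (efhom F a b \<cdot> f)"
    and undef: "\<And>a b. \<not> (a \<in> eob (efdom F) \<and> b \<in> eob (efdom F)) \<Longrightarrow> efhom F a b = undefined"
  shows "enriched_functor \<U> V F"
proof (intro enriched_functor.intro)
  have [simp]: "efhom F a b \<in> Arr V" "Dom V (efhom F a b) = ehom (efdom F) a b"
    "Cod V (efhom F a b) = ehom (efcod F) (efob F a) (efob F b)"
    if "a \<in> eob (efdom F)" "b \<in> eob (efdom F)" for a b
    using hom that by (auto simp: in_hom_iff)
  note [simp] = enriched_arr[OF dom] enriched_arr[OF cod]
  fix a b c assume o [simp]: "a \<in> eob (efdom F)" "b \<in> eob (efdom F)" "c \<in> eob (efdom F)"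
  let ?X = "ehom (efdom F) b c" and ?Y = "ehom (efdom F) a b"
  show "efhom F a c \<cdot> ecmp (efdom F) a b c = ecmp (efcod F) (efob F a) (efob F b) (efob F c)
      \<cdot> prod_map V (efhom F b c) (efhom F a b)"
    using cmp[OF o, of "Pr1 V ?X ?Y" "Pr2 V ?X ?Y"] by (simp add: ecomp_def prod_map_def)
qed (use assms in simp_all)

lemma enriched_functorD:
  assumes "enriched_functor \<U> V F"
  shows "enriched_category \<U> V (efdom F)" "enriched_category \<U> V (efcod F)"
    "efob F \<in> eob (efdom F) \<rightarrow>\<^sub>E eob (efcod F)"
    "a \<in> eob (efdom F) \<Longrightarrow> efob F a \<in> eob (efcod F)"
    "\<lbrakk>a \<in> eob (efdom F); b \<in> eob (efdom F)\<rbrakk> \<Longrightarrow> efhom F a b \<in> Arr V"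
    "\<lbrakk>a \<in> eob (efdom F); b \<in> eob (efdom F)\<rbrakk> \<Longrightarrow> Dom V (efhom F a b) = ehom (efdom F) a b"
    "\<lbrakk>a \<in> eob (efdom F); b \<in> eob (efdom F)\<rbrakk> \<Longrightarrow> Cod V (efhom F a b) = ehom (efcod F) (efob F a) (efob F b)"
    "\<not> (a \<in> eob (efdom F) \<and> b \<in> eob (efdom F)) \<Longrightarrow> efhom F a b = undefined"
  using assms by (auto simp: enriched_functor_def in_hom_iff)

text \<open>Off the object set the values of \<open>efob\<close> and \<open>efhom\<close> are fixed,
  by extensionality and by the \<open>undefined\<close> convention, so agreement on objects already
  gives equality of the records.\<close>

lemma enriched_functor_eqI:
  assumes F: "enriched_functor \<U> V F" and G: "enriched_functor \<U> V G"
    and dc: "efdom F = efdom G" "efcod F = efcod G"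
    and ob: "\<And>a. a \<in> eob (efdom G) \<Longrightarrow> efob F a = efob G a"
    and hom: "\<And>a b. \<lbrakk>a \<in> eob (efdom G); b \<in> eob (efdom G)\<rbrakk> \<Longrightarrow> efhom F a b = efhom G a b"
  shows "F = G"
proof -
  have "efob F = efob G"
    by (rule PiE_ext[OF enriched_functorD(3)[OF F]]) (use enriched_functorD(3)[OF G] dc ob in simp_all)
  moreover have "efhom F = efhom G"
  proof (intro ext)
    fix a b show "efhom F a b = efhom G a b"
      using hom enriched_functorD(8)[OF F, of a b] enriched_functorD(8)[OF G, of a b] dc by metis
  qed
  ultimately show ?thesis
    using dc by simp
qed

lemma category_Cat_enr: "category (Cat_enr \<U> V)"
proof
  fix E assume "E \<in> Obj (Cat_enr \<U> V)"
  then have E: "enriched_category \<U> V E"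
    by (simp add: Cat_enr_def)
  note [simp] = enriched_arr[OF E]
  have "enriched_functor \<U> V \<lparr>efdom = E, efcod = E, efob = (\<lambda>a \<in> eob E. a),
     efhom = (\<lambda>a b. if a \<in> eob E \<and> b \<in> eob E then Idt V (ehom E a b) else undefined)\<rparr>"
    by (rule enriched_functorI) (auto simp: E in_hom_iff ecomp_arr)
  then show "Idt (Cat_enr \<U> V) E \<in> hom (Cat_enr \<U> V) E E"
    by (simp add: Cat_enr_def in_hom_iff)
next
  fix F K L G M assume "F \<in> hom (Cat_enr \<U> V) K L" "G \<in> hom (Cat_enr \<U> V) L M"
  then have F: "enriched_functor \<U> V F" "efdom F = K" "efcod F = L"
    and G: "enriched_functor \<U> V G" "efdom G = L" "efcod G = M"
    by (auto simp: Cat_enr_def in_hom_iff)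
  note FD [simp] = enriched_functorD(1-7)[OF F(1), unfolded F(2,3)]
  note GD [simp] = enriched_functorD(1-7)[OF G(1), unfolded G(2,3)]
  note [simp] = enriched_arr[OF FD(1)] enriched_arr[OF FD(2)] enriched_arr[OF GD(2)] ecomp_arr
  let ?GF = "\<lparr>efdom = K, efcod = M, efob = compose (eob K) (efob G) (efob F),
    efhom = (\<lambda>a b. if a \<in> eob K \<and> b \<in> eob K then efhom G (efob F a) (efob F b) \<cdot> efhom F a b else undefined)\<rparr>"
  have "enriched_functor \<U> V ?GF"
  proof (rule enriched_functorI)
    show "efob ?GF \<in> eob (efdom ?GF) \<rightarrow>\<^sub>E eob (efcod ?GF)"
      by (auto simp: compose_def)
    fix a assume "a \<in> eob (efdom ?GF)"
    then have a [simp]: "a \<in> eob K"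
      by simp
    have "efhom F a a \<cdot> eidt K a = eidt L (efob F a)"
      "efhom G (efob F a) (efob F a) \<cdot> eidt L (efob F a) = eidt M (efob G (efob F a))"
      using enriched_functor.efhom_eidt[OF F(1), of a] enriched_functor.efhom_eidt[OF G(1), of "efob F a"] F G
      by simp_all
    then show "efhom ?GF a a \<cdot> eidt (efdom ?GF) a = eidt (efcod ?GF) (efob ?GF a)"
      by (simp add: compose_def)
  next
    fix a b c g f assume "a \<in> eob (efdom ?GF)" "b \<in> eob (efdom ?GF)" "c \<in> eob (efdom ?GF)"
      "g \<in> Arr V" "Cod V g = ehom (efdom ?GF) b c" "f \<in> Arr V" "Dom V f = Dom V g"
      "Cod V f = ehom (efdom ?GF) a b"
    then have [simp]: "a \<in> eob K" "b \<in> eob K" "c \<in> eob K" "g \<in> Arr V" "Cod V g = ehom K b c"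
      "f \<in> Arr V" "Dom V f = Dom V g" "Cod V f = ehom K a b"
      by simp_all
    have "efhom F a c \<cdot> ecomp K a b c g f =
        ecomp L (efob F a) (efob F b) (efob F c) (efhom F b c \<cdot> g) (efhom F a b \<cdot> f)"
      using enriched_functor_ecomp[OF F(1), of a b c g f] F by simp
    moreover have "efhom G (efob F a) (efob F c) \<cdot>
        ecomp L (efob F a) (efob F b) (efob F c) (efhom F b c \<cdot> g) (efhom F a b \<cdot> f) =
      ecomp M (efob G (efob F a)) (efob G (efob F b)) (efob G (efob F c))
       (efhom G (efob F b) (efob F c) \<cdot> (efhom F b c \<cdot> g)) (efhom G (efob F a) (efob F b) \<cdot> (efhom F a b \<cdot> f))"
      using enriched_functor_ecomp[OF G(1), of "efob F a" "efob F b" "efob F c" "efhom F b c \<cdot> g" "efhom F a b \<cdot> f"] G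
      by simp
    ultimately show "efhom ?GF a c \<cdot> ecomp (efdom ?GF) a b c g f =
        ecomp (efcod ?GF) (efob ?GF a) (efob ?GF b) (efob ?GF c) (efhom ?GF b c \<cdot> g) (efhom ?GF a b \<cdot> f)"
      by (simp add: compose_def)
  qed (auto simp: in_hom_iff compose_def)
  then show "Cmp (Cat_enr \<U> V) G F \<in> hom (Cat_enr \<U> V) K M"
    using F G by (simp add: Cat_enr_def in_hom_iff)
next
  fix F K L assume "F \<in> hom (Cat_enr \<U> V) K L"
  then have F: "enriched_functor \<U> V F" "efdom F = K" "efcod F = L"
    by (auto simp: Cat_enr_def in_hom_iff)
  note FD [simp] = enriched_functorD(1-7)[OF F(1), unfolded F(2,3)]
  have "compose (eob K) (efob F) (\<lambda>a \<in> eob K. a) = efob F" "compose (eob K) (\<lambda>a \<in> eob L. a) (efob F) = efob F"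
    using PiE_arb[OF FD(3)] by (auto simp: compose_def fun_eq_iff)
  moreover have "(\<lambda>a b. if a \<in> eob K \<and> b \<in> eob K then efhom F a b \<cdot> Idt V (ehom K a b) else undefined) = efhom F"
    "(\<lambda>a b. if a \<in> eob K \<and> b \<in> eob K then Idt V (ehom L (efob F a) (efob F b)) \<cdot> efhom F a b else undefined) = efhom F"
    using enriched_functorD(8)[OF F(1)] F(2) by (auto simp: fun_eq_iff)
  ultimately show "Cmp (Cat_enr \<U> V) F (Idt (Cat_enr \<U> V) K) = F" "Cmp (Cat_enr \<U> V) (Idt (Cat_enr \<U> V) L) F = F"
    using F by (auto simp: Cat_enr_def intro!: efun.equality cong: conj_cong if_cong)
next
  fix F K L G M H N
  assume "F \<in> hom (Cat_enr \<U> V) K L" "G \<in> hom (Cat_enr \<U> V) L M" "H \<in> hom (Cat_enr \<U> V) M N"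
  then have F: "enriched_functor \<U> V F" "efdom F = K" "efcod F = L"
    and G: "enriched_functor \<U> V G" "efdom G = L" "efcod G = M"
    and H: "enriched_functor \<U> V H" "efdom H = M" "efcod H = N"
    by (auto simp: Cat_enr_def in_hom_iff)
  note FD [simp] = enriched_functorD(1-7)[OF F(1), unfolded F(2,3)]
  note GD [simp] = enriched_functorD(1-7)[OF G(1), unfolded G(2,3)]
  note HD [simp] = enriched_functorD(1-7)[OF H(1), unfolded H(2,3)]
  show "Cmp (Cat_enr \<U> V) (Cmp (Cat_enr \<U> V) H G) F = Cmp (Cat_enr \<U> V) H (Cmp (Cat_enr \<U> V) G F)"
    using F G H by (auto simp: Cat_enr_def compose_def fun_eq_iff)
qed (auto simp: Cat_enr_def enriched_functor_def)

section \<open>The copower functor\<close>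

lemma discrete_copower:
  assumes "A \<in> \<U>"
  shows "discrete A (copower V A) (copower_inj V A)"
proof -
  have "\<exists>x. case x of (s, \<iota>) \<Rightarrow> is_coproduct V A (\<lambda>_. Unit V) s \<iota>"
    using lextensive assms by (auto simp: infinitary_lextensive_def has_small_coproducts_def)
  from someI_ex[OF this] show ?thesis
    using assms by (auto simp: discrete_def copower_def copower_inj_def copower_cocone_def split: prod.splits)
qed

lemma copower_arr [simp]:
  assumes "A \<in> \<U>"
  shows "copower V A \<in> Obj V"
    "a \<in> A \<Longrightarrow> copower_inj V A a \<in> Arr V" "a \<in> A \<Longrightarrow> Dom V (copower_inj V A a) = Unit V"
    "a \<in> A \<Longrightarrow> Cod V (copower_inj V A a) = copower V A"
  using discrete_copower[OF assms] discrete_arr by (auto simp: discrete_def is_coproduct_def)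

lemma discrete_map_unique:
  assumes D: "discrete A D e" and f: "f \<in> hom V D y" and g: "g \<in> hom V D y"
    and eq: "\<And>a. a \<in> A \<Longrightarrow> f \<cdot> e a = g \<cdot> e a"
  shows "f = g"
proof -
  have "is_coproduct V A (\<lambda>_. Unit V) D e"
    using D by (simp add: discrete_def)
  from coproduct_ext[OF this f g] eq show ?thesis
    by blast
qed

text \<open>Justifies the definite description in \<open>J_fctr\<close>: existence is copairing,
  uniqueness is joint epimorphy of the points.\<close>

lemma J_map:
  assumes "A \<in> \<U>" "B \<in> \<U>" "f \<in> A \<rightarrow> B"
  shows "FA (J_fctr V) (A, B, f) \<in> hom V (copower V A) (copower V B)"
    "a \<in> A \<Longrightarrow> FA (J_fctr V) (A, B, f) \<cdot> copower_inj V A a = copower_inj V B (f a)"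
proof -
  let ?P = "\<lambda>h. h \<in> hom V (copower V A) (copower V B) \<and>
      (\<forall>a \<in> A. h \<cdot> copower_inj V A a = copower_inj V B (f a))"
  have "\<exists>h. ?P h"
  proof -
    have "\<exists>h \<in> hom V (copower V A) (copower V B). \<forall>a \<in> A. h \<cdot> copower_inj V A a = copower_inj V B (f a)"
    proof (rule coproduct_copair)
      show "is_coproduct V A (\<lambda>_. Unit V) (copower V A) (copower_inj V A)"
        using discrete_copower[OF assms(1)] by (simp add: discrete_def)
    qed (use assms in \<open>auto simp: in_hom_iff Pi_iff\<close>)
    then show ?thesis
      by blast
  qed
  moreover have "h = h'" if "?P h" "?P h'" for h h'
    by (rule discrete_map_unique[OF discrete_copower[OF assms(1)], of h _ h']) (use that in auto)
  ultimately have "\<exists>!h. ?P h"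
    by blast
  from theI'[OF this] show "FA (J_fctr V) (A, B, f) \<in> hom V (copower V A) (copower V B)"
    "a \<in> A \<Longrightarrow> FA (J_fctr V) (A, B, f) \<cdot> copower_inj V A a = copower_inj V B (f a)"
    by (auto simp: J_fctr_def)
qed

lemma is_functor_J_fctr: "is_functor (Set_cat \<U>) V (J_fctr V)"
proof
  fix A assume "A \<in> Obj (Set_cat \<U>)"
  then have A: "A \<in> \<U>"
    by (simp add: Set_cat_def)
  then show "FO (J_fctr V) A \<in> Obj V"
    by (simp add: J_fctr_def)
  have "FA (J_fctr V) (A, A, \<lambda>a \<in> A. a) = Idt V (copower V A)"
    by (rule discrete_map_unique[OF discrete_copower[OF A]])
      (use A J_map[of A A "\<lambda>a \<in> A. a"] in \<open>auto simp: in_hom_iff\<close>)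
  then show "FA (J_fctr V) (Idt (Set_cat \<U>) A) = Idt V (FO (J_fctr V) A)"
    by (simp add: Set_cat_def) (simp add: J_fctr_def)
next
  fix f A B assume "f \<in> hom (Set_cat \<U>) A B"
  then obtain \<phi> where f: "f = (A, B, \<phi>)" "A \<in> \<U>" "B \<in> \<U>" "\<phi> \<in> A \<rightarrow>\<^sub>E B"
    by (auto simp: Set_cat_def in_hom_iff)
  have "FA (J_fctr V) f \<in> hom V (copower V A) (copower V B)"
    using f J_map(1)[of A B \<phi>] by auto
  then show "FA (J_fctr V) f \<in> hom V (FO (J_fctr V) A) (FO (J_fctr V) B)"
    by (simp add: J_fctr_def)
next
  fix f A B g D assume "f \<in> hom (Set_cat \<U>) A B" "g \<in> hom (Set_cat \<U>) B D"
  then obtain \<phi> \<psi> where f: "f = (A, B, \<phi>)" "\<phi> \<in> A \<rightarrow>\<^sub>E B" and g: "g = (B, D, \<psi>)" "\<psi> \<in> B \<rightarrow>\<^sub>E D"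
    and U: "A \<in> \<U>" "B \<in> \<U>" "D \<in> \<U>"
    by (auto simp: Set_cat_def in_hom_iff)
  have c: "compose A \<psi> \<phi> \<in> A \<rightarrow> D"
    using f g by (auto simp: compose_def)
  have [simp]: "\<phi> a \<in> B" if "a \<in> A" for a
    using f(2) that by blast
  note J = J_map[of A B \<phi>] J_map[of B D \<psi>] J_map[of A D "compose A \<psi> \<phi>"]
  have "FA (J_fctr V) (A, D, compose A \<psi> \<phi>) = FA (J_fctr V) (B, D, \<psi>) \<cdot> FA (J_fctr V) (A, B, \<phi>)"
    by (rule discrete_map_unique[OF discrete_copower[OF U(1)]])
      (use J U f g c in \<open>auto simp: in_hom_iff PiE_iff compose_def\<close>)
  then show "FA (J_fctr V) (Cmp (Set_cat \<U>) g f) = FA (J_fctr V) g \<cdot> FA (J_fctr V) f"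
    using f g by (simp add: Set_cat_def)
qed

end

section \<open>Typed elements and representations\<close>

text \<open>In the next two lemmas the base arrow \<open>n\<close> is there for the induction, which passes from \<open>n\<close> to \<open>n \<cdot> k\<close>
  for the pieces \<open>k\<close> on which the first map of the list is constant.\<close>

lemma (in lextensive_cartesian) discrete_ext_list:
  assumes D: "discrete A D e"
    and "n \<in> Arr V" "\<And>x. x \<in> set xs \<Longrightarrow> x \<in> hom V (Cod V n) D"
    and "f \<in> hom V (Dom V n) Y" "g \<in> hom V (Dom V n) Y"
    and "\<And>k. \<lbrakk>k \<in> Arr V; Cod V k = Dom V n; \<And>x. x \<in> set xs \<Longrightarrow> \<exists>a \<in> A. x \<cdot> (n \<cdot> k) = e a \<cdot> bang (Dom V k)\<rbrakk>
      \<Longrightarrow> f \<cdot> k = g \<cdot> k"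
  shows "f = g"
  using assms(2-)
proof (induction xs arbitrary: n f g)
  case Nil
  then show ?case
    using Nil(5)[of "Idt V (Dom V n)"] by (simp add: in_hom_iff)
next
  case (Cons x xs)
  have x: "x \<in> Arr V" "Dom V x = Cod V n" "Cod V x = D"
    using Cons.prems(2)[of x] by (auto simp: in_hom_iff)
  have fg: "f \<in> Arr V" "g \<in> Arr V" "Dom V f = Dom V n" "Dom V g = Dom V n" "Cod V f = Y" "Cod V g = Y"
    using Cons.prems(3,4) by (auto simp: in_hom_iff)
  show ?case
  proof (rule discrete_ext[OF D _ Cons.prems(3,4)])
    show "x \<cdot> n \<in> hom V (Dom V n) D"
      using x Cons.prems(1) by (simp add: in_hom_iff)
    fix a k assume a: "a \<in> A" and k: "k \<in> Arr V" "Cod V k = Dom V n" and xk: "x \<cdot> n \<cdot> k = e a \<cdot> bang (Dom V k)"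
    show "f \<cdot> k = g \<cdot> k"
    proof (rule Cons.IH[of "n \<cdot> k"])
      fix y assume "y \<in> set xs"
      then show "y \<in> hom V (Cod V (n \<cdot> k)) D"
        using Cons.prems(1,2) k by simp
    next
      fix l assume l: "l \<in> Arr V" "Cod V l = Dom V (n \<cdot> k)"
        and typed: "\<And>y. y \<in> set xs \<Longrightarrow> \<exists>a \<in> A. y \<cdot> (n \<cdot> k \<cdot> l) = e a \<cdot> bang (Dom V l)"
      have l': "Cod V l = Dom V k"
        using l k Cons.prems(1) by simp
      have "x \<cdot> (n \<cdot> (k \<cdot> l)) = (x \<cdot> n \<cdot> k) \<cdot> l"
        using x k l l' Cons.prems(1) by simp
      also have "\<dots> = e a \<cdot> bang (Dom V l)"
        unfolding xk using discrete_arr[OF D a] k l(1) l' by simp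
      finally have "f \<cdot> (k \<cdot> l) = g \<cdot> (k \<cdot> l)"
        using a typed k l l' Cons.prems(1) by (intro Cons.prems(5)) (auto simp: set_ConsD)
      then show "f \<cdot> k \<cdot> l = g \<cdot> k \<cdot> l"
        using k l l' fg by simp
    qed (use Cons.prems(1) k fg in \<open>simp_all add: in_hom_iff\<close>)
  qed
qed

lemma (in lextensive_cartesian) discrete_glue_list:
  assumes D: "discrete A D e" and Y: "Y \<in> Obj V"
    and "n \<in> Arr V" "\<And>x. x \<in> set xs \<Longrightarrow> x \<in> hom V (Cod V n) D"
    and "\<And>as k. \<lbrakk>k \<in> Arr V; Cod V k = Dom V n;
        list_all2 (\<lambda>x a. a \<in> A \<and> x \<cdot> (n \<cdot> k) = e a \<cdot> bang (Dom V k)) xs as\<rbrakk> \<Longrightarrow> \<phi> as k \<in> hom V (Dom V k) Y"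
    and "\<And>as k l. \<lbrakk>k \<in> Arr V; Cod V k = Dom V n;
        list_all2 (\<lambda>x a. a \<in> A \<and> x \<cdot> (n \<cdot> k) = e a \<cdot> bang (Dom V k)) xs as; l \<in> Arr V; Cod V l = Dom V k\<rbrakk>
        \<Longrightarrow> \<phi> as (k \<cdot> l) = \<phi> as k \<cdot> l"
  shows "\<exists>f \<in> hom V (Dom V n) Y. \<forall>as. \<forall>k \<in> Arr V. Cod V k = Dom V n \<and>
        list_all2 (\<lambda>x a. a \<in> A \<and> x \<cdot> (n \<cdot> k) = e a \<cdot> bang (Dom V k)) xs as \<longrightarrow> f \<cdot> k = \<phi> as k"
  using assms(3-)
proof (induction xs arbitrary: n \<phi>)
  case Nil
  have "\<phi> [] k = \<phi> [] (Idt V (Dom V n)) \<cdot> k" if "k \<in> Arr V" "Cod V k = Dom V n" for k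
    using Nil(4)[of "Idt V (Dom V n)" "[]" k] Nil(1) that by simp
  moreover have "\<phi> [] (Idt V (Dom V n)) \<in> hom V (Dom V n) Y"
    using Nil(1) Nil(3)[of "Idt V (Dom V n)" "[]"] by simp
  ultimately show ?case
    by (intro bexI[of _ "\<phi> [] (Idt V (Dom V n))"]) simp_all
next
  case (Cons x xs)
  let ?T = "\<lambda>n xs as k. list_all2 (\<lambda>x a. a \<in> A \<and> x \<cdot> (n \<cdot> k) = e a \<cdot> bang (Dom V k)) xs as"
  have x: "x \<in> Arr V" "Dom V x = Cod V n" "Cod V x = D"
    using Cons.prems(2)[of x] by (auto simp: in_hom_iff)
  note n = Cons.prems(1)
  \<comment> \<open>A solution of the gluing problem for the remaining maps \<open>xs\<close>, on
    the piece \<open>k\<close> where \<open>x\<close> is constant at \<open>a\<close>: the base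
    becomes \<open>n \<cdot> k\<close>, and \<open>a\<close> is prepended to the list of
    values.\<close>
  let ?glued = "\<lambda>a k f. f \<in> hom V (Dom V k) Y \<and>
    (\<forall>as. \<forall>l \<in> Arr V. Cod V l = Dom V k \<and> ?T (n \<cdot> k) xs as l \<longrightarrow> f \<cdot> l = \<phi> (a # as) (k \<cdot> l))"
  have typed: "?T n (x # xs) (a # as) (k \<cdot> l)"
    if "a \<in> A" "k \<in> Arr V" "Cod V k = Dom V n" "x \<cdot> n \<cdot> k = e a \<cdot> bang (Dom V k)"
      "l \<in> Arr V" "Cod V l = Dom V k" "?T (n \<cdot> k) xs as l" for a k l as
  proof -
    have "x \<cdot> (n \<cdot> (k \<cdot> l)) = (x \<cdot> n \<cdot> k) \<cdot> l"
      using x that(2,3,5,6) n by simp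
    also have "\<dots> = e a \<cdot> bang (Dom V l)"
      unfolding that(4) using discrete_arr[OF D that(1)] that by simp
    finally show ?thesis
      using that n by simp
  qed
  have ex: "\<exists>f. ?glued a k f"
    if a: "a \<in> A" and k: "k \<in> Arr V" "Cod V k = Dom V n" "x \<cdot> n \<cdot> k = e a \<cdot> bang (Dom V k)" for a k
  proof -
    have "\<exists>f \<in> hom V (Dom V (n \<cdot> k)) Y. \<forall>as. \<forall>l \<in> Arr V. Cod V l = Dom V (n \<cdot> k) \<and> ?T (n \<cdot> k) xs as l \<longrightarrow>
        f \<cdot> l = \<phi> (a # as) (k \<cdot> l)"
    proof (rule Cons.IH)
      show "n \<cdot> k \<in> Arr V"
        using n k by simp
      show "y \<in> hom V (Cod V (n \<cdot> k)) D" if "y \<in> set xs" for y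
        using that n k Cons.prems(2) by simp
      fix as l assume l: "l \<in> Arr V" "Cod V l = Dom V (n \<cdot> k)" "?T (n \<cdot> k) xs as l"
      have l': "Cod V l = Dom V k"
        using l(2) n k by simp
      show "\<phi> (a # as) (k \<cdot> l) \<in> hom V (Dom V l) Y"
        using Cons.prems(3)[OF _ _ typed[OF a k l(1) l' l(3)]] k l(1) l' by simp
      fix m assume m: "m \<in> Arr V" "Cod V m = Dom V l"
      show "\<phi> (a # as) (k \<cdot> (l \<cdot> m)) = \<phi> (a # as) (k \<cdot> l) \<cdot> m"
        using Cons.prems(4)[OF _ _ typed[OF a k l(1) l' l(3)], of m] k l(1) l' m by simp
    qed
    then show ?thesis
      using n k by auto
  qed
  \<comment> \<open>Solutions come from existence statements and are picked by choice below; it is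
    their uniqueness that makes the chosen family natural in \<open>k\<close>.\<close>
  have uniq: "f = g"
    if f: "?glued a k f" and g: "?glued a k g" and k: "k \<in> Arr V" "Cod V k = Dom V n" for a k f g
  proof (rule discrete_ext_list[OF D, of "n \<cdot> k" xs f Y g])
    fix l assume l: "l \<in> Arr V" "Cod V l = Dom V (n \<cdot> k)"
      and "\<And>y. y \<in> set xs \<Longrightarrow> \<exists>a \<in> A. y \<cdot> (n \<cdot> k \<cdot> l) = e a \<cdot> bang (Dom V l)"
    then have "\<exists>as. ?T (n \<cdot> k) xs as l"
      by (induction xs) (auto simp: list_all2_Cons1)
    then show "f \<cdot> l = g \<cdot> l"
      using f g l n k by auto
  qed (use f g k n Cons.prems(2) in auto)
  let ?\<psi> = "\<lambda>a k. SOME f. ?glued a k f"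
  have \<psi>: "?glued a k (?\<psi> a k)"
    if "a \<in> A" "k \<in> Arr V" "Cod V k = Dom V n" "x \<cdot> n \<cdot> k = e a \<cdot> bang (Dom V k)" for a k
    using someI_ex[OF ex[OF that]] .
  have "\<exists>f \<in> hom V (Dom V n) Y. \<forall>a \<in> A. \<forall>k \<in> Arr V.
      Cod V k = Dom V n \<and> x \<cdot> n \<cdot> k = e a \<cdot> bang (Dom V k) \<longrightarrow> f \<cdot> k = ?\<psi> a k"
  proof (rule discrete_glue[OF D _ Y])
    show "x \<cdot> n \<in> hom V (Dom V n) D"
      using x n by (simp add: in_hom_iff)
  next
    fix a k assume a: "a \<in> A" and k: "k \<in> Arr V" "Cod V k = Dom V n" "x \<cdot> n \<cdot> k = e a \<cdot> bang (Dom V k)"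
    show "?\<psi> a k \<in> hom V (Dom V k) Y"
      using \<psi>[OF a k] by blast
    fix l assume l: "l \<in> Arr V" "Cod V l = Dom V k"
    have "x \<cdot> n \<cdot> (k \<cdot> l) = (x \<cdot> n \<cdot> k) \<cdot> l"
      using x k(1,2) l n by simp
    also have "\<dots> = e a \<cdot> bang (Dom V l)"
      unfolding k(3) using discrete_arr[OF D a] k l by simp
    finally have "x \<cdot> n \<cdot> (k \<cdot> l) = e a \<cdot> bang (Dom V (k \<cdot> l))"
      using k l by simp
    then have 1: "?glued a (k \<cdot> l) (?\<psi> a (k \<cdot> l))"
      using a k l n by (intro \<psi>) simp_all
    have hk: "?\<psi> a k \<in> hom V (Dom V k) Y" "\<And>as l. \<lbrakk>l \<in> Arr V; Cod V l = Dom V k; ?T (n \<cdot> k) xs as l\<rbrakk>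
        \<Longrightarrow> ?\<psi> a k \<cdot> l = \<phi> (a # as) (k \<cdot> l)"
      using \<psi>[OF a k] by blast+
    \<comment> \<open>Restricting the solution on \<open>k\<close> along \<open>l\<close> solves the
      problem on \<open>k \<cdot> l\<close>, where another solution has been chosen.\<close>
    have 2: "?glued a (k \<cdot> l) (?\<psi> a k \<cdot> l)"
    proof (intro conjI allI ballI impI)
      show "?\<psi> a k \<cdot> l \<in> hom V (Dom V (k \<cdot> l)) Y"
        using hk(1) k l by (simp add: in_hom_iff)
      fix as m assume m: "m \<in> Arr V" and "Cod V m = Dom V (k \<cdot> l) \<and> ?T (n \<cdot> (k \<cdot> l)) xs as m"
      then have Tm: "?T (n \<cdot> (k \<cdot> l)) xs as m" and m': "Cod V m = Dom V l"
        using k l by simp_all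
      have "?T (n \<cdot> k) xs as (l \<cdot> m)"
        using Tm k(1,2) l m m' n by simp
      note m' = m' this
      show "?\<psi> a k \<cdot> l \<cdot> m = \<phi> (a # as) (k \<cdot> l \<cdot> m)"
        using hk(2)[of "l \<cdot> m" as] hk(1) m m' k l by (simp add: in_hom_iff)
    qed
    show "?\<psi> a (k \<cdot> l) = ?\<psi> a k \<cdot> l"
      by (rule uniq[OF 1 2]) (use k l in simp_all)
  qed
  then obtain f where f: "f \<in> hom V (Dom V n) Y"
    "\<And>a k. \<lbrakk>a \<in> A; k \<in> Arr V; Cod V k = Dom V n; x \<cdot> n \<cdot> k = e a \<cdot> bang (Dom V k)\<rbrakk> \<Longrightarrow> f \<cdot> k = ?\<psi> a k"
    by auto
  have "f \<cdot> k = \<phi> bs k" if k: "k \<in> Arr V" "Cod V k = Dom V n" "?T n (x # xs) bs k" for bs k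
  proof -
    obtain a as where bs: "bs = a # as" "a \<in> A" "x \<cdot> (n \<cdot> k) = e a \<cdot> bang (Dom V k)" "?T n xs as k"
      using k(3) by (auto simp: list_all2_Cons1)
    have xk: "x \<cdot> n \<cdot> k = e a \<cdot> bang (Dom V k)"
      using bs(3) x n k by simp
    \<comment> \<open>On \<open>k\<close> every map of the list is already constant, so the identity
      is an admissible piece of the remaining problem, and evaluation there returns the chosen
      solution itself.\<close>
    have "?T (n \<cdot> k) xs as (Idt V (Dom V k))"
      using bs(4) k n by simp
    moreover have "\<And>as l. \<lbrakk>l \<in> Arr V; Cod V l = Dom V k; ?T (n \<cdot> k) xs as l\<rbrakk> \<Longrightarrow> ?\<psi> a k \<cdot> l = \<phi> (a # as) (k \<cdot> l)"
      and h: "?\<psi> a k \<in> hom V (Dom V k) Y"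
      using \<psi>[OF bs(2) k(1,2) xk] by blast+
    ultimately have "?\<psi> a k \<cdot> Idt V (Dom V k) = \<phi> (a # as) (k \<cdot> Idt V (Dom V k))"
      using k by simp
    then show ?thesis
      using f(2)[OF bs(2) k(1,2) xk] bs(1) k h by (simp add: in_hom_iff)
  qed
  then show ?case
    using f(1) by blast
qed

text \<open>\<open>D\<close>, \<open>M\<close>, \<open>s\<close>, \<open>t\<close> play the roles of \<open>C\<^sub>0\<close>, \<open>C\<^sub>1\<close>, source and target, and \<open>H\<close> that of the enriched
  hom objects, before any identities or composition are given.\<close>

locale frame = lextensive_cartesian \<U> V
  for \<U> :: "'i set set" and V :: "('o, 'a, 'm) ccat_scheme" (structure) +
  fixes A :: "'i set" and D M :: 'o and s t :: 'a and e :: "'i \<Rightarrow> 'a"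
    and H :: "'i \<Rightarrow> 'i \<Rightarrow> 'o" and j :: "'i \<Rightarrow> 'i \<Rightarrow> 'a"
  assumes disc: "discrete A D e"
    and s_in: "s \<in> hom V M D" and t_in: "t \<in> hom V M D"
    and H_in: "\<lbrakk>a \<in> A; b \<in> A\<rbrakk> \<Longrightarrow> H a b \<in> Obj V"
    and j_in: "\<lbrakk>a \<in> A; b \<in> A\<rbrakk> \<Longrightarrow> j a b \<in> hom V (H a b) M"
    and s_j: "\<lbrakk>a \<in> A; b \<in> A\<rbrakk> \<Longrightarrow> s \<cdot> j a b = e a \<cdot> bang (H a b)"
    and t_j: "\<lbrakk>a \<in> A; b \<in> A\<rbrakk> \<Longrightarrow> t \<cdot> j a b = e b \<cdot> bang (H a b)"
    and j_universal: "\<lbrakk>a \<in> A; b \<in> A; x \<in> hom V W M; s \<cdot> x = e a \<cdot> bang W; t \<cdot> x = e b \<cdot> bang W\<rbrakk>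
      \<Longrightarrow> \<exists>!h. h \<in> hom V W (H a b) \<and> j a b \<cdot> h = x"
begin

lemma arr [simp]:
  "s \<in> Arr V" "Dom V s = M" "Cod V s = D" "t \<in> Arr V" "Dom V t = M" "Cod V t = D" "D \<in> Obj V" "M \<in> Obj V"
  "a \<in> A \<Longrightarrow> e a \<in> Arr V" "a \<in> A \<Longrightarrow> Dom V (e a) = Unit V" "a \<in> A \<Longrightarrow> Cod V (e a) = D"
  "a \<in> A \<Longrightarrow> b \<in> A \<Longrightarrow> H a b \<in> Obj V"
  "a \<in> A \<Longrightarrow> b \<in> A \<Longrightarrow> j a b \<in> Arr V" "a \<in> A \<Longrightarrow> b \<in> A \<Longrightarrow> Dom V (j a b) = H a b"
  "a \<in> A \<Longrightarrow> b \<in> A \<Longrightarrow> Cod V (j a b) = M"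
  using s_in t_in H_in j_in discrete_arr[OF disc] by (auto simp: in_hom_iff)

definition el :: "'i \<Rightarrow> 'i \<Rightarrow> 'a \<Rightarrow> bool" where
  "el a b x \<longleftrightarrow> a \<in> A \<and> b \<in> A \<and> x \<in> Arr V \<and> Cod V x = M \<and>
     s \<cdot> x = e a \<cdot> bang (Dom V x) \<and> t \<cdot> x = e b \<cdot> bang (Dom V x)"

definition fac :: "'i \<Rightarrow> 'i \<Rightarrow> 'a \<Rightarrow> 'a" where
  "fac a b x = (THE h. h \<in> hom V (Dom V x) (H a b) \<and> j a b \<cdot> h = x)"

lemma fac [simp]:
  assumes "el a b x"
  shows "fac a b x \<in> Arr V" "Dom V (fac a b x) = Dom V x" "Cod V (fac a b x) = H a b" "j a b \<cdot> fac a b x = x"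
proof -
  have "\<exists>!h. h \<in> hom V (Dom V x) (H a b) \<and> j a b \<cdot> h = x"
    using assms by (intro j_universal) (auto simp: el_def in_hom_iff)
  from theI'[OF this] show "fac a b x \<in> Arr V" "Dom V (fac a b x) = Dom V x" "Cod V (fac a b x) = H a b"
    "j a b \<cdot> fac a b x = x"
    by (auto simp: fac_def in_hom_iff)
qed

lemma j_ends [simp]:
  assumes "a \<in> A" "b \<in> A" "h \<in> Arr V" "Cod V h = H a b"
  shows "s \<cdot> (j a b \<cdot> h) = e a \<cdot> bang (Dom V h)" "t \<cdot> (j a b \<cdot> h) = e b \<cdot> bang (Dom V h)"
  using assms by (simp_all add: Cmp_reassoc[OF s_j] Cmp_reassoc[OF t_j])

lemma el_j: "\<lbrakk>a \<in> A; b \<in> A; h \<in> Arr V; Cod V h = H a b\<rbrakk> \<Longrightarrow> el a b (j a b \<cdot> h)"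
  by (simp add: el_def)

lemma j_mono:
  assumes ab: "a \<in> A" "b \<in> A" and h: "h \<in> Arr V" "Cod V h = H a b"
    and k: "k \<in> Arr V" "Cod V k = H a b" and "Dom V h = Dom V k" "j a b \<cdot> h = j a b \<cdot> k"
  shows "h = k"
proof -
  have "\<exists>!l. l \<in> hom V (Dom V h) (H a b) \<and> j a b \<cdot> l = j a b \<cdot> h"
    by (rule j_universal) (use ab h in \<open>simp_all add: in_hom_iff\<close>)
  then show ?thesis
    using assms unfolding in_hom_iff by metis
qed

lemma fac_j [simp]:
  assumes "a \<in> A" "b \<in> A" "h \<in> Arr V" "Cod V h = H a b"
  shows "fac a b (j a b \<cdot> h) = h"
  by (rule j_mono[OF assms(1,2)]) (use assms fac[OF el_j[OF assms]] in simp_all)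

lemma fac_comp:
  assumes "el a b x" "k \<in> Arr V" "Cod V k = Dom V x"
  shows "fac a b (x \<cdot> k) = fac a b x \<cdot> k"
proof -
  have "x \<cdot> k = j a b \<cdot> (fac a b x \<cdot> k)"
    using assms fac[OF assms(1)] by (simp add: el_def flip: Cmp_assoc')
  moreover have "fac a b (j a b \<cdot> (fac a b x \<cdot> k)) = fac a b x \<cdot> k"
    using assms by (intro fac_j) (auto simp: el_def)
  ultimately show ?thesis
    by simp
qed

text \<open>An element is typed exactly when its source and its target are constant, so the domain
  is split along the sources and targets of all the \<open>zs\<close> at once.\<close>

lemma ext_elements:
  assumes zs: "\<And>z. z \<in> set zs \<Longrightarrow> z \<in> hom V W M" and f: "f \<in> hom V W Y" and g: "g \<in> hom V W Y"
    and eq: "\<And>k. \<lbrakk>k \<in> Arr V; Cod V k = W; \<And>z. z \<in> set zs \<Longrightarrow> \<exists>a b. el a b (z \<cdot> k)\<rbrakk> \<Longrightarrow> f \<cdot> k = g \<cdot> k"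
  shows "f = g"
proof -
  have W: "W \<in> Obj V"
    using f by (auto simp: in_hom_iff)
  show ?thesis
  proof (rule discrete_ext_list[OF disc, of "Idt V W" "map (\<lambda>z. s \<cdot> z) zs @ map (\<lambda>z. t \<cdot> z) zs" f Y g])
    fix k assume k: "k \<in> Arr V" "Cod V k = Dom V (Idt V W)"
      and typed: "\<And>x. x \<in> set (map (\<lambda>z. s \<cdot> z) zs @ map (\<lambda>z. t \<cdot> z) zs) \<Longrightarrow>
        \<exists>a \<in> A. x \<cdot> (Idt V W \<cdot> k) = e a \<cdot> bang (Dom V k)"
    have k' [simp]: "Cod V k = W"
      using k W by simp
    show "f \<cdot> k = g \<cdot> k"
    proof (rule eq[OF k(1) k'])
      fix z assume z: "z \<in> set zs"
      then have [simp]: "z \<in> Arr V" "Dom V z = W" "Cod V z = M"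
        using zs by (auto simp: in_hom_iff)
      obtain a b where "a \<in> A" "s \<cdot> z \<cdot> k = e a \<cdot> bang (Dom V k)" "b \<in> A" "t \<cdot> z \<cdot> k = e b \<cdot> bang (Dom V k)"
        using typed[of "s \<cdot> z"] typed[of "t \<cdot> z"] z k by auto
      then show "\<exists>a b. el a b (z \<cdot> k)"
        using k by (auto simp: el_def)
    qed
  qed (use W zs f g in \<open>auto simp: in_hom_iff\<close>)
qed

text \<open>\<open>M\<close> is not assumed to be a coproduct. The universality of the
  \<open>j a b\<close> alone makes them jointly epic: tested on typed elements, every
  \<open>k\<close> factors through some \<open>j a b\<close>.\<close>

lemma ext_j:
  assumes "f \<in> hom V M Y" "g \<in> hom V M Y" "\<And>a b. \<lbrakk>a \<in> A; b \<in> A\<rbrakk> \<Longrightarrow> f \<cdot> j a b = g \<cdot> j a b"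
  shows "f = g"
proof (rule ext_elements[of "[Idt V M]" M f Y g])
  fix k assume k: "k \<in> Arr V" "Cod V k = M" "\<And>z. z \<in> set [Idt V M] \<Longrightarrow> \<exists>a b. el a b (z \<cdot> k)"
  then obtain a b where ab: "el a b k"
    by auto
  then have "a \<in> A" "b \<in> A" "k = j a b \<cdot> fac a b k"
    by (auto simp: el_def)
  moreover from this(1,2) have "f \<cdot> (j a b \<cdot> fac a b k) = g \<cdot> (j a b \<cdot> fac a b k)"
    using assms(1,2) assms(3)[of a b] fac(1-3)[OF ab]
    by (simp add: in_hom_iff del: fac Cmp_assoc' flip: Cmp_assoc')
  ultimately show "f \<cdot> k = g \<cdot> k"
    by simp
qed (use assms in \<open>auto simp: in_hom_iff\<close>)

text \<open>Together with \<open>ext_j\<close> this shows that any frame exhibits \<open>M\<close>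
  as the coproduct of the hom objects, also when these were obtained from \<open>M\<close> by
  pullback.\<close>

lemma copair_j:
  assumes Y: "Y \<in> Obj V" and F: "\<And>a b. \<lbrakk>a \<in> A; b \<in> A\<rbrakk> \<Longrightarrow> F a b \<in> hom V (H a b) Y"
  shows "\<exists>f \<in> hom V M Y. \<forall>a \<in> A. \<forall>b \<in> A. f \<cdot> j a b = F a b"
proof -
  \<comment> \<open>Gluing along source and target of the universal element: the list of values is
    the pair \<open>[a, b]\<close>, and the prescribed value is \<open>F a b\<close> applied to the
    factorisation through \<open>j a b\<close>.\<close>
  let ?T = "\<lambda>as k. list_all2 (\<lambda>x a. a \<in> A \<and> x \<cdot> (Idt V M \<cdot> k) = e a \<cdot> bang (Dom V k)) [s, t] as"
  let ?\<phi> = "\<lambda>as k. F (as ! 0) (as ! 1) \<cdot> fac (as ! 0) (as ! 1) k"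
  have T: "el (as ! 0) (as ! 1) k" if "k \<in> Arr V" "Cod V k = M" "?T as k" for as k
    using that by (auto simp: list_all2_Cons1 el_def)
  have F': "F (as ! 0) (as ! 1) \<in> hom V (H (as ! 0) (as ! 1)) Y" if "k \<in> Arr V" "Cod V k = M" "?T as k" for as k
    using T[OF that] F by (auto simp: el_def)
  have "\<exists>f \<in> hom V (Dom V (Idt V M)) Y. \<forall>as. \<forall>k \<in> Arr V. Cod V k = Dom V (Idt V M) \<and> ?T as k \<longrightarrow> f \<cdot> k = ?\<phi> as k"
  proof (rule discrete_glue_list[OF disc Y])
    fix as k assume k: "k \<in> Arr V" "Cod V k = Dom V (Idt V M)" "?T as k"
    then have k': "Cod V k = M"
      by simp
    note a = T[OF k(1) k' k(3)] and b = F'[OF k(1) k' k(3)]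
    show "?\<phi> as k \<in> hom V (Dom V k) Y"
      using fac[OF a] b by (simp add: in_hom_iff del: fac)
    fix l assume l: "l \<in> Arr V" "Cod V l = Dom V k"
    show "?\<phi> as (k \<cdot> l) = ?\<phi> as k \<cdot> l"
      using fac_comp[OF a l] fac[OF a] b l by (simp add: in_hom_iff del: fac)
  qed (auto simp: in_hom_iff)
  then obtain f where f: "f \<in> hom V M Y" "\<And>as k. \<lbrakk>k \<in> Arr V; Cod V k = M; ?T as k\<rbrakk> \<Longrightarrow> f \<cdot> k = ?\<phi> as k"
    by auto
  have "f \<cdot> j a b = F a b" if ab: "a \<in> A" "b \<in> A" for a b
    using f(2)[of "j a b" "[a, b]"] fac_j[OF ab, of "Idt V (H a b)"] F[OF ab] ab by (simp add: s_j t_j in_hom_iff)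
  then show ?thesis
    using f(1) by blast
qed

end

text \<open>Hom objects are fibres of fibres: the elements with source \<open>e a\<close> are cut
  out of \<open>M\<close>, and within that piece those with target \<open>e b\<close>. The value
  \<open>undefined\<close> off \<open>A\<close> matches the convention for
  \<open>ehom\<close>.\<close>

lemma (in lextensive_cartesian) frame_exists:
  assumes D: "discrete A D e" and s: "s \<in> hom V M D" and t: "t \<in> hom V M D"
  shows "\<exists>H j. frame \<U> V A D M s t e H j \<and> (\<forall>a b. \<not> (a \<in> A \<and> b \<in> A) \<longrightarrow> H a b = undefined)"
proof -
  note [simp] = discrete_arr[OF D]
  have [simp]: "s \<in> Arr V" "Dom V s = M" "Cod V s = D" "t \<in> Arr V" "Dom V t = M" "Cod V t = D"
    using s t by (auto simp: in_hom_iff)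
  let ?K = "\<lambda>a. pb_obj V (e a) s" and ?k = "\<lambda>a. pb_snd V (e a) s"
  let ?L = "\<lambda>a b. pb_obj V (e b) (t \<cdot> ?k a)" and ?l = "\<lambda>a b. pb_snd V (e b) (t \<cdot> ?k a)"
  define H where "H = (\<lambda>a b. if a \<in> A \<and> b \<in> A then ?L a b else undefined)"
  have tk: "t \<cdot> ?k a \<in> hom V (?K a) D" if "a \<in> A" for a
    using that by (simp add: in_hom_iff)
  have "frame \<U> V A D M s t e H (\<lambda>a b. ?k a \<cdot> ?l a b)"
  proof
    fix a b assume ab [simp]: "a \<in> A" "b \<in> A"
    note k = fiber[OF D ab(1) s] and l = fiber[OF D ab(2) tk[OF ab(1)]]
    show "H a b \<in> Obj V"
      by (simp add: H_def)
    show "?k a \<cdot> ?l a b \<in> hom V (H a b) M"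
      by (simp add: H_def in_hom_iff)
    show "s \<cdot> (?k a \<cdot> ?l a b) = e a \<cdot> bang (H a b)"
      by (simp add: H_def Cmp_reassoc[OF k(2)])
    show "t \<cdot> (?k a \<cdot> ?l a b) = e b \<cdot> bang (H a b)"
      using l(2) by (simp add: H_def)
    fix x W assume x: "x \<in> hom V W M" "s \<cdot> x = e a \<cdot> bang W" "t \<cdot> x = e b \<cdot> bang W"
    then have x' [simp]: "x \<in> Arr V" "Dom V x = W" "Cod V x = M"
      by (auto simp: in_hom_iff)
    obtain y where y: "y \<in> hom V W (?K a)" "?k a \<cdot> y = x" "\<And>z. z \<in> hom V W (?K a) \<Longrightarrow> ?k a \<cdot> z = x \<Longrightarrow> z = y"
      using k(3)[of x] x by auto
    have y' [simp]: "y \<in> Arr V" "Dom V y = W" "Cod V y = ?K a"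
      using y(1) by (auto simp: in_hom_iff)
    have "\<exists>!h. h \<in> hom V W (?L a b) \<and> ?l a b \<cdot> h = y"
      using l(3)[of y] y(2) x(3) by simp
    moreover have "?k a \<cdot> ?l a b \<cdot> h = x \<longleftrightarrow> ?l a b \<cdot> h = y" if "h \<in> hom V W (?L a b)" for h
    proof -
      have "?k a \<cdot> ?l a b \<cdot> h = ?k a \<cdot> (?l a b \<cdot> h)" "?l a b \<cdot> h \<in> hom V W (?K a)"
        using that by (auto simp: in_hom_iff)
      then show ?thesis
        using y(2) y(3)[of "?l a b \<cdot> h"] by auto
    qed
    ultimately show "\<exists>!h. h \<in> hom V W (H a b) \<and> ?k a \<cdot> ?l a b \<cdot> h = x"
      by (simp add: H_def cong: conj_cong)
  qed (use D s t in simp_all)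
  then show ?thesis
    by (auto simp: H_def)
qed

text \<open>Neither structure is presented as built from the other, so the same notion covers hom
  objects cut out of \<open>icat1 C\<close> and an \<open>icat1 C\<close> assembled from hom
  objects. The maps \<open>j\<close> may be thought of as an action of \<open>E\<close> on elements
  that respects identities and composites.\<close>

locale representation =
  frame \<U> V "eob E" "icat0 C" "icat1 C" "isrc C" "itgt C" e "ehom E" j + internal_category_in V C +
  enriched_category \<U> V E
  for \<U> :: "'i set set" and V :: "('o, 'a, 'm) ccat_scheme" (structure)
    and C :: "('o, 'a) icat" and E :: "('i, 'o, 'a) ecat" and e :: "'i \<Rightarrow> 'a" and j :: "'i \<Rightarrow> 'i \<Rightarrow> 'a" +
  assumes j_eidt: "a \<in> eob E \<Longrightarrow> j a a \<cdot> eidt E a = iidt C \<cdot> e a"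
    and j_ecomp: "\<lbrakk>a \<in> eob E; b \<in> eob E; c \<in> eob E; g \<in> Arr V; f \<in> Arr V; Dom V g = Dom V f;
        Cod V g = ehom E b c; Cod V f = ehom E a b\<rbrakk>
      \<Longrightarrow> j a c \<cdot> ecomp E a b c g f = icomp V C (j b c \<cdot> g) (j a b \<cdot> f)"

text \<open>Enriched identities and composites are the factorisations through \<open>j\<close> of
  the internal ones. Since \<open>j\<close> can be cancelled, every enriched law reduces to the
  internal law for the images.\<close>

lemma (in lextensive_cartesian) representation_of_internal:
  assumes C: "internal_category V C" and D: "discrete A (icat0 C) e"
  shows "\<exists>E j. eob E = A \<and> representation \<U> V C E e j"
proof -
  interpret C: internal_category_in V C
    using C by (simp add: internal_category_in_def finitely_complete_axioms)
  obtain H j where fr: "frame \<U> V A (icat0 C) (icat1 C) (isrc C) (itgt C) e H j"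
    and Hu: "\<And>a b. \<not> (a \<in> A \<and> b \<in> A) \<Longrightarrow> H a b = undefined"
    using frame_exists[OF D C.isrc_in C.itgt_in] by blast
  interpret F: frame \<U> V A "icat0 C" "icat1 C" "isrc C" "itgt C" e H j
    by (rule fr)
  define E where "E = \<lparr>eob = A, ehom = H,
    eidt = (\<lambda>a. if a \<in> A then F.fac a a (iidt C \<cdot> e a) else undefined),
    ecmp = (\<lambda>a b c. if a \<in> A \<and> b \<in> A \<and> c \<in> A then F.fac a c (icomp V C (j b c \<cdot> Pr1 V (H b c) (H a b))
      (j a b \<cdot> Pr2 V (H b c) (H a b))) else undefined)\<rparr>"
  have [simp]: "eob E = A" "ehom E = H"
    by (simp_all add: E_def)
  have comp: "icomposable V C (j b c \<cdot> g) (j a b \<cdot> f)"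
    and el: "F.el a c (icomp V C (j b c \<cdot> g) (j a b \<cdot> f))"
    if "a \<in> A" "b \<in> A" "c \<in> A" "g \<in> Arr V" "f \<in> Arr V" "Dom V g = Dom V f" "Cod V g = H b c" "Cod V f = H a b"
    for a b c g f
  proof -
    show c: "icomposable V C (j b c \<cdot> g) (j a b \<cdot> f)"
      using that by (simp add: icomposable_def)
    show "F.el a c (icomp V C (j b c \<cdot> g) (j a b \<cdot> f))"
      using that C.icomp_arr[OF c] C.isrc_icomp[OF c] C.itgt_icomp[OF c] by (simp add: F.el_def)
  qed
  have el_id: "F.el a a (iidt C \<cdot> e a)" if "a \<in> A" for a
    using that by (simp add: F.el_def C.isrc_iidt_comp C.itgt_iidt_comp)
  have idt: "eidt E a \<in> Arr V" "Dom V (eidt E a) = Unit V" "Cod V (eidt E a) = H a a"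
    "j a a \<cdot> eidt E a = iidt C \<cdot> e a" if "a \<in> A" for a
    using F.fac[OF el_id[OF that]] that by (auto simp: E_def)
  have cmp: "ecmp E a b c \<in> Arr V" "Dom V (ecmp E a b c) = H b c \<otimes> H a b" "Cod V (ecmp E a b c) = H a c"
    "j a c \<cdot> ecmp E a b c = icomp V C (j b c \<cdot> Pr1 V (H b c) (H a b)) (j a b \<cdot> Pr2 V (H b c) (H a b))"
    if abc: "a \<in> A" "b \<in> A" "c \<in> A" for a b c
    using F.fac[OF el[OF abc, of "Pr1 V (H b c) (H a b)" "Pr2 V (H b c) (H a b)"]]
      C.icomp_arr[OF comp[OF abc, of "Pr1 V (H b c) (H a b)" "Pr2 V (H b c) (H a b)"]] abc
    by (auto simp: E_def)
  note [simp] = idt(1-3) cmp(1-3)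
  have undef: "\<not> (a \<in> A \<and> b \<in> A \<and> c \<in> A) \<Longrightarrow> ecmp E a b c = undefined" "a \<notin> A \<Longrightarrow> eidt E a = undefined" for a b c
    by (auto simp: E_def)
  have ec: "ecomp E a b c g f \<in> Arr V" "Dom V (ecomp E a b c g f) = Dom V f" "Cod V (ecomp E a b c g f) = H a c"
    "j a c \<cdot> ecomp E a b c g f = icomp V C (j b c \<cdot> g) (j a b \<cdot> f)"
    if abc [simp]: "a \<in> A" "b \<in> A" "c \<in> A" and gf [simp]: "g \<in> Arr V" "f \<in> Arr V" "Dom V g = Dom V f" "Cod V g = H b c" "Cod V f = H a b"
    for a b c g f
  proof -
    show "ecomp E a b c g f \<in> Arr V" "Dom V (ecomp E a b c g f) = Dom V f" "Cod V (ecomp E a b c g f) = H a c"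
      by (simp_all add: ecomp_def)
    have c: "icomposable V C (j b c \<cdot> Pr1 V (H b c) (H a b)) (j a b \<cdot> Pr2 V (H b c) (H a b))"
      by (rule comp) simp_all
    have "j a c \<cdot> ecomp E a b c g f = (j a c \<cdot> ecmp E a b c) \<cdot> prod_pair V g f"
      by (simp add: ecomp_def)
    also have "\<dots> = icomp V C (j b c \<cdot> g) (j a b \<cdot> f)"
      unfolding cmp(4)[OF abc] by (simp add: C.icomp_nat[OF c])
    finally show "j a c \<cdot> ecomp E a b c g f = icomp V C (j b c \<cdot> g) (j a b \<cdot> f)" .
  qed
  have "enriched_category \<U> V E"
  proof (rule enriched_categoryI)
    fix a b c d h g f assume "a \<in> eob E" "b \<in> eob E" "c \<in> eob E" "d \<in> eob E"
      "h \<in> Arr V" "Cod V h = ehom E c d" "g \<in> Arr V" "Dom V g = Dom V h" "Cod V g = ehom E b c"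
      "f \<in> Arr V" "Dom V f = Dom V h" "Cod V f = ehom E a b"
    then have [simp]: "a \<in> A" "b \<in> A" "c \<in> A" "d \<in> A" "h \<in> Arr V" "Cod V h = H c d" "g \<in> Arr V"
      "Dom V g = Dom V h" "Cod V g = H b c" "f \<in> Arr V" "Dom V f = Dom V h" "Cod V f = H a b"
      by simp_all
    have c: "icomposable V C (j c d \<cdot> h) (j b c \<cdot> g)" "icomposable V C (j b c \<cdot> g) (j a b \<cdot> f)"
      by (rule comp; simp)+
    \<comment> \<open>Under \<open>j a d\<close> both bracketings turn into internal composites of
      the same three elements.\<close>
    have "j a d \<cdot> ecomp E a b d (ecomp E b c d h g) f = icomp V C (icomp V C (j c d \<cdot> h) (j b c \<cdot> g)) (j a b \<cdot> f)"
      by (simp add: ec)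
    moreover have "j a d \<cdot> ecomp E a c d h (ecomp E a b c g f) = icomp V C (j c d \<cdot> h) (icomp V C (j b c \<cdot> g) (j a b \<cdot> f))"
      by (simp add: ec)
    ultimately have "j a d \<cdot> ecomp E a b d (ecomp E b c d h g) f = j a d \<cdot> ecomp E a c d h (ecomp E a b c g f)"
      by (simp add: C.icomp_assoc[OF c])
    then show "ecomp E a b d (ecomp E b c d h g) f = ecomp E a c d h (ecomp E a b c g f)"
      by (rule F.j_mono[of a d, rotated -1]) (simp_all add: ec(1-3))
  next
    fix a b f assume "a \<in> eob E" "b \<in> eob E" "f \<in> Arr V" "Cod V f = ehom E a b"
    then have [simp]: "a \<in> A" "b \<in> A" "f \<in> Arr V" "Cod V f = H a b"
      by simp_all
    have i: "j c c \<cdot> (eidt E c \<cdot> bang (Dom V f)) = iidt C \<cdot> (e c \<cdot> bang (Dom V f))" if "c \<in> A" for c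
      using that by (simp add: Cmp_reassoc[OF idt(4)])
    show "ecomp E a a b f (eidt E a \<cdot> bang (Dom V f)) = f"
      by (rule F.j_mono[of a b]) (use C.icomp_iidt_right[of "j a b \<cdot> f"] in \<open>simp_all add: ec i\<close>)
    show "ecomp E a b b (eidt E b \<cdot> bang (Dom V f)) f = f"
      by (rule F.j_mono[of a b]) (use C.icomp_iidt_left[of "j a b \<cdot> f"] in \<open>simp_all add: ec i\<close>)
  next
    show "eob E \<in> \<U>"
      using D by (simp add: discrete_def)
  qed (use Hu undef in \<open>auto simp: in_hom_iff\<close>)
  then have "representation \<U> V C E e j"
    using fr C.internal_category_in_axioms
    by (intro representation.intro representation_axioms.intro) (simp_all add: idt ec)
  then show ?thesis
    by (intro exI[of _ E] exI[of _ j]) simp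
qed

section \<open>Internal categories from enriched categories\<close>

lemma (in lextensive_cartesian) small_coproduct:
  assumes "A \<in> \<U>" "\<And>a. a \<in> A \<Longrightarrow> X a \<in> Obj V"
  shows "\<exists>s \<iota>. is_coproduct V A X s \<iota>"
  using lextensive assms unfolding infinitary_lextensive_def has_small_coproducts_def by blast

text \<open>Small coproducts are indexed by sets of elements of \<open>'i\<close>, so the coproduct
  over pairs is formed in two stages, over \<open>b\<close> and then over \<open>a\<close>.
  Correspondingly \<open>coproduct_over_discrete\<close> is used twice: \<open>s\<close> separates
  the outer summands, and \<open>\<tau> a\<close> separates the inner ones.\<close>

lemma (in lextensive_cartesian) frame_of_coproducts:
  assumes D: "discrete A D e" and H: "\<And>a b. \<lbrakk>a \<in> A; b \<in> A\<rbrakk> \<Longrightarrow> H a b \<in> Obj V"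
  shows "\<exists>M s t j. frame \<U> V A D M s t e H j"
proof -
  have A: "A \<in> \<U>" and D_Obj: "D \<in> Obj V"
    using D by (auto simp: discrete_def is_coproduct_def)
  note [simp] = discrete_arr[OF D] D_Obj
  have "\<forall>a \<in> A. \<exists>y. is_coproduct V A (H a) (fst y) (snd y)"
    using small_coproduct[OF A] H by (metis fst_conv snd_conv)
  then obtain z where z: "\<And>a. a \<in> A \<Longrightarrow> is_coproduct V A (H a) (fst (z a)) (snd (z a))"
    by metis
  define Y i where "Y = (\<lambda>a. fst (z a))" and "i = (\<lambda>a. snd (z a))"
  have Y: "is_coproduct V A (H a) (Y a) (i a)" if "a \<in> A" for a
    using z[OF that] by (simp add: Y_def i_def)
  have i [simp]: "Y a \<in> Obj V" "b \<in> A \<Longrightarrow> i a b \<in> Arr V" "b \<in> A \<Longrightarrow> Dom V (i a b) = H a b"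
    "b \<in> A \<Longrightarrow> Cod V (i a b) = Y a" if "a \<in> A" for a b
    using is_coproductD[OF Y[OF that]] by auto
  obtain M y where M: "is_coproduct V A Y M y"
    using small_coproduct[OF A, of Y] by auto
  have y [simp]: "M \<in> Obj V" "a \<in> A \<Longrightarrow> y a \<in> Arr V" "a \<in> A \<Longrightarrow> Dom V (y a) = Y a" "a \<in> A \<Longrightarrow> Cod V (y a) = M" for a
    using is_coproductD[OF M] by auto
  note [simp] = H
  obtain s where s: "s \<in> hom V M D" "\<And>a. a \<in> A \<Longrightarrow> s \<cdot> y a = e a \<cdot> bang (Y a)"
    using coproduct_copair[OF M D_Obj, of "\<lambda>a. e a \<cdot> bang (Y a)"] by (auto simp: in_hom_iff)
  have "\<exists>h. h \<in> hom V (Y a) D \<and> (\<forall>b \<in> A. h \<cdot> i a b = e b \<cdot> bang (H a b))" if "a \<in> A" for a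
    using coproduct_copair[OF Y[OF that] D_Obj, of "\<lambda>b. e b \<cdot> bang (H a b)"] that by (auto simp: in_hom_iff)
  then obtain \<tau> where \<tau>: "\<And>a. a \<in> A \<Longrightarrow> \<tau> a \<in> hom V (Y a) D"
    "\<And>a b. a \<in> A \<Longrightarrow> b \<in> A \<Longrightarrow> \<tau> a \<cdot> i a b = e b \<cdot> bang (H a b)"
    by metis
  obtain t where t: "t \<in> hom V M D" "\<And>a. a \<in> A \<Longrightarrow> t \<cdot> y a = \<tau> a"
    using coproduct_copair[OF M D_Obj \<tau>(1)] by auto
  have [simp]: "s \<in> Arr V" "Dom V s = M" "Cod V s = D" "t \<in> Arr V" "Dom V t = M" "Cod V t = D"
    using s t by (auto simp: in_hom_iff)
  have [simp]: "\<tau> a \<in> Arr V" "Dom V (\<tau> a) = Y a" "Cod V (\<tau> a) = D" if "a \<in> A" for a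
    using \<tau>(1)[OF that] by (auto simp: in_hom_iff)
  have "frame \<U> V A D M s t e H (\<lambda>a b. y a \<cdot> i a b)"
  proof
    fix a b assume ab [simp]: "a \<in> A" "b \<in> A"
    show "y a \<cdot> i a b \<in> hom V (H a b) M"
      by (simp add: in_hom_iff)
    show "s \<cdot> (y a \<cdot> i a b) = e a \<cdot> bang (H a b)"
      by (simp add: Cmp_reassoc[OF s(2)])
    show "t \<cdot> (y a \<cdot> i a b) = e b \<cdot> bang (H a b)"
      by (simp add: Cmp_reassoc[OF t(2)] \<tau>(2))
    fix x W assume x: "x \<in> hom V W M" "s \<cdot> x = e a \<cdot> bang W" "t \<cdot> x = e b \<cdot> bang W"
    obtain h where h: "h \<in> hom V W (Y a)" "y a \<cdot> h = x" "\<And>h'. h' \<in> hom V W (Y a) \<Longrightarrow> y a \<cdot> h' = x \<Longrightarrow> h' = h"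
      using coproduct_over_discrete[OF D M s(1) s(2) ab(1) x(1,2)] by metis
    have h' [simp]: "h \<in> Arr V" "Dom V h = W" "Cod V h = Y a"
      using h(1) by (auto simp: in_hom_iff)
    have "\<tau> a \<cdot> h = e b \<cdot> bang W"
      using Cmp_reassoc[OF t(2)[OF ab(1)], of h] h(2) x(3) by simp
    then have "\<exists>!l. l \<in> hom V W (H a b) \<and> i a b \<cdot> l = h"
      using coproduct_over_discrete[OF D Y[OF ab(1)] \<tau>(1)[OF ab(1)] \<tau>(2)[OF ab(1)] ab(2) h(1)] by simp
    \<comment> \<open>Factoring through the outer injection is unique, so factoring \<open>x\<close>
      through the composite is the same as factoring \<open>h\<close> through the inner
      injection.\<close>
    moreover have "y a \<cdot> i a b \<cdot> l = x \<longleftrightarrow> i a b \<cdot> l = h" if "l \<in> hom V W (H a b)" for l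
    proof -
      have "y a \<cdot> i a b \<cdot> l = y a \<cdot> (i a b \<cdot> l)" "i a b \<cdot> l \<in> hom V W (Y a)"
        using that by (auto simp: in_hom_iff)
      then show ?thesis
        using h(2) h(3)[of "i a b \<cdot> l"] by auto
    qed
    ultimately show "\<exists>!l. l \<in> hom V W (H a b) \<and> y a \<cdot> i a b \<cdot> l = x"
      by (simp cong: conj_cong)
  qed (use D s t in simp_all)
  then show ?thesis
    by blast
qed

text \<open>The types of an element need not be unique, as its domain may be initial; hence \<open>b' = b\<close> is not
  claimed.\<close>

lemma (in frame) el_source:
  assumes "el b c g" "el a b' f" "Dom V g = Dom V f" "s \<cdot> g = t \<cdot> f"
  shows "el a b f"
  using assms by (simp add: el_def)

text \<open>The composition map is glued over the object of composable pairs, and each internal law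
  is checked on typed pieces, where it is the corresponding law of \<open>E\<close>.\<close>

lemma (in lextensive_cartesian) representation_of_enriched:
  assumes E: "enriched_category \<U> V E" and D: "discrete (eob E) D e"
  shows "\<exists>C j. icat0 C = D \<and> representation \<U> V C E e j"
proof -
  let ?A = "eob E" and ?H = "ehom E"
  obtain M s t j where fr: "frame \<U> V ?A D M s t e ?H j"
    using frame_of_coproducts[OF D, of ?H] enriched_arr[OF E] by blast
  interpret F: frame \<U> V ?A D M s t e ?H j
    by (rule fr)
  note [simp] = enriched_arr[OF E] ecomp_arr[OF E]
  let ?P = "pb_obj V s t" and ?p = "pb_fst V s t" and ?q = "pb_snd V s t"
  \<comment> \<open>A composable pair \<open>(g, f)\<close> passes through three points: the source
    of \<open>f\<close>, the target of \<open>f\<close>, and the target of \<open>g\<close>. The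
    source of \<open>g\<close>, namely \<open>s \<cdot> ?p\<close>, equals
    \<open>t \<cdot> ?q\<close> on the pullback, so the middle point serves both factors.\<close>
  let ?T = "\<lambda>as k. list_all2 (\<lambda>x a. a \<in> ?A \<and> x \<cdot> (Idt V ?P \<cdot> k) = e a \<cdot> bang (Dom V k)) [s \<cdot> ?q, t \<cdot> ?q, t \<cdot> ?p] as"
  let ?m = "\<lambda>a b c k. j a c \<cdot> ecomp E a b c (F.fac b c (?p \<cdot> k)) (F.fac a b (?q \<cdot> k))"
  let ?\<phi> = "\<lambda>as k. ?m (as ! 0) (as ! 1) (as ! 2) k"
  have T: "F.el (as ! 1) (as ! 2) (?p \<cdot> k)" "F.el (as ! 0) (as ! 1) (?q \<cdot> k)"
    if k: "k \<in> Arr V" "Cod V k = ?P" "?T as k" for as k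
  proof -
    have "s \<cdot> (?p \<cdot> k) = t \<cdot> (?q \<cdot> k)"
      using k Cmp_reassoc[OF pb_commutes[of s t], of k] by simp
    then show "F.el (as ! 1) (as ! 2) (?p \<cdot> k)" "F.el (as ! 0) (as ! 1) (?q \<cdot> k)"
      using k by (auto simp: list_all2_Cons1 F.el_def)
  qed
  have "\<exists>f \<in> hom V (Dom V (Idt V ?P)) M. \<forall>as. \<forall>k \<in> Arr V. Cod V k = Dom V (Idt V ?P) \<and> ?T as k \<longrightarrow> f \<cdot> k = ?\<phi> as k"
  proof (rule discrete_glue_list[OF D])
    fix as k assume k: "k \<in> Arr V" "Cod V k = Dom V (Idt V ?P)" "?T as k"
    then have k' [simp]: "Cod V k = ?P" "k \<in> Arr V"
      by simp_all
    note p = T(1)[OF k(1) k'(1) k(3)] and q = T(2)[OF k(1) k'(1) k(3)]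
    have [simp]: "as ! 0 \<in> ?A" "as ! 1 \<in> ?A" "as ! 2 \<in> ?A"
      using p q by (auto simp: F.el_def)
    note [simp] = F.fac(1-3)[OF p] F.fac(1-3)[OF q]
    show "?\<phi> as k \<in> hom V (Dom V k) M"
      by (simp add: in_hom_iff del: One_nat_def)
    fix l assume l: "l \<in> Arr V" "Cod V l = Dom V k"
    have "F.fac (as ! 1) (as ! 2) (?p \<cdot> (k \<cdot> l)) = F.fac (as ! 1) (as ! 2) (?p \<cdot> k) \<cdot> l"
      "F.fac (as ! 0) (as ! 1) (?q \<cdot> (k \<cdot> l)) = F.fac (as ! 0) (as ! 1) (?q \<cdot> k) \<cdot> l"
      using F.fac_comp[OF p, of l] F.fac_comp[OF q, of l] l by simp_all
    then show "?\<phi> as (k \<cdot> l) = ?\<phi> as k \<cdot> l"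
      using l by (simp add: ecomp_nat[OF E] del: One_nat_def)
  qed (auto simp: in_hom_iff)
  then obtain m where m: "m \<in> hom V ?P M" "\<And>as k. \<lbrakk>k \<in> Arr V; Cod V k = ?P; ?T as k\<rbrakk> \<Longrightarrow> m \<cdot> k = ?\<phi> as k"
    by auto
  have [simp]: "m \<in> Arr V" "Dom V m = ?P" "Cod V m = M"
    using m(1) by (auto simp: in_hom_iff)
  have "is_coproduct V ?A (\<lambda>_. Unit V) D e"
    using D by (simp add: discrete_def)
  \<comment> \<open>The internal identities are determined at the points of \<open>D\<close>, where
    they must be the enriched ones carried along \<open>j\<close>.\<close>
  from coproduct_copair[OF this, of M "\<lambda>a. j a a \<cdot> eidt E a"]
  obtain i where i: "i \<in> hom V D M" "\<And>a. a \<in> ?A \<Longrightarrow> i \<cdot> e a = j a a \<cdot> eidt E a"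
    by (auto simp: in_hom_iff)
  have [simp]: "i \<in> Arr V" "Dom V i = D" "Cod V i = M"
    using i(1) by (auto simp: in_hom_iff)
  define C where "C = \<lparr>icat0 = D, icat1 = M, isrc = s, itgt = t, iidt = i, icmp = m\<rparr>"
  have C [simp]: "icat0 C = D" "icat1 C = M" "isrc C = s" "itgt C = t" "iidt C = i" "icmp C = m"
    by (simp_all add: C_def)
  have jm: "icomp V C (j b c \<cdot> g) (j a b \<cdot> f) = j a c \<cdot> ecomp E a b c g f"
    if [simp]: "a \<in> ?A" "b \<in> ?A" "c \<in> ?A" "g \<in> Arr V" "f \<in> Arr V" "Dom V g = Dom V f"
      "Cod V g = ehom E b c" "Cod V f = ehom E a b" for a b c g f
  proof -
    let ?k = "pb_pair V s t (j b c \<cdot> g) (j a b \<cdot> f)"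
    have e: "s \<cdot> (j b c \<cdot> g) = t \<cdot> (j a b \<cdot> f)"
      by simp
    have [simp]: "?k \<in> Arr V" "Dom V ?k = Dom V f" "Cod V ?k = ?P" "?p \<cdot> ?k = j b c \<cdot> g" "?q \<cdot> ?k = j a b \<cdot> f"
      by (simp_all add: e)
    \<comment> \<open>The glued map may be evaluated at whichever types the given presentation of
      the pair supplies, and \<open>fac\<close> then undoes \<open>j\<close>.\<close>
    have "?T [a, b, c] ?k"
      by simp
    from m(2)[OF _ _ this] show ?thesis
      by (simp add: icomp_def)
  qed
  have nat: "icomp V C g f \<cdot> k = icomp V C (g \<cdot> k) (f \<cdot> k)"
    if "icomposable V C g f" "k \<in> Arr V" "Cod V k = Dom V f" for g f k
    using that by (simp add: icomposable_def icomp_def pb_pair_comp)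
  have ic: "icomp V C g f \<in> Arr V" "Dom V (icomp V C g f) = Dom V f" "Cod V (icomp V C g f) = M"
    if "icomposable V C g f" for g f
    using that by (simp_all add: icomposable_def icomp_def)
  have icD: "g \<in> Arr V" "f \<in> Arr V" "Cod V g = M" "Cod V f = M" "Dom V g = Dom V f" "s \<cdot> g = t \<cdot> f"
    if "icomposable V C g f" for g f
    using that by (auto simp: icomposable_def)
  have ic_nat: "icomposable V C (g \<cdot> k) (f \<cdot> k)"
    if "icomposable V C g f" "k \<in> Arr V" "Cod V k = Dom V f" for g f k
    using that Cmp_reassoc[of s g "t \<cdot> f" k] by (simp add: icomposable_def)
  \<comment> \<open>A composable pair of typed elements is brought to a common middle point: the
    target of \<open>f\<close> is replaced by the source \<open>b\<close> of \<open>g\<close>, and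
    both are then factored through \<open>j\<close>.\<close>
  have local: "\<exists>a b c g' f'. a \<in> ?A \<and> b \<in> ?A \<and> c \<in> ?A \<and> g' \<in> Arr V \<and> f' \<in> Arr V \<and> Dom V g' = Dom V f' \<and>
      Cod V g' = ?H b c \<and> Cod V f' = ?H a b \<and> Dom V f' = Dom V f \<and> g = j b c \<cdot> g' \<and> f = j a b \<cdot> f'"
    if gf: "icomposable V C g f" and g: "F.el b c g" and f: "F.el a b' f" for g f a b b' c
  proof -
    have f': "F.el a b f"
      by (rule F.el_source[OF g f]) (use icD[OF gf] in simp_all)
    show ?thesis
      using F.fac[OF g] F.fac[OF f'] g f' icD[OF gf]
      by (intro exI[of _ a] exI[of _ b] exI[of _ c] exI[of _ "F.fac b c g"] exI[of _ "F.fac a b f"])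
        (simp add: F.el_def)
  qed
  have idt: "i \<cdot> (e a \<cdot> bang W) = j a a \<cdot> (eidt E a \<cdot> bang W)" if "a \<in> ?A" "W \<in> Obj V" for a W
    using that by (simp add: Cmp_reassoc[OF i(2)])
  \<comment> \<open>Source and target of a composite are compared on the pieces where both factors
    are typed; there the composite is \<open>j a c\<close> of something, whose ends are
    constant.\<close>
  have sm: "s \<cdot> icomp V C g f = s \<cdot> f" "t \<cdot> icomp V C g f = t \<cdot> g" if gf: "icomposable V C g f" for g f
  proof -
    have loc: "s \<cdot> icomp V C g f \<cdot> k = s \<cdot> f \<cdot> k \<and> t \<cdot> icomp V C g f \<cdot> k = t \<cdot> g \<cdot> k"
      if k: "k \<in> Arr V" "Cod V k = Dom V f" and el: "\<And>z. z \<in> set [g, f] \<Longrightarrow> \<exists>a b. F.el a b (z \<cdot> k)" for k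
    proof -
      obtain b c a b' where "F.el b c (g \<cdot> k)" "F.el a b' (f \<cdot> k)"
        using el[of g] el[of f] by auto
      from local[OF ic_nat[OF gf k] this] obtain a b c g' f'
        where [simp]: "a \<in> ?A" "b \<in> ?A" "c \<in> ?A" "g' \<in> Arr V" "f' \<in> Arr V" "Dom V g' = Dom V f'"
          "Cod V g' = ?H b c" "Cod V f' = ?H a b" and gk: "g \<cdot> k = j b c \<cdot> g'" "f \<cdot> k = j a b \<cdot> f'"
        by blast
      have "icomp V C g f \<cdot> k = j a c \<cdot> ecomp E a b c g' f'"
        unfolding nat[OF gf k] gk by (rule jm) simp_all
      then show ?thesis
        using ic[OF gf] icD[OF gf] k gk by simp
    qed
    have ty: "\<And>z. z \<in> set [g, f] \<Longrightarrow> z \<in> hom V (Dom V f) M"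
      "s \<cdot> icomp V C g f \<in> hom V (Dom V f) D" "s \<cdot> f \<in> hom V (Dom V f) D"
      "t \<cdot> icomp V C g f \<in> hom V (Dom V f) D" "t \<cdot> g \<in> hom V (Dom V f) D"
      using ic[OF gf] icD[OF gf] by (auto simp: in_hom_iff)
    show "s \<cdot> icomp V C g f = s \<cdot> f"
      by (rule F.ext_elements[OF ty(1,2,3)]) (assumption, use loc in blast)
    show "t \<cdot> icomp V C g f = t \<cdot> g"
      by (rule F.ext_elements[OF ty(1,4,5)]) (assumption, use loc in blast)
  qed
  have "internal_category V C"
  proof (rule internal_categoryI)
    show "isrc C \<cdot> iidt C = Idt V (icat0 C)" "itgt C \<cdot> iidt C = Idt V (icat0 C)"
      by (rule discrete_map_unique[OF D, of _ D]; auto simp: in_hom_iff i(2))+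
    show "isrc C \<cdot> icomp V C g f = isrc C \<cdot> f" "itgt C \<cdot> icomp V C g f = itgt C \<cdot> g" if "icomposable V C g f" for g f
      using sm[OF that] by simp_all
  next
    fix x assume "x \<in> Arr V" "Cod V x = icat1 C"
    then have x [simp]: "x \<in> Arr V" "Cod V x = M"
      by simp_all
    have si: "s \<cdot> i = Idt V D" "t \<cdot> i = Idt V D"
      by (rule discrete_map_unique[OF D, of _ D]; auto simp: in_hom_iff i(2))+
    have si': "s \<cdot> (i \<cdot> z) = z" "t \<cdot> (i \<cdot> z) = z" if "z \<in> Arr V" "Cod V z = D" for z
      using that by (simp_all add: Cmp_reassoc[OF si(1)] Cmp_reassoc[OF si(2)])
    have c: "icomposable V C x (i \<cdot> (s \<cdot> x))" "icomposable V C (i \<cdot> (t \<cdot> x)) x"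
      by (simp_all add: icomposable_def si')
    have loc: "icomp V C x (i \<cdot> (s \<cdot> x)) \<cdot> k = x \<cdot> k \<and> icomp V C (i \<cdot> (t \<cdot> x)) x \<cdot> k = x \<cdot> k"
      if k: "k \<in> Arr V" "Cod V k = Dom V x" and el: "\<And>z. z \<in> set [x] \<Longrightarrow> \<exists>a b. F.el a b (z \<cdot> k)" for k
    proof -
      obtain a b where ab: "F.el a b (x \<cdot> k)"
        using el[of x] by auto
      obtain y where y [simp]: "y \<in> Arr V" "Cod V y = ?H a b" "Dom V y = Dom V k" and xk: "x \<cdot> k = j a b \<cdot> y"
        using F.fac[OF ab] x k by (metis Cmp_arr(2))
      have [simp]: "a \<in> ?A" "b \<in> ?A"
        using ab by (auto simp: F.el_def)
      have "icomp V C x (i \<cdot> (s \<cdot> x)) \<cdot> k = icomp V C (j a b \<cdot> y) (j a a \<cdot> (eidt E a \<cdot> bang (Dom V y)))"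
        using k nat[OF c(1), of k] by (simp add: xk idt)
      also have "\<dots> = j a b \<cdot> y"
        using ecomp_eidt_right[OF E, of a b y] k by (simp add: jm)
      finally have 1: "icomp V C x (i \<cdot> (s \<cdot> x)) \<cdot> k = x \<cdot> k"
        using xk by simp
      have "icomp V C (i \<cdot> (t \<cdot> x)) x \<cdot> k = icomp V C (j b b \<cdot> (eidt E b \<cdot> bang (Dom V y))) (j a b \<cdot> y)"
        using k nat[OF c(2), of k] by (simp add: xk idt)
      also have "\<dots> = j a b \<cdot> y"
        using ecomp_eidt_left[OF E, of a b y] k by (simp add: jm)
      finally show ?thesis
        using 1 xk by simp
    qed
    have ty: "\<And>z. z \<in> set [x] \<Longrightarrow> z \<in> hom V (Dom V x) M" "x \<in> hom V (Dom V x) M"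
      "icomp V C x (i \<cdot> (s \<cdot> x)) \<in> hom V (Dom V x) M" "icomp V C (i \<cdot> (t \<cdot> x)) x \<in> hom V (Dom V x) M"
      using ic[OF c(1)] ic[OF c(2)] by (auto simp: in_hom_iff)
    have "icomp V C x (i \<cdot> (s \<cdot> x)) = x"
      by (rule F.ext_elements[OF ty(1,3,2)]) (assumption, use loc in blast)
    moreover have "icomp V C (i \<cdot> (t \<cdot> x)) x = x"
      by (rule F.ext_elements[OF ty(1,4,2)]) (assumption, use loc in blast)
    ultimately show "icomp V C x (iidt C \<cdot> (isrc C \<cdot> x)) = x" "icomp V C (iidt C \<cdot> (itgt C \<cdot> x)) x = x"
      by simp_all
  next
    fix h g f assume hg: "icomposable V C h g" and gf: "icomposable V C g f"
    have c: "icomposable V C (icomp V C h g) f" "icomposable V C h (icomp V C g f)"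
      using icD[OF hg] icD[OF gf] ic[OF hg] ic[OF gf] sm[OF hg] sm[OF gf] by (simp_all add: icomposable_def)
    show "icomp V C (icomp V C h g) f = icomp V C h (icomp V C g f)"
    proof (rule F.ext_elements[of "[h, g, f]" "Dom V f" _ M])
      show "z \<in> hom V (Dom V f) M" if "z \<in> set [h, g, f]" for z
        using that icD[OF hg] icD[OF gf] by (auto simp: in_hom_iff)
      show "icomp V C (icomp V C h g) f \<in> hom V (Dom V f) M" "icomp V C h (icomp V C g f) \<in> hom V (Dom V f) M"
        using ic[OF c(1)] ic[OF c(2)] ic[OF gf] by (simp_all add: in_hom_iff)
      fix k assume k: "k \<in> Arr V" "Cod V k = Dom V f" and el: "\<And>z. z \<in> set [h, g, f] \<Longrightarrow> \<exists>a b. F.el a b (z \<cdot> k)"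
      have kg: "Cod V k = Dom V g"
        using k icD[OF gf] by simp
      obtain c d b c' a b' where hk: "F.el c d (h \<cdot> k)" and gk: "F.el b c' (g \<cdot> k)" and fk: "F.el a b' (f \<cdot> k)"
        using el[of h] el[of g] el[of f] by auto
      \<comment> \<open>The types are aligned from left to right: the target of \<open>g\<close> is
        replaced by the source of \<open>h\<close>, and the target of \<open>f\<close> by the source
        of \<open>g\<close>.\<close>
      have gk: "F.el b c (g \<cdot> k)"
        by (rule F.el_source[OF hk gk]) (use icD[OF ic_nat[OF hg k(1) kg]] in simp_all)
      have fk: "F.el a b (f \<cdot> k)"
        by (rule F.el_source[OF gk fk]) (use icD[OF ic_nat[OF gf k]] in simp_all)
      have abcd [simp]: "a \<in> ?A" "b \<in> ?A" "c \<in> ?A" "d \<in> ?A"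
        using hk gk fk by (auto simp: F.el_def)
      obtain h' g' f' where l [simp]: "h' \<in> Arr V" "g' \<in> Arr V" "f' \<in> Arr V" "Dom V h' = Dom V k" "Dom V g' = Dom V k"
          "Dom V f' = Dom V k" "Cod V h' = ?H c d" "Cod V g' = ?H b c" "Cod V f' = ?H a b"
        and e: "h \<cdot> k = j c d \<cdot> h'" "g \<cdot> k = j b c \<cdot> g'" "f \<cdot> k = j a b \<cdot> f'"
        using F.fac[OF hk] F.fac[OF gk] F.fac[OF fk] icD[OF hg] icD[OF gf] k by (metis Cmp_arr(2))
      have "icomp V C (icomp V C h g) f \<cdot> k = j a d \<cdot> ecomp E a b d (ecomp E b c d h' g') f'"
        by (simp add: nat[OF c(1) k] nat[OF hg k(1) kg] e jm)
      moreover have "icomp V C h (icomp V C g f) \<cdot> k = j a d \<cdot> ecomp E a c d h' (ecomp E a b c g' f')"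
        using nat[OF c(2), of k] ic[OF gf] k by (simp add: nat[OF gf k] e jm)
      ultimately show "icomp V C (icomp V C h g) f \<cdot> k = icomp V C h (icomp V C g f) \<cdot> k"
        by (simp add: ecomp_assoc[OF E])
    qed
  qed (auto simp: in_hom_iff)
  then have "representation \<U> V C E e j"
    using fr E by (intro representation.intro representation_axioms.intro internal_category_in.intro)
      (simp_all add: finitely_complete_axioms i(2) jm)
  then show ?thesis
    by (intro exI[of _ C] exI[of _ j]) simp
qed

section \<open>Functors between represented categories\<close>

lemma (in representation) eidt_arr' [simp]:
  "a \<in> eob E \<Longrightarrow> eidt E a \<in> Arr V" "a \<in> eob E \<Longrightarrow> Dom V (eidt E a) = Unit V"
  "a \<in> eob E \<Longrightarrow> Cod V (eidt E a) = ehom E a a"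
  using eidt_in by (auto simp: in_hom_iff)

lemmas (in representation) ecomp_arr' [simp] = ecomp_arr[OF enriched_category_axioms]

locale representation_pair = R: representation \<U> V C E e j + R': representation \<U> V C' E' e' j'
  for \<U> :: "'i set set" and V :: "('o, 'a, 'm) ccat_scheme" (structure)
    and C :: "('o, 'a) icat" and E :: "('i, 'o, 'a) ecat" and e :: "'i \<Rightarrow> 'a" and j :: "'i \<Rightarrow> 'i \<Rightarrow> 'a"
    and C' :: "('o, 'a) icat" and E' :: "('i, 'o, 'a) ecat" and e' :: "'i \<Rightarrow> 'a" and j' :: "'i \<Rightarrow> 'i \<Rightarrow> 'a"
begin

text \<open>\<open>ifun1 u\<close> maps elements of type \<open>(a, b)\<close> to elements of type
  \<open>(v a, v b)\<close>, so it factors through \<open>j'\<close>. Because \<open>j'\<close> can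
  be cancelled, the factorisation is unique and inherits the functor laws.\<close>

lemma enriched_of_internal:
  assumes u: "internal_functor V u" "ifdom u = C" "ifcod u = C'"
    and v: "v \<in> eob E \<rightarrow>\<^sub>E eob E'" and ue: "\<And>a. a \<in> eob E \<Longrightarrow> ifun0 u \<cdot> e a = e' (v a)"
  shows "\<exists>!F. enriched_functor \<U> V F \<and> efdom F = E \<and> efcod F = E' \<and> efob F = v \<and>
    (\<forall>a \<in> eob E. \<forall>b \<in> eob E. ifun1 u \<cdot> j a b = j' (v a) (v b) \<cdot> efhom F a b)"
proof (rule ex_ex1I)
  note [simp] = R.internal_functorD[OF u(1), unfolded u(2,3)]
  have [simp]: "v a \<in> eob E'" if "a \<in> eob E" for a
    using v that by blast
  have us: "isrc C' \<cdot> ifun1 u = ifun0 u \<cdot> isrc C" "itgt C' \<cdot> ifun1 u = ifun0 u \<cdot> itgt C"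
    and ui: "ifun1 u \<cdot> iidt C = iidt C' \<cdot> ifun0 u"
    using internal_functor.ifun_isrc[OF u(1)] internal_functor.ifun_itgt[OF u(1)]
      internal_functor.ifun_iidt[OF u(1)] u(2,3) by simp_all
  define F where "F = \<lparr>efdom = E, efcod = E', efob = v,
    efhom = (\<lambda>a b. if a \<in> eob E \<and> b \<in> eob E then R'.fac (v a) (v b) (ifun1 u \<cdot> j a b) else undefined)\<rparr>"
  have [simp]: "efdom F = E" "efcod F = E'" "efob F = v"
    by (simp_all add: F_def)
  \<comment> \<open>The source of \<open>ifun1 u \<cdot> j a b\<close> is \<open>ifun0 u\<close>
    applied to the constant \<open>e a\<close>, which is the constant \<open>e' (v a)\<close>;
    likewise for the target.\<close>
  have el: "R'.el (v a) (v b) (ifun1 u \<cdot> j a b)" if "a \<in> eob E" "b \<in> eob E" for a b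
    using that by (simp add: R'.el_def R.s_j R.t_j
        R.Cmp_reassoc[OF us(1)] R.Cmp_reassoc[OF us(2)] R.Cmp_reassoc[OF ue])
  have F [simp]: "efhom F a b \<in> Arr V" "Dom V (efhom F a b) = ehom E a b" "Cod V (efhom F a b) = ehom E' (v a) (v b)"
    and jF: "ifun1 u \<cdot> j a b = j' (v a) (v b) \<cdot> efhom F a b" if "a \<in> eob E" "b \<in> eob E" for a b
    using that R'.fac[OF el[OF that]] by (simp_all add: F_def)
  have jF': "j' (v a) (v b) \<cdot> (efhom F a b \<cdot> k) = ifun1 u \<cdot> (j a b \<cdot> k)"
    if "a \<in> eob E" "b \<in> eob E" "k \<in> Arr V" "Cod V k = ehom E a b" for a b k
    using that R.Cmp_reassoc[OF jF[symmetric]] by simp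
  have "enriched_functor \<U> V F"
  proof (rule R.enriched_functorI)
    fix a assume "a \<in> eob (efdom F)"
    then have a [simp]: "a \<in> eob E"
      by simp
    have "ifun1 u \<cdot> (iidt C \<cdot> e a) = iidt C' \<cdot> e' (v a)"
      by (simp add: R.Cmp_reassoc[OF ui] ue)
    then have "j' (v a) (v a) \<cdot> (efhom F a a \<cdot> eidt E a) = j' (v a) (v a) \<cdot> eidt E' (v a)"
      by (simp add: jF' R.j_eidt R'.j_eidt)
    then have "efhom F a a \<cdot> eidt E a = eidt E' (v a)"
      by (rule R'.j_mono[rotated -1]) simp_all
    then show "efhom F a a \<cdot> eidt (efdom F) a = eidt (efcod F) (efob F a)"
      by simp
  next
    fix a b c g f assume "a \<in> eob (efdom F)" "b \<in> eob (efdom F)" "c \<in> eob (efdom F)"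
      "g \<in> Arr V" "Cod V g = ehom (efdom F) b c" "f \<in> Arr V" "Dom V f = Dom V g" "Cod V f = ehom (efdom F) a b"
    then have [simp]: "a \<in> eob E" "b \<in> eob E" "c \<in> eob E"
      "g \<in> Arr V" "Cod V g = ehom E b c" "f \<in> Arr V" "Dom V f = Dom V g" "Cod V f = ehom E a b"
      by simp_all
    have "icomposable V C (j b c \<cdot> g) (j a b \<cdot> f)"
      by (simp add: icomposable_def)
    then have "ifun1 u \<cdot> icomp V C (j b c \<cdot> g) (j a b \<cdot> f) =
        icomp V C' (ifun1 u \<cdot> (j b c \<cdot> g)) (ifun1 u \<cdot> (j a b \<cdot> f))"
      using R.internal_functor_icomp[OF u(1)] u(2,3) by simp
    then have "j' (v a) (v c) \<cdot> (efhom F a c \<cdot> R.ecomp E a b c g f) =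
        j' (v a) (v c) \<cdot> R.ecomp E' (v a) (v b) (v c) (efhom F b c \<cdot> g) (efhom F a b \<cdot> f)"
      by (simp add: jF' R.j_ecomp R'.j_ecomp)
    then have "efhom F a c \<cdot> R.ecomp E a b c g f = R.ecomp E' (v a) (v b) (v c) (efhom F b c \<cdot> g) (efhom F a b \<cdot> f)"
      by (rule R'.j_mono[rotated -1]) simp_all
    then show "efhom F a c \<cdot> R.ecomp (efdom F) a b c g f =
        R.ecomp (efcod F) (efob F a) (efob F b) (efob F c) (efhom F b c \<cdot> g) (efhom F a b \<cdot> f)"
      by simp
  next
    show "efhom F a b = undefined" if "\<not> (a \<in> eob (efdom F) \<and> b \<in> eob (efdom F))" for a b
      using that by (auto simp: F_def)
  qed (use v R.enriched_category_axioms R'.enriched_category_axioms in \<open>simp_all add: in_hom_iff\<close>)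
  then show "\<exists>F. enriched_functor \<U> V F \<and> efdom F = E \<and> efcod F = E' \<and> efob F = v \<and>
      (\<forall>a \<in> eob E. \<forall>b \<in> eob E. ifun1 u \<cdot> j a b = j' (v a) (v b) \<cdot> efhom F a b)"
    using jF by (intro exI[of _ F]) simp
next
  have [simp]: "v a \<in> eob E'" if "a \<in> eob E" for a
    using v that by blast
  fix F G
  assume F: "enriched_functor \<U> V F \<and> efdom F = E \<and> efcod F = E' \<and> efob F = v \<and>
      (\<forall>a \<in> eob E. \<forall>b \<in> eob E. ifun1 u \<cdot> j a b = j' (v a) (v b) \<cdot> efhom F a b)"
    and G: "enriched_functor \<U> V G \<and> efdom G = E \<and> efcod G = E' \<and> efob G = v \<and>
      (\<forall>a \<in> eob E. \<forall>b \<in> eob E. ifun1 u \<cdot> j a b = j' (v a) (v b) \<cdot> efhom G a b)"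
  show "F = G"
  proof (rule R.enriched_functor_eqI)
    fix a b assume "a \<in> eob (efdom G)" "b \<in> eob (efdom G)"
    then have ab: "a \<in> eob E" "b \<in> eob E"
      using G by simp_all
    then have "j' (v a) (v b) \<cdot> efhom F a b = j' (v a) (v b) \<cdot> efhom G a b"
      using F G by metis
    then show "efhom F a b = efhom G a b"
      by (rule R'.j_mono[rotated -1]) (use ab F G R.enriched_functorD(5-7)[of F a b] R.enriched_functorD(5-7)[of G a b] in auto)
  qed (use F G in simp_all)
qed

text \<open>Both components are obtained by copairing, over the points of \<open>icat0 C\<close> and
  over the hom objects. Uniqueness and the functor laws are tested on these summands; only
  compatibility with composition needs typed pairs.\<close>

lemma internal_of_enriched:
  assumes F: "enriched_functor \<U> V F" "efdom F = E" "efcod F = E'"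
  shows "\<exists>!u. internal_functor V u \<and> ifdom u = C \<and> ifcod u = C' \<and>
    (\<forall>a \<in> eob E. ifun0 u \<cdot> e a = e' (efob F a)) \<and>
    (\<forall>a \<in> eob E. \<forall>b \<in> eob E. ifun1 u \<cdot> j a b = j' (efob F a) (efob F b) \<cdot> efhom F a b)"
proof (rule ex_ex1I)
  note FD [simp] = R.enriched_functorD(4-7)[OF F(1), unfolded F(2,3)]
  let ?v = "efob F"
  have "is_coproduct V (eob E) (\<lambda>_. Unit V) (icat0 C) e"
    using R.disc by (simp add: R.discrete_def)
  from coproduct_copair[OF this, of "icat0 C'" "\<lambda>a. e' (?v a)"]
  obtain u0 where u0: "u0 \<in> hom V (icat0 C) (icat0 C')" "\<And>a. a \<in> eob E \<Longrightarrow> u0 \<cdot> e a = e' (?v a)"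
    by (auto simp: in_hom_iff)
  obtain u1 where u1: "u1 \<in> hom V (icat1 C) (icat1 C')"
    "\<And>a b. a \<in> eob E \<Longrightarrow> b \<in> eob E \<Longrightarrow> u1 \<cdot> j a b = j' (?v a) (?v b) \<cdot> efhom F a b"
    using R.copair_j[of "icat1 C'" "\<lambda>a b. j' (?v a) (?v b) \<cdot> efhom F a b"] by (auto simp: in_hom_iff)
  have [simp]: "u0 \<in> Arr V" "Dom V u0 = icat0 C" "Cod V u0 = icat0 C'"
    "u1 \<in> Arr V" "Dom V u1 = icat1 C" "Cod V u1 = icat1 C'"
    using u0(1) u1(1) by (auto simp: in_hom_iff)
  have u1': "u1 \<cdot> (j a b \<cdot> k) = j' (?v a) (?v b) \<cdot> (efhom F a b \<cdot> k)"
    if "a \<in> eob E" "b \<in> eob E" "k \<in> Arr V" "Cod V k = ehom E a b" for a b k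
    using that by (simp add: R.Cmp_reassoc[OF u1(2)])
  let ?u = "\<lparr>ifdom = C, ifcod = C', ifun0 = u0, ifun1 = u1\<rparr>"
  have src: "isrc C' \<cdot> u1 = u0 \<cdot> isrc C"
  proof (rule R.ext_j)
    show "isrc C' \<cdot> u1 \<in> hom V (icat1 C) (icat0 C')" "u0 \<cdot> isrc C \<in> hom V (icat1 C) (icat0 C')"
      by (simp_all add: in_hom_iff)
    show "isrc C' \<cdot> u1 \<cdot> j a b = u0 \<cdot> isrc C \<cdot> j a b" if "a \<in> eob E" "b \<in> eob E" for a b
      using that by (simp add: u1(2) R.s_j R.Cmp_reassoc[OF u0(2)])
  qed
  have tgt: "itgt C' \<cdot> u1 = u0 \<cdot> itgt C"
  proof (rule R.ext_j)
    show "itgt C' \<cdot> u1 \<in> hom V (icat1 C) (icat0 C')" "u0 \<cdot> itgt C \<in> hom V (icat1 C) (icat0 C')"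
      by (simp_all add: in_hom_iff)
    show "itgt C' \<cdot> u1 \<cdot> j a b = u0 \<cdot> itgt C \<cdot> j a b" if "a \<in> eob E" "b \<in> eob E" for a b
      using that by (simp add: u1(2) R.t_j R.Cmp_reassoc[OF u0(2)])
  qed
  have idt: "u1 \<cdot> iidt C = iidt C' \<cdot> u0"
  proof (rule R.discrete_map_unique[OF R.disc])
    show "u1 \<cdot> iidt C \<in> hom V (icat0 C) (icat1 C')" "iidt C' \<cdot> u0 \<in> hom V (icat0 C) (icat1 C')"
      by (simp_all add: in_hom_iff)
    show "u1 \<cdot> iidt C \<cdot> e a = iidt C' \<cdot> u0 \<cdot> e a" if a [simp]: "a \<in> eob E" for a
      using enriched_functor.efhom_eidt[OF F(1), of a] F(2,3) u1'[of a a "eidt E a"]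
      by (simp add: u0(2) R.j_eidt R'.j_eidt)
  qed
  have "internal_functor V ?u"
  proof (rule R.internal_functorI)
    fix g f assume "icomposable V (ifdom ?u) g f"
    then have gf: "icomposable V C g f"
      by simp
    then have D [simp]: "g \<in> Arr V" "f \<in> Arr V" "Cod V g = icat1 C" "Cod V f = icat1 C" "Dom V g = Dom V f"
      and st: "isrc C \<cdot> g = itgt C \<cdot> f"
      by (auto simp: icomposable_def)
    have c: "icomposable V C' (u1 \<cdot> g) (u1 \<cdot> f)"
      by (simp add: icomposable_def R.Cmp_reassoc[OF src] R.Cmp_reassoc[OF tgt] st)
    have "u1 \<cdot> icomp V C g f = icomp V C' (u1 \<cdot> g) (u1 \<cdot> f)"
    proof (rule R.ext_elements[of "[g, f]" "Dom V f"])
      show "u1 \<cdot> icomp V C g f \<in> hom V (Dom V f) (icat1 C')" "icomp V C' (u1 \<cdot> g) (u1 \<cdot> f) \<in> hom V (Dom V f) (icat1 C')"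
        using R.icomp_arr[OF gf] R'.icomp_arr[OF c] by (simp_all add: in_hom_iff)
      fix k assume k [simp]: "k \<in> Arr V" "Cod V k = Dom V f" and el: "\<And>z. z \<in> set [g, f] \<Longrightarrow> \<exists>a b. R.el a b (z \<cdot> k)"
      obtain b b' a c where g: "R.el b c (g \<cdot> k)" and f: "R.el a b' (f \<cdot> k)"
        using el[of g] el[of f] by auto
      \<comment> \<open>The target of \<open>f \<cdot> k\<close> is replaced by the source
        \<open>b\<close> of \<open>g \<cdot> k\<close>, so that the pair comes from elements of
        \<open>ehom E b c\<close> and \<open>ehom E a b\<close>.\<close>
      have f: "R.el a b (f \<cdot> k)"
        by (rule R.el_source[OF g f]) (simp_all add: R.Cmp_reassoc[OF st])
      have [simp]: "a \<in> eob E" "b \<in> eob E" "c \<in> eob E"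
        using g f by (auto simp: R.el_def)
      obtain g' f' where [simp]: "g' \<in> Arr V" "f' \<in> Arr V" "Dom V g' = Dom V k" "Dom V f' = Dom V k"
          "Cod V g' = ehom E b c" "Cod V f' = ehom E a b"
        and e: "g \<cdot> k = j b c \<cdot> g'" "f \<cdot> k = j a b \<cdot> f'"
        using R.fac[OF g] R.fac[OF f] by (metis D(1,2,3,5) k R.Cmp_arr(2))
      have "u1 \<cdot> icomp V C g f \<cdot> k = u1 \<cdot> icomp V C (j b c \<cdot> g') (j a b \<cdot> f')"
        using R.icomp_arr[OF gf] by (simp add: R.icomp_nat[OF gf] e)
      also have "\<dots> = u1 \<cdot> (j a c \<cdot> R.ecomp E a b c g' f')"
        by (simp add: R.j_ecomp)
      also have "\<dots> = j' (?v a) (?v c) \<cdot> R.ecomp E' (?v a) (?v b) (?v c) (efhom F b c \<cdot> g') (efhom F a b \<cdot> f')"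
        using R.enriched_functor_ecomp[OF F(1), of a b c g' f'] F(2,3) by (simp add: u1')
      also have "\<dots> = icomp V C' (u1 \<cdot> (g \<cdot> k)) (u1 \<cdot> (f \<cdot> k))"
        by (simp add: R'.j_ecomp e u1')
      also have "\<dots> = icomp V C' (u1 \<cdot> g) (u1 \<cdot> f) \<cdot> k"
        by (simp add: R'.icomp_nat[OF c])
      finally show "u1 \<cdot> icomp V C g f \<cdot> k = icomp V C' (u1 \<cdot> g) (u1 \<cdot> f) \<cdot> k" .
    qed (auto simp: in_hom_iff)
    then show "ifun1 ?u \<cdot> icomp V (ifdom ?u) g f = icomp V (ifcod ?u) (ifun1 ?u \<cdot> g) (ifun1 ?u \<cdot> f)"
      by simp
  qed (use src tgt idt u0 u1 R.internal_category_axioms R'.internal_category_axioms in simp_all)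
  then show "\<exists>u. internal_functor V u \<and> ifdom u = C \<and> ifcod u = C' \<and>
    (\<forall>a \<in> eob E. ifun0 u \<cdot> e a = e' (efob F a)) \<and>
    (\<forall>a \<in> eob E. \<forall>b \<in> eob E. ifun1 u \<cdot> j a b = j' (efob F a) (efob F b) \<cdot> efhom F a b)"
    using u0(2) u1(2) by (intro exI[of _ ?u]) simp
next
  fix u w
  assume u: "internal_functor V u \<and> ifdom u = C \<and> ifcod u = C' \<and>
      (\<forall>a \<in> eob E. ifun0 u \<cdot> e a = e' (efob F a)) \<and>
      (\<forall>a \<in> eob E. \<forall>b \<in> eob E. ifun1 u \<cdot> j a b = j' (efob F a) (efob F b) \<cdot> efhom F a b)"
    and w: "internal_functor V w \<and> ifdom w = C \<and> ifcod w = C' \<and>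
      (\<forall>a \<in> eob E. ifun0 w \<cdot> e a = e' (efob F a)) \<and>
      (\<forall>a \<in> eob E. \<forall>b \<in> eob E. ifun1 w \<cdot> j a b = j' (efob F a) (efob F b) \<cdot> efhom F a b)"
  have "ifun0 u = ifun0 w"
    by (rule R.discrete_map_unique[OF R.disc, of _ "icat0 C'"])
      (use u w R.internal_functorD[of u] R.internal_functorD[of w] in \<open>auto simp: in_hom_iff\<close>)
  moreover have "ifun1 u = ifun1 w"
    by (rule R.ext_j[of _ "icat1 C'"])
      (use u w R.internal_functorD[of u] R.internal_functorD[of w] in \<open>auto simp: in_hom_iff\<close>)
  ultimately show "u = w"
    using u w by simp
qed

end

section \<open>The pseudopullback in terms of points\<close>

context lextensive_cartesian
begin

lemma discrete_iso:
  assumes D: "discrete A D e" and \<psi>: "\<psi> \<in> hom V D D'" "\<psi>' \<in> hom V D' D"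
    "\<psi> \<cdot> \<psi>' = Idt V D'" "\<psi>' \<cdot> \<psi> = Idt V D"
  shows "discrete A D' (\<lambda>a. \<psi> \<cdot> e a)"
proof -
  note [simp] = discrete_arr[OF D]
  have [simp]: "\<psi> \<in> Arr V" "Dom V \<psi> = D" "Cod V \<psi> = D'" "\<psi>' \<in> Arr V" "Dom V \<psi>' = D'" "Cod V \<psi>' = D"
    using \<psi> by (auto simp: in_hom_iff)
  have c: "is_coproduct V A (\<lambda>_. Unit V) D e" and A: "A \<in> \<U>"
    using D by (simp_all add: discrete_def)
  have "is_coproduct V A (\<lambda>_. Unit V) D' (\<lambda>a. \<psi> \<cdot> e a)"
    unfolding is_coproduct_def
  proof (intro conjI ballI allI impI)
    show "D' \<in> Obj V"
      using Cod_Obj'[of \<psi>] by simp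
    fix y f assume y: "y \<in> Obj V" and f: "\<forall>a \<in> A. f a \<in> hom V (Unit V) y"
    obtain h where h: "h \<in> hom V D y" "\<forall>a \<in> A. h \<cdot> e a = f a"
      using coproduct_copair[OF c y, of f] f by blast
    show "\<exists>!h. h \<in> hom V D' y \<and> (\<forall>a \<in> A. h \<cdot> (\<psi> \<cdot> e a) = f a)"
    proof (rule ex1I)
      show "h \<cdot> \<psi>' \<in> hom V D' y \<and> (\<forall>a \<in> A. h \<cdot> \<psi>' \<cdot> (\<psi> \<cdot> e a) = f a)"
        using h by (auto simp: in_hom_iff Cmp_reassoc[OF \<psi>(4)])
    next
      fix k assume k: "k \<in> hom V D' y \<and> (\<forall>a \<in> A. k \<cdot> (\<psi> \<cdot> e a) = f a)"
      have "k \<cdot> \<psi> = h"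
        by (rule discrete_map_unique[OF D, of _ y]) (use h k in \<open>auto simp: in_hom_iff\<close>)
      then have "h \<cdot> \<psi>' = k \<cdot> (\<psi> \<cdot> \<psi>')"
        using k by (auto simp: in_hom_iff)
      then show "k = h \<cdot> \<psi>'"
        using k \<psi>(3) by (simp add: in_hom_iff)
    qed
  qed (auto simp: in_hom_iff)
  then show ?thesis
    using A by (simp add: discrete_def)
qed

text \<open>At the point \<open>e a\<close> the left composite is the injection at
  \<open>v a\<close>, that is \<open>\<theta>' \<cdot> e' (v a)\<close>. Points are jointly epic and
  \<open>\<theta>'\<close> is invertible, so the square can be tested pointwise with
  \<open>\<theta>'\<close> cancelled.\<close>

lemma J_square_iff:
  assumes D: "discrete A D e" and A: "A' \<in> \<U>" and \<theta>: "\<theta> \<in> hom V D (copower V A)" "\<And>a. a \<in> A \<Longrightarrow> \<theta> \<cdot> e a = copower_inj V A a"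
    and \<theta>': "\<theta>' \<in> hom V D' (copower V A')" "is_iso V \<theta>'"
    and e': "\<And>a. a \<in> A' \<Longrightarrow> e' a \<in> hom V (Unit V) D'" "\<And>a. a \<in> A' \<Longrightarrow> \<theta>' \<cdot> e' a = copower_inj V A' a"
    and v: "v \<in> A \<rightarrow> A'" and u: "u \<in> hom V D D'"
  shows "FA (J_fctr V) (A, A', v) \<cdot> \<theta> = \<theta>' \<cdot> u \<longleftrightarrow> (\<forall>a \<in> A. u \<cdot> e a = e' (v a))"
proof -
  note [simp] = discrete_arr[OF D]
  have AU: "A \<in> \<U>"
    using D by (simp add: discrete_def)
  have v' [simp]: "v a \<in> A'" if "a \<in> A" for a
    using v that by blast
  have [simp]: "e' a \<in> Arr V" "Dom V (e' a) = Unit V" "Cod V (e' a) = D'" if "a \<in> A'" for a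
    using e'(1)[OF that] by (auto simp: in_hom_iff)
  let ?J = "FA (J_fctr V) (A, A', v)"
  have [simp]: "?J \<in> Arr V" "Dom V ?J = copower V A" "Cod V ?J = copower V A'" "\<theta> \<in> Arr V" "Dom V \<theta> = D"
    "Cod V \<theta> = copower V A" "\<theta>' \<in> Arr V" "Dom V \<theta>' = D'" "Cod V \<theta>' = copower V A'" "u \<in> Arr V" "Dom V u = D" "Cod V u = D'"
    using J_map(1)[OF AU A v] \<theta>(1) \<theta>'(1) u by (auto simp: in_hom_iff)
  have J: "?J \<cdot> (\<theta> \<cdot> e a) = \<theta>' \<cdot> e' (v a)" if "a \<in> A" for a
    using that J_map(2)[OF AU A v that] by (simp add: \<theta>(2) e'(2))
  obtain \<psi> where \<psi>: "\<psi> \<in> Arr V" "Dom V \<psi> = copower V A'" "Cod V \<psi> = D'" "\<psi> \<cdot> \<theta>' = Idt V D'"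
    using \<theta>'(2) by (auto simp: is_iso_def in_hom_iff)
  show ?thesis
  proof
    assume sq: "?J \<cdot> \<theta> = \<theta>' \<cdot> u"
    show "\<forall>a \<in> A. u \<cdot> e a = e' (v a)"
    proof
      fix a assume a: "a \<in> A"
      have "\<theta>' \<cdot> (u \<cdot> e a) = \<theta>' \<cdot> e' (v a)"
        using a J[OF a] Cmp_reassoc[OF sq, of "e a"] by simp
      then have "\<psi> \<cdot> (\<theta>' \<cdot> (u \<cdot> e a)) = \<psi> \<cdot> (\<theta>' \<cdot> e' (v a))"
        by simp
      then show "u \<cdot> e a = e' (v a)"
        using a \<psi>(1-3) by (simp add: Cmp_reassoc[OF \<psi>(4)])
    qed
  next
    assume "\<forall>a \<in> A. u \<cdot> e a = e' (v a)"
    then have "?J \<cdot> \<theta> \<cdot> e a = \<theta>' \<cdot> u \<cdot> e a" if "a \<in> A" for a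
      using J that by simp
    then show "?J \<cdot> \<theta> = \<theta>' \<cdot> u"
      by (rule discrete_map_unique[OF D, of _ "copower V A'", rotated -1]) (simp_all add: in_hom_iff)
  qed
qed

abbreviation PP where
  "PP \<equiv> pseudopullback (Cat_int V) (Set_cat \<U>) V U0_fctr (J_fctr V)"

lemma PP_Obj: "(C, A, \<theta>) \<in> Obj PP \<longleftrightarrow>
    internal_category V C \<and> A \<in> \<U> \<and> \<theta> \<in> hom V (icat0 C) (copower V A) \<and> is_iso V \<theta>"
  by (simp add: pseudopullback_def Cat_int_def Set_cat_def U0_fctr_def J_fctr_def)

lemma PP_hom: "w \<in> hom PP (C, A, \<theta>) (C', A', \<theta>') \<longleftrightarrow>
    (C, A, \<theta>) \<in> Obj PP \<and> (C', A', \<theta>') \<in> Obj PP \<and>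
    (\<exists>u v. w = ((C, A, \<theta>), (C', A', \<theta>'), u, (A, A', v)) \<and> internal_functor V u \<and> ifdom u = C \<and> ifcod u = C' \<and>
      v \<in> A \<rightarrow>\<^sub>E A' \<and> FA (J_fctr V) (A, A', v) \<cdot> \<theta> = \<theta>' \<cdot> ifun0 u)"
proof -
  have U0: "FA U0_fctr u = ifun0 u" for u :: "('o, 'a) ifun"
    by (simp add: U0_fctr_def)
  show ?thesis
    unfolding PP_Obj in_hom_iff
    by (auto simp: pseudopullback_def in_hom_iff Cat_int_def Set_cat_def U0) (auto simp: U0_fctr_def J_fctr_def)
qed

lemma category_PP: "category PP"
  by (rule category_pseudopullback)
    (simp_all add: category_Cat_int category_Set_cat is_functor_U0_fctr is_functor_J_fctr category_axioms)

end

section \<open>The span of representations\<close>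

context lextensive_cartesian
begin

text \<open>The last condition ties the points to the isomorphism: as \<open>\<theta>\<close> is
  invertible, \<open>e a\<close> must be the inverse image of the chosen injection.\<close>

definition reps where
  "reps = {((C, A, \<theta>), E, e, j). (C, A, \<theta>) \<in> Obj PP \<and> representation \<U> V C E e j \<and> eob E = A \<and>
     (\<forall>a \<in> A. \<theta> \<cdot> e a = copower_inj V A a)}"

text \<open>The object part \<open>ifun0 u \<cdot> e a = e' (v a)\<close> does not appear, since by
  \<open>J_square_iff\<close> the square carried by an arrow of \<open>PP\<close> already expresses
  it.\<close>

definition matches where
  "matches = (\<lambda>(x, E, e, j) (x', E', e', j') (y, y', u, (B, B', v)) F.
     efob F = v \<and> (\<forall>a \<in> eob E. \<forall>b \<in> eob E. ifun1 u \<cdot> j a b = j' (v a) (v b) \<cdot> efhom F a b))"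

lemma Cat_enr_hom: "F \<in> hom (Cat_enr \<U> V) E E' \<longleftrightarrow> enriched_functor \<U> V F \<and> efdom F = E \<and> efcod F = E'"
  by (auto simp: Cat_enr_def in_hom_iff)

lemma reps_pair:
  assumes "((C, A, \<theta>), E, e, j) \<in> reps" "((C', A', \<theta>'), E', e', j') \<in> reps"
  shows "representation_pair \<U> V C E e j C' E' e' j'" "eob E = A" "eob E' = A'"
    and "\<lbrakk>v \<in> A \<rightarrow> A'; u \<in> hom V (icat0 C) (icat0 C')\<rbrakk> \<Longrightarrow>
      FA (J_fctr V) (A, A', v) \<cdot> \<theta> = \<theta>' \<cdot> u \<longleftrightarrow> (\<forall>a \<in> A. u \<cdot> e a = e' (v a))"
proof -
  have r: "representation \<U> V C E e j" "representation \<U> V C' E' e' j'"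
    using assms by (auto simp: reps_def)
  then show "representation_pair \<U> V C E e j C' E' e' j'"
    by (simp add: representation_pair_def)
  show e: "eob E = A" "eob E' = A'"
    using assms by (auto simp: reps_def)
  interpret R: representation \<U> V C E e j by (rule r)
  interpret R': representation \<U> V C' E' e' j' by (rule r)
  assume "v \<in> A \<rightarrow> A'" "u \<in> hom V (icat0 C) (icat0 C')"
  then show "FA (J_fctr V) (A, A', v) \<cdot> \<theta> = \<theta>' \<cdot> u \<longleftrightarrow> (\<forall>a \<in> A. u \<cdot> e a = e' (v a))"
    using assms R.disc discrete_arr[OF R'.disc] e
    by (intro J_square_iff) (auto simp: reps_def PP_Obj in_hom_iff)
qed

lemma reps_over_object:
  assumes "x \<in> Obj PP"
  shows "\<exists>r \<in> reps. fst r = x"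
proof -
  obtain C A \<theta> where x: "x = (C, A, \<theta>)"
    by (cases x)
  then have o: "internal_category V C" "A \<in> \<U>" "\<theta> \<in> hom V (icat0 C) (copower V A)" "is_iso V \<theta>"
    using assms by (simp_all add: PP_Obj)
  then obtain \<psi> where \<psi>: "\<psi> \<in> hom V (copower V A) (icat0 C)" "\<psi> \<cdot> \<theta> = Idt V (icat0 C)"
    "\<theta> \<cdot> \<psi> = Idt V (copower V A)"
    by (auto simp: is_iso_def in_hom_iff)
  \<comment> \<open>The points of \<open>icat0 C\<close> are the chosen injections transported along
    the inverse \<open>\<psi>\<close> of \<open>\<theta>\<close>.\<close>
  have "discrete A (icat0 C) (\<lambda>a. \<psi> \<cdot> copower_inj V A a)"
    by (rule discrete_iso[OF discrete_copower[OF o(2)] \<psi>(1) o(3) \<psi>(2,3)])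
  from representation_of_internal[OF o(1) this] obtain E j
    where "eob E = A" "representation \<U> V C E (\<lambda>a. \<psi> \<cdot> copower_inj V A a) j"
    by blast
  moreover have "\<theta> \<cdot> (\<psi> \<cdot> copower_inj V A a) = copower_inj V A a" if "a \<in> A" for a
    using o(2,3) \<psi>(1) that by (simp add: in_hom_iff Cmp_reassoc[OF \<psi>(3)])
  ultimately have "(x, E, \<lambda>a. \<psi> \<cdot> copower_inj V A a, j) \<in> reps"
    using assms x by (simp add: reps_def)
  then show ?thesis
    by force
qed

lemma reps_over_enriched:
  assumes E: "enriched_category \<U> V E"
  shows "\<exists>r \<in> reps. fst (snd r) = E"
proof -
  have A: "eob E \<in> \<U>"
    using E by (simp add: enriched_category_def)
  \<comment> \<open>The internal category is built directly on the chosen copower, so that the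
    identity can serve as \<open>\<theta>\<close>.\<close>
  obtain C j where C: "icat0 C = copower V (eob E)" "representation \<U> V C E (copower_inj V (eob E)) j"
    using representation_of_enriched[OF E discrete_copower[OF A]] by blast
  have "internal_category V C"
    using C(2) by (simp add: representation_def internal_category_in_def)
  moreover have "is_iso V (Idt V (copower V (eob E)))"
    unfolding is_iso_def using A by (auto simp: in_hom_iff intro!: bexI[of _ "Idt V (copower V (eob E))"])
  ultimately have "((C, eob E, Idt V (copower V (eob E))), E, copower_inj V (eob E), j) \<in> reps"
    using A C by (simp add: reps_def PP_Obj in_hom_iff)
  then show ?thesis
    by force
qed

text \<open>The square of \<open>w\<close> gives the values of \<open>ifun0 u\<close> at the points,
  which is the hypothesis under which \<open>enriched_of_internal\<close> supplies exactly one
  enriched functor.\<close>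

lemma lift_unique:
  assumes r: "r \<in> reps" "r' \<in> reps" and w: "w \<in> hom PP (fst r) (fst r')"
  shows "\<exists>!F. F \<in> hom (Cat_enr \<U> V) (fst (snd r)) (fst (snd r')) \<and> matches r r' w F"
proof -
  obtain C A \<theta> E e j C' A' \<theta>' E' e' j' where rr: "r = ((C, A, \<theta>), E, e, j)" "r' = ((C', A', \<theta>'), E', e', j')"
    by (cases r; cases r') auto
  note P = reps_pair[OF r[unfolded rr]]
  interpret P: representation_pair \<U> V C E e j C' E' e' j'
    by (rule P(1))
  obtain u v where w: "w = ((C, A, \<theta>), (C', A', \<theta>'), u, (A, A', v))" and u: "internal_functor V u" "ifdom u = C" "ifcod u = C'"
    and v: "v \<in> A \<rightarrow>\<^sub>E A'" and sq: "FA (J_fctr V) (A, A', v) \<cdot> \<theta> = \<theta>' \<cdot> ifun0 u"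
    using w by (auto simp: rr PP_hom)
  have v': "v \<in> A \<rightarrow> A'"
    using v by auto
  have "ifun0 u \<in> hom V (icat0 C) (icat0 C')"
    using internal_functorD[OF u(1)] u by (simp add: in_hom_iff)
  then have ue: "ifun0 u \<cdot> e a = e' (v a)" if "a \<in> eob E" for a
    using P(4)[OF v'] sq that P(2) by blast
  show ?thesis
    using P.enriched_of_internal[OF u _ ue] v P(2,3)
    by (simp add: rr w matches_def Cat_enr_hom conj_assoc cong: conj_cong)
qed

lemma lift_unique':
  assumes r: "r \<in> reps" "r' \<in> reps" and F: "F \<in> hom (Cat_enr \<U> V) (fst (snd r)) (fst (snd r'))"
  shows "\<exists>!w. w \<in> hom PP (fst r) (fst r') \<and> matches r r' w F"
proof -
  obtain C A \<theta> E e j C' A' \<theta>' E' e' j' where rr: "r = ((C, A, \<theta>), E, e, j)" "r' = ((C', A', \<theta>'), E', e', j')"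
    by (cases r; cases r') auto
  note P = reps_pair[OF r[unfolded rr]]
  interpret P: representation_pair \<U> V C E e j C' E' e' j'
    by (rule P(1))
  have F: "enriched_functor \<U> V F" "efdom F = E" "efcod F = E'"
    using F by (auto simp: rr Cat_enr_hom)
  have v: "efob F \<in> A \<rightarrow>\<^sub>E A'"
    using enriched_functorD(3)[OF F(1)] F P(2,3) by simp
  then have v': "efob F \<in> A \<rightarrow> A'"
    by auto
  have o: "(C, A, \<theta>) \<in> Obj PP" "(C', A', \<theta>') \<in> Obj PP"
    using r by (auto simp: rr reps_def)
  let ?Q = "\<lambda>u. internal_functor V u \<and> ifdom u = C \<and> ifcod u = C' \<and>
    (\<forall>a \<in> eob E. ifun0 u \<cdot> e a = e' (efob F a)) \<and>
    (\<forall>a \<in> eob E. \<forall>b \<in> eob E. ifun1 u \<cdot> j a b = j' (efob F a) (efob F b) \<cdot> efhom F a b)"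
  let ?w = "\<lambda>u. ((C, A, \<theta>), (C', A', \<theta>'), u, (A, A', efob F))"
  have sq: "FA (J_fctr V) (A, A', efob F) \<cdot> \<theta> = \<theta>' \<cdot> ifun0 u \<longleftrightarrow> (\<forall>a \<in> A. ifun0 u \<cdot> e a = e' (efob F a))"
    if "internal_functor V u" "ifdom u = C" "ifcod u = C'" for u
    using P(4)[OF v', of "ifun0 u"] internal_functorD[OF that(1)] that by (simp add: in_hom_iff)
  \<comment> \<open>The function of sets in a matching arrow must be \<open>efob F\<close>, so only
    its internal functor is free; the square and the matching condition together are the conditions
    of \<open>internal_of_enriched\<close>.\<close>
  have "w \<in> hom PP (fst r) (fst r') \<and> matches r r' w F \<longleftrightarrow> (\<exists>u. w = ?w u \<and> ?Q u)" for w
    using o v sq P(2) by (auto simp: rr PP_hom matches_def)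
  moreover obtain u where "?Q u" "\<And>u'. ?Q u' \<Longrightarrow> u' = u"
    using P.internal_of_enriched[OF F] by (elim ex1E) blast
  ultimately show ?thesis
    by (intro ex1I[of _ "?w u"]) blast+
qed

lemma matches_Idt:
  assumes "r \<in> reps"
  shows "matches r r (Idt PP (fst r)) (Idt (Cat_enr \<U> V) (fst (snd r)))"
proof -
  obtain C A \<theta> E e j where r: "r = ((C, A, \<theta>), E, e, j)"
    by (cases r) auto
  interpret R: representation \<U> V C E e j
    using assms by (simp add: r reps_def)
  have "eob E = A"
    using assms by (simp add: r reps_def)
  then show ?thesis
    by (auto simp: r matches_def pseudopullback_def Cat_enr_def Set_cat_def Cat_int_def)
qed

text \<open>The equations for \<open>u\<close> and \<open>u'\<close> paste: \<open>ifun1 u\<close>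
  moves \<open>j\<close> to \<open>j'\<close>, then \<open>ifun1 u'\<close> moves \<open>j'\<close>
  to \<open>j''\<close>, leaving the composite of the two hom maps.\<close>

lemma matches_Cmp:
  assumes r: "r \<in> reps" "r' \<in> reps" "r'' \<in> reps"
    and w: "w \<in> hom PP (fst r) (fst r')" "w' \<in> hom PP (fst r') (fst r'')"
    and F: "F \<in> hom (Cat_enr \<U> V) (fst (snd r)) (fst (snd r'))" "F' \<in> hom (Cat_enr \<U> V) (fst (snd r')) (fst (snd r''))"
    and m: "matches r r' w F" "matches r' r'' w' F'"
  shows "matches r r'' (Cmp PP w' w) (Cmp (Cat_enr \<U> V) F' F)"
proof -
  obtain C A \<theta> E e j C' A' \<theta>' E' e' j' C'' A'' \<theta>'' E'' e'' j''
    where rr: "r = ((C, A, \<theta>), E, e, j)" "r' = ((C', A', \<theta>'), E', e', j')" "r'' = ((C'', A'', \<theta>''), E'', e'', j'')"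
    by (cases r; cases r'; cases r'') auto
  interpret R: representation \<U> V C E e j
    using r by (simp add: rr reps_def)
  interpret R': representation \<U> V C' E' e' j'
    using r by (simp add: rr reps_def)
  interpret R'': representation \<U> V C'' E'' e'' j''
    using r by (simp add: rr reps_def)
  have [simp]: "eob E = A" "eob E' = A'" "eob E'' = A''"
    using r by (simp_all add: rr reps_def)
  obtain u v where weq: "w = ((C, A, \<theta>), (C', A', \<theta>'), u, (A, A', v))" and u: "internal_functor V u" "ifdom u = C" "ifcod u = C'"
    and v: "v \<in> A \<rightarrow>\<^sub>E A'"
    using w(1) by (auto simp: rr PP_hom)
  obtain u' v' where weq': "w' = ((C', A', \<theta>'), (C'', A'', \<theta>''), u', (A', A'', v'))"
    and u': "internal_functor V u'" "ifdom u' = C'" "ifcod u' = C''" and v': "v' \<in> A' \<rightarrow>\<^sub>E A''"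
    using w(2) by (auto simp: rr PP_hom)
  note [simp] = internal_functorD[OF u(1), unfolded u(2,3)] internal_functorD[OF u'(1), unfolded u'(2,3)]
  have F: "enriched_functor \<U> V F" "efdom F = E" "efcod F = E'"
    and F': "enriched_functor \<U> V F'" "efdom F' = E'" "efcod F' = E''"
    using F by (auto simp: rr Cat_enr_hom)
  note [simp] = enriched_functorD(4-7)[OF F(1), unfolded F(2,3)] enriched_functorD(4-7)[OF F'(1), unfolded F'(2,3)]
  have m': "efob F = v" "efob F' = v'"
    "\<And>a b. a \<in> A \<Longrightarrow> b \<in> A \<Longrightarrow> ifun1 u \<cdot> j a b = j' (v a) (v b) \<cdot> efhom F a b"
    "\<And>a b. a \<in> A' \<Longrightarrow> b \<in> A' \<Longrightarrow> ifun1 u' \<cdot> j' a b = j'' (v' a) (v' b) \<cdot> efhom F' a b"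
    using m by (simp_all add: rr weq weq' matches_def)
  have va [simp]: "v a \<in> A'" if "a \<in> A" for a
    using v that by blast
  have va' [simp]: "v' a \<in> A''" if "a \<in> A'" for a
    using v' that by blast
  have E: "efhom F a b \<in> Arr V" "Dom V (efhom F a b) = ehom E a b" "Cod V (efhom F a b) = ehom E' (v a) (v b)"
    if "a \<in> A" "b \<in> A" for a b
    using that enriched_functorD(5-7)[OF F(1), of a b] F m'(1) by simp_all
  have E': "efhom F' a b \<in> Arr V" "Dom V (efhom F' a b) = ehom E' a b" "Cod V (efhom F' a b) = ehom E'' (v' a) (v' b)"
    if "a \<in> A'" "b \<in> A'" for a b
    using that enriched_functorD(5-7)[OF F'(1), of a b] F' m'(2) by simp_all
  have "ifun1 u' \<cdot> ifun1 u \<cdot> j a b = j'' (v' (v a)) (v' (v b)) \<cdot> (efhom F' (v a) (v b) \<cdot> efhom F a b)"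
    if "a \<in> A" "b \<in> A" for a b
    using that E E' by (simp add: m'(3) Cmp_reassoc[OF m'(4)])
  then show ?thesis
    using F F' m'(1,2)
    by (simp add: rr weq weq' matches_def pseudopullback_def Cat_enr_def Set_cat_def Cat_int_def compose_def)
qed

lemma equivalent_PP_Cat_enr: "equivalent_categories PP (Cat_enr \<U> V)"
proof (rule category_span.equivalent)
  show "category_span PP (Cat_enr \<U> V) reps fst (\<lambda>r. fst (snd r)) matches"
  proof (intro category_span.intro category_span_axioms.intro)
    show "category PP" "category (Cat_enr \<U> V)"
      by (rule category_PP category_Cat_enr)+
    show "fst r \<in> Obj PP" if "r \<in> reps" for r
      using that by (auto simp: reps_def)
    show "fst (snd r) \<in> Obj (Cat_enr \<U> V)" if "r \<in> reps" for r
      using that by (auto simp: reps_def Cat_enr_def representation_def)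
    show "\<exists>r \<in> reps. fst r = x" if "x \<in> Obj PP" for x
      by (rule reps_over_object[OF that])
    show "\<exists>r \<in> reps. fst (snd r) = E" if "E \<in> Obj (Cat_enr \<U> V)" for E
      using that by (intro reps_over_enriched) (simp add: Cat_enr_def)
  qed (rule lift_unique lift_unique' matches_Idt matches_Cmp; assumption)+
qed

end

theorem lemma9p9:
  fixes V :: "('o, 'a) ccat" and \<U> :: "'i set set"
  assumes "small_sets \<U>"
    and "is_cartesian V"
    and "infinitary_lextensive \<U> V"
    and "fully_faithful (Set_cat \<U>) V (J_fctr V)"
  shows "equivalent_categories
    (pseudopullback (Cat_int V) (Set_cat \<U>) V U0_fctr (J_fctr V))
    (Cat_enr \<U> V)"
proof -
  interpret lextensive_cartesian \<U> V
    by (rule lextensive_cartesian.intro) (use assms in simp_all)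
  show ?thesis
    by (rule equivalent_PP_Cat_enr)
qed

end
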